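(* Let $n,k\ge 1$ be integers. Let $X$ be a random vector in $\mathbb{R}^n$ with $\frac1n\mathbb{E}[\|X\|^2]=\gamma\in(0,\infty)$, and let $\Theta$ be a $k\times n$ random matrix, independent of $X$, whose entries are i.i.d. Gaussian with mean zero and variance $1/n$. Let $Z=\Theta X$, let $P_{Z\mid\Theta}$ be the conditional distribution of $Z$ given $\Theta$, and let $G_Z=\mathcal{N}(0,\gamma I_k)$ (the Gaussian distribution with the same mean and covariance as $Z$). Then $$\frac1\gamma\,\mathbb{E}\left[W_2^2(P_{Z\mid\Theta},G_Z)\right]\le C\,k\,\frac{\alpha(X)}{\gamma}+C\,k^{3/4}\left(\frac{\beta_1(X)}{\gamma}\right)^{1/2}+C\,k\left(\frac{\beta_2(X)}{\gamma}\right)^{\frac{4}{k+4}},$$ where the expectation is with respect to $\Theta$ and $C$ is a universal constant; in particular, the inequality holds with $C=40$.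
   Context: $\|\cdot\|$ is the Euclidean norm and $\langle\cdot,\cdot\rangle$ the Euclidean inner product. For a random vector $X$ in $\mathbb{R}^n$ with $\mathbb{E}\|X\|^2<\infty$, define $$\alpha(X)=\frac1n\mathbb{E}\left[\left|\|X\|^2-\mathbb{E}[\|X\|^2]\right|\right],\qquad \beta_r(X)=\frac1n\left(\mathbb{E}\left[|\langle X_1,X_2\rangle|^r\right]\right)^{1/r},\quad r\in\{1,2\},$$ where $X_1,X_2$ are independent copies of $X$. The quadratic Wasserstein distance between distributions $P,Q$ on $\mathbb{R}^k$ is $W_2(P,Q)=\inf(\mathbb{E}\|U-V\|^2)^{1/2}$, the infimum being over all couplings $(U,V)$ with $U\sim P$, $V\sim Q$. *)

theory Defs
  imports "HOL-Probability.Probability"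
begin

text \<open>
  For a random vector \<open>X\<close> on a probability space \<open>M\<close>. The expectations are Bochner integrals,
  hence meaningful when \<open>\<parallel>X\<parallel>\<^sup>2\<close> is integrable (this covers \<open>\<beta>\<^sub>1\<close> and \<open>\<beta>\<^sub>2\<close> by Cauchy--Schwarz). The
  independent copies of \<open>X\<close> are \<open>X \<circ> fst\<close> and \<open>X \<circ> snd\<close> on the product space.
\<close>

definition alpha :: "'a measure \<Rightarrow> ('a \<Rightarrow> real ^ 'n) \<Rightarrow> real" where
  "alpha M X =
     1 / real CARD('n) * (\<integral>\<omega>. \<bar>(norm (X \<omega>))\<^sup>2 - (\<integral>\<omega>'. (norm (X \<omega>'))\<^sup>2 \<partial>M)\<bar> \<partial>M)"

definition beta :: "nat \<Rightarrow> 'a measure \<Rightarrow> ('a \<Rightarrow> real ^ 'n) \<Rightarrow> real" where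
  "beta r M X =
     1 / real CARD('n) *
     (\<integral>p. \<bar>X (fst p) \<bullet> X (snd p)\<bar> ^ r \<partial>(M \<Otimes>\<^sub>M M)) powr (1 / real r)"

definition ennreal_sqrt :: "ennreal \<Rightarrow> ennreal" where
  "ennreal_sqrt x = (if x = \<infinity> then \<infinity> else ennreal (sqrt (enn2real x)))"

text \<open>A coupling \<open>(U, V)\<close> is represented by its joint law.\<close>

definition couplings ::
  "(real ^ 'k) measure \<Rightarrow> (real ^ 'k) measure \<Rightarrow> ((real ^ 'k) \<times> (real ^ 'k)) measure set" where
  "couplings P Q =
     {\<pi>. prob_space \<pi> \<and> sets \<pi> = sets (borel \<Otimes>\<^sub>M borel) \<and>
         distr \<pi> borel fst = P \<and> distr \<pi> borel snd = Q}"

definition W2 :: "(real ^ 'k) measure \<Rightarrow> (real ^ 'k) measure \<Rightarrow> ennreal" where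
  "W2 P Q =
     ennreal_sqrt (INF \<pi>\<in>couplings P Q. \<integral>\<^sup>+p. ennreal ((norm (fst p - snd p))\<^sup>2) \<partial>\<pi>)"

text \<open>The centred Gaussian distribution with covariance \<open>v I\<^sub>k\<close>; here \<open>v\<close> is the variance,
  whereas \<^const>\<open>normal_density\<close> takes the standard deviation.\<close>

definition isotropic_gaussian :: "real \<Rightarrow> (real ^ 'k) measure" where
  "isotropic_gaussian v =
     density lborel (\<lambda>z. ennreal (\<Prod>i\<in>UNIV. normal_density 0 (sqrt v) (z $ i)))"

text \<open>\<open>\<kappa>\<close> is a (regular) conditional distribution of \<open>Z\<close> given \<open>Y\<close>, that is, a probability kernel
  with \<open>\<P>(Y \<in> A, Z \<in> B) = \<integral>\<^bsub>A\<^esub> \<kappa>(y)(B) \<P>\<^bsub>Y\<^esub>(dy)\<close>. It is determined up to \<open>\<P>\<^bsub>Y\<^esub>\<close>-null sets.\<close>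

definition is_conditional_distribution ::
  "'a measure \<Rightarrow> ('a \<Rightarrow> 'b::topological_space) \<Rightarrow> ('a \<Rightarrow> 'c::topological_space) \<Rightarrow>
   ('b \<Rightarrow> 'c measure) \<Rightarrow> bool" where
  "is_conditional_distribution M Y Z \<kappa> \<longleftrightarrow>
     \<kappa> \<in> borel \<rightarrow>\<^sub>M prob_algebra borel \<and>
     (\<forall>A\<in>sets borel. \<forall>B\<in>sets borel.
        emeasure M {\<omega> \<in> space M. Y \<omega> \<in> A \<and> Z \<omega> \<in> B} =
        (\<integral>\<^sup>+y\<in>A. emeasure (\<kappa> y) B \<partial>distr M borel Y))"

end

theory Submission
  imports Defs
begin

text \<open>
  Rescale to \<open>\<gamma> = 1\<close>. The point \<open>x\<close> is shrunk to \<open>x'\<close> with \<open>\<parallel>x'\<parallel>\<^sup>2 / n \<le> 1 - t\<close>, and \<open>\<Theta>x'\<close> is smoothed by an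
  independent Gaussian of variance \<open>v = 1 - \<parallel>x'\<parallel>\<^sup>2 / n \<ge> t\<close>. For every \<open>x\<close> the result is exactly standard
  normal when averaged over \<open>\<Theta>\<close>, so its conditional density \<open>f\<close> given \<open>\<Theta>\<close> has mean the standard normal
  density \<open>\<phi>\<close>. Shrinking and smoothing cost at most \<open>k (\<alpha> + 2 (1 - sqrt (1 - t)))\<close>. The remaining
  transport from \<open>f\<close> to \<open>\<phi>\<close> is bounded by the weighted total variation \<open>\<integral> \<parallel>y\<parallel>\<^sup>2 \<bar>f - \<phi>\<bar>\<close>, and
  Cauchy--Schwarz against the weight \<open>w = N(0, 2 I)\<close> reduces it to \<open>E \<integral> (f - \<phi>)\<^sup>2 / w\<close>. The second
  moment of \<open>f(y)\<close> over \<open>\<Theta>\<close> is a product of bivariate normal densities with correlation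
  \<open>r = \<langle>x\<^sub>1', x\<^sub>2'\<rangle> / n\<close>, which gives \<open>E (h(r) - h(0))\<close> with \<open>h(r) = (4 / ((3 - r) (1 - r)))\<^bsup>k/2\<^esup>\<close>.
  Expanding \<open>h\<close> to second order produces \<open>\<beta>\<^sub>1\<close> and \<open>\<beta>\<^sub>2\<^sup>2 t\<^bsup>-k/2\<^esup>\<close>, and \<open>t\<close> is chosen as
  \<open>2 \<beta>\<^sub>2\<^bsup>4/(k+4)\<^esup>\<close>. For \<open>k \<ge> 6\<close> the \<open>\<beta>\<^sub>1\<close> term is absorbed by \<open>\<beta>\<^sub>1 \<le> \<beta>\<^sub>2\<close>, as the bound is trivial
  unless \<open>\<beta>\<^sub>2\<close> is exponentially small in \<open>k\<close>.
\<close>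

section \<open>One-dimensional Gaussian integrals\<close>

text \<open>Letting the noise variance depend on the point makes the expected weighted square a pure
  variance without bias term, so that only the correlation of two independent copies survives in it.
  The price of the weight \<open>N(0, 2 I)\<close> is a factor \<open>(2 / sqrt 3) ^ k\<close> in
  the coefficient linear in \<open>r\<close>. Against \<open>k powr (3 / 4)\<close> a universal
  constant can pay for it only when \<open>k\<close> is small, hence the separate treatment of
  \<open>k \<ge> 6\<close>. The scale of \<open>t\<close> balances the shrinking cost, of order
  \<open>t\<close>, against \<open>\<beta>\<^sub>2 * t powr (- k / 4)\<close>, the root of the
  quadratic term. The constant 40 is an account: with \<open>b = t / 2\<close>, shrinking costs at
  most \<open>12 b\<close>, the quadratic term \<open>9 b\<close> and, for large \<open>k\<close>,
  the linear term another \<open>19 b\<close>; for \<open>b \<ge> 1 / 10\<close> the trivial bound 4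
  per coordinate is at most \<open>40 b\<close> anyway. Measurability of the transport cost as a
  function of the matrix is an obstacle that is bypassed: the cost is dominated by an explicit
  measurable majorant before it is integrated.\<close>

abbreviation (input) nd :: "real \<Rightarrow> real \<Rightarrow> real" where
  "nd v x \<equiv> normal_density 0 (sqrt v) x"

lemma nd_eq:
  assumes "v > 0"
  shows "nd v x = 1 / sqrt (2 * pi * v) * exp (- (x\<^sup>2 / (2 * v)))"
  using assms by (simp add: normal_density_def)

lemma nn_integral_normal_density:
  assumes "\<sigma> > 0"
  shows "(\<integral>\<^sup>+x. ennreal (normal_density \<mu> \<sigma> x) \<partial>lborel) = 1"
  using assms by (subst nn_integral_eq_integral) auto

lemma normal_density_shift: "normal_density 0 \<sigma> (x - m) = normal_density m \<sigma> x"
  by (simp add: normal_density_def)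

lemma nn_integral_nd_shift:
  assumes "v > 0"
  shows "(\<integral>\<^sup>+x. ennreal (nd v (x - m)) \<partial>lborel) = 1"
  using assms by (simp add: normal_density_shift nn_integral_normal_density)

lemma nn_integral_normal_density_square:
  assumes "\<sigma> > 0"
  shows "(\<integral>\<^sup>+x. ennreal (normal_density \<mu> \<sigma> x * (p - x)\<^sup>2) \<partial>lborel) = ennreal ((p - \<mu>)\<^sup>2 + \<sigma>\<^sup>2)"
proof -
  have 0: "has_bochner_integral lborel (\<lambda>x. normal_density \<mu> \<sigma> x * (x - \<mu>)\<^sup>2) (\<sigma>\<^sup>2)"
    using normal_moment_even[OF assms, of \<mu> 1] by (simp add: fact_numeral)
  have 1: "has_bochner_integral lborel (\<lambda>x. normal_density \<mu> \<sigma> x * x) \<mu>"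
    using normal_moment_nz_1[OF assms] .
  have 2: "has_bochner_integral lborel (\<lambda>x. normal_density \<mu> \<sigma> x) 1"
    using assms by (simp add: has_bochner_integral_iff)
  have "has_bochner_integral lborel (\<lambda>x. normal_density \<mu> \<sigma> x * (x - \<mu>)\<^sup>2
     + (normal_density \<mu> \<sigma> x * x) * (2 * (\<mu> - p)) + normal_density \<mu> \<sigma> x * (p\<^sup>2 - \<mu>\<^sup>2))
     (\<sigma>\<^sup>2 + \<mu> * (2 * (\<mu> - p)) + 1 * (p\<^sup>2 - \<mu>\<^sup>2))"
    by (intro has_bochner_integral_add has_bochner_integral_mult_left 0 1 2)
  also have "(\<lambda>x. normal_density \<mu> \<sigma> x * (x - \<mu>)\<^sup>2
     + (normal_density \<mu> \<sigma> x * x) * (2 * (\<mu> - p)) + normal_density \<mu> \<sigma> x * (p\<^sup>2 - \<mu>\<^sup>2))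
     = (\<lambda>x. normal_density \<mu> \<sigma> x * (p - x)\<^sup>2)"
    by (auto simp: fun_eq_iff algebra_simps power2_eq_square)
  also have "(\<sigma>\<^sup>2 + \<mu> * (2 * (\<mu> - p)) + 1 * (p\<^sup>2 - \<mu>\<^sup>2)) = (p - \<mu>)\<^sup>2 + \<sigma>\<^sup>2"
    by (auto simp: algebra_simps power2_eq_square)
  finally show ?thesis
    by (subst nn_integral_eq_integral) (auto simp: has_bochner_integral_iff)
qed

lemma nn_integral_nd_fourth:
  assumes "v > 0"
  shows "(\<integral>\<^sup>+x. ennreal (nd v x * x ^ 4) \<partial>lborel) = ennreal (3 * v\<^sup>2)"
proof -
  have "has_bochner_integral lborel (\<lambda>x. nd v x * x ^ 4) (3 * v\<^sup>2)"
    using normal_moment_even[of "sqrt v" 0 2] assms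
    by (simp add: fact_numeral power_mult_distrib power_mult[of "sqrt v" 2 2, simplified]
        power_divide)
  then show ?thesis
    using assms by (subst nn_integral_eq_integral) (auto simp: has_bochner_integral_iff)
qed

text \<open>
  Bivariate normal density with covariance matrix \<open>((A, R), (R, B))\<close>.
\<close>

definition gauss2 :: "real \<Rightarrow> real \<Rightarrow> real \<Rightarrow> real \<Rightarrow> real \<Rightarrow> real" where
  "gauss2 A B R p q = 1 / (2 * pi * sqrt (A * B - R\<^sup>2)) *
     exp (- ((B * p\<^sup>2 - 2 * R * p * q + A * q\<^sup>2) / (2 * (A * B - R\<^sup>2))))"

lemma gauss2_nonneg: "A * B > R\<^sup>2 \<Longrightarrow> gauss2 A B R p q \<ge> 0"
  by (simp add: gauss2_def)

lemma gauss2_zero: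
  assumes "A > 0" "B > 0"
  shows "gauss2 A B 0 p q = nd A p * nd B q"
proof -
  have "p\<^sup>2 / (2 * A) + q\<^sup>2 / (2 * B) = (B * p\<^sup>2 + A * q\<^sup>2) / (2 * (A * B))"
    using assms by (simp add: field_simps)
  then have e: "exp (- ((B * p\<^sup>2 + A * q\<^sup>2) / (2 * (A * B)))) = exp (- (p\<^sup>2 / (2 * A))) * exp (- (q\<^sup>2 / (2 * B)))"
    by (simp flip: exp_add)
  have s: "sqrt (2 * pi * A) * sqrt (2 * pi * B) = 2 * pi * sqrt (A * B)"
  proof -
    have "sqrt (2 * pi * A) * sqrt (2 * pi * B) = sqrt ((2 * pi)\<^sup>2 * (A * B))"
      unfolding real_sqrt_mult[symmetric] by (simp add: power2_eq_square)
    also have "\<dots> = 2 * pi * sqrt (A * B)"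
      by (subst real_sqrt_mult) (simp only: real_sqrt_abs abs_of_pos pi_gt_zero zero_less_numeral mult_pos_pos)
    finally show ?thesis .
  qed
  show ?thesis
    using assms by (simp add: gauss2_def nd_eq e flip: s)
qed

text \<open>
  Completing the square in \<open>x\<close>. Adding an independent multiple \<open>(a, b) N(0, V)\<close> updates the covariance,
  so that the entries of a Gaussian matrix can be integrated out one at a time; no rotation invariance
  is needed, and linearly dependent vectors need no special treatment.
\<close>

lemma gauss2_step_pointwise:
  fixes a b :: real
  assumes A: "A > 0" "B > 0" "A * B > R\<^sup>2" and V: "V > 0"
  defines "\<Delta> \<equiv> A * B - R\<^sup>2"
  defines "\<Delta>' \<equiv> (A + V * a\<^sup>2) * (B + V * b\<^sup>2) - (R + V * a * b)\<^sup>2"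
  shows "gauss2 A B R (p - x * a) (q - x * b) * nd V x =
    gauss2 (A + V * a\<^sup>2) (B + V * b\<^sup>2) (R + V * a * b) p q *
    normal_density (V * (B * p * a - R * (p * b + q * a) + A * q * b) / \<Delta>') (sqrt (\<Delta> * V / \<Delta>')) x"
    and "\<Delta>' > 0"
proof -
  define K where "K = B * a\<^sup>2 - 2 * R * a * b + A * b\<^sup>2"
  define L where "L = B * p * a - R * (p * b + q * a) + A * q * b"
  define Q where "Q = B * p\<^sup>2 - 2 * R * p * q + A * q\<^sup>2"
  have \<Delta>: "\<Delta> > 0" using A by (simp add: \<Delta>_def)
  \<comment> \<open>Positivity of the quadratic form \<open>K\<close>, by multiplying with its
    coefficient \<open>A\<close> and completing the square.\<close>
  have "A * K = (A * b - R * a)\<^sup>2 + \<Delta> * a\<^sup>2"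
    by (simp add: K_def \<Delta>_def algebra_simps power2_eq_square)
  then have "A * K \<ge> 0" using \<Delta> by simp
  then have K: "K \<ge> 0" using A by (simp add: zero_le_mult_iff)
  have \<Delta>'_eq: "\<Delta>' = \<Delta> + V * K"
    by (simp add: K_def \<Delta>_def \<Delta>'_def algebra_simps power2_eq_square)
  then show \<Delta>': "\<Delta>' > 0" using \<Delta> K V by (simp add: add_pos_nonneg)
  \<comment> \<open>\<open>K\<close>, \<open>Q\<close> and \<open>L\<close> are the values at
    \<open>(a, b)\<close>, at \<open>(p, q)\<close> and the mixed value of one quadratic form of
    determinant \<open>\<Delta>\<close>; this is its Lagrange identity. It lets the exponent split
    into a part in \<open>p, q\<close> alone and a square in \<open>x\<close>.\<close>
  have lag: "\<Delta> * (b * p - a * q)\<^sup>2 = Q * K - L\<^sup>2"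
    by (simp add: K_def L_def Q_def \<Delta>_def algebra_simps power2_eq_square)
  define s where "s = \<Delta> * V / \<Delta>'"
  have s: "s > 0" using \<Delta> \<Delta>' V by (simp add: s_def)
  define Q' where "Q' = (B + V * b\<^sup>2) * p\<^sup>2 - 2 * (R + V * a * b) * p * q + (A + V * a\<^sup>2) * q\<^sup>2"
  have Q': "Q' = Q + V * (b * p - a * q)\<^sup>2"
    by (simp add: Q_def Q'_def algebra_simps power2_eq_square)
  have ex: "(B * (p - x * a)\<^sup>2 - 2 * R * (p - x * a) * (q - x * b) + A * (q - x * b)\<^sup>2) / (2 * \<Delta>) + x\<^sup>2 / (2 * V)
     = Q' / (2 * \<Delta>') + (x - V * L / \<Delta>')\<^sup>2 / (2 * s)"
  proof -
    have 1: "B * (p - x * a)\<^sup>2 - 2 * R * (p - x * a) * (q - x * b) + A * (q - x * b)\<^sup>2 = Q - 2 * x * L + x\<^sup>2 * K"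
      by (simp add: K_def L_def Q_def algebra_simps power2_eq_square)
    have 2: "(x - V * L / \<Delta>')\<^sup>2 / (2 * s) = (\<Delta>' * x\<^sup>2 - 2 * V * L * x + V\<^sup>2 * L\<^sup>2 / \<Delta>') / (2 * \<Delta> * V)"
      using \<Delta> \<Delta>' V by (simp add: s_def field_simps power2_eq_square)
    have 3: "Q' = (Q * \<Delta>' - V * L\<^sup>2) / \<Delta>"
    proof -
      have "Q' * \<Delta> = Q * \<Delta>' - V * L\<^sup>2"
        using arg_cong[OF lag, of "\<lambda>z. V * z"] unfolding Q' \<Delta>'_eq by (simp add: algebra_simps)
      then show ?thesis using \<Delta> by (simp add: field_simps)
    qed
    have 4: "Q' / (2 * \<Delta>') = (Q - V * L\<^sup>2 / \<Delta>') / (2 * \<Delta>)"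
      using \<Delta> \<Delta>' unfolding 3 by (simp add: field_simps)
    have 5: "(Q - 2 * x * L + x\<^sup>2 * K) / (2 * \<Delta>) + x\<^sup>2 / (2 * V) = (V * (Q - 2 * x * L) + \<Delta>' * x\<^sup>2) / (2 * \<Delta> * V)"
      using \<Delta> V unfolding \<Delta>'_eq by (simp add: field_simps)
    show ?thesis
      unfolding 1 2 4 5 using \<Delta> \<Delta>' V by (simp add: field_simps power2_eq_square)
  qed
  \<comment> \<open>The variance \<open>s\<close> satisfies
    \<open>\<Delta>' * s = \<Delta> * V\<close>, so the normalising constants agree as well.\<close>
  have pre: "1 / (2 * pi * sqrt \<Delta>) * (1 / sqrt (2 * pi * V)) = 1 / (2 * pi * sqrt \<Delta>') * (1 / sqrt (2 * pi * s))"
  proof -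
    have "sqrt \<Delta> * sqrt (2 * pi * V) = sqrt \<Delta>' * sqrt (2 * pi * s)"
      unfolding real_sqrt_mult[symmetric] s_def using \<Delta>' by (simp add: field_simps)
    then show ?thesis by (simp add: field_simps)
  qed
  have "gauss2 A B R (p - x * a) (q - x * b) * nd V x =
    (1 / (2 * pi * sqrt \<Delta>) * (1 / sqrt (2 * pi * V))) *
    exp (- ((B * (p - x * a)\<^sup>2 - 2 * R * (p - x * a) * (q - x * b) + A * (q - x * b)\<^sup>2) / (2 * \<Delta>) + x\<^sup>2 / (2 * V)))"
    unfolding gauss2_def nd_eq[OF V] \<Delta>_def[symmetric] minus_add_distrib exp_add by simp
  also have "\<dots> = (1 / (2 * pi * sqrt \<Delta>') * (1 / sqrt (2 * pi * s))) *
    exp (- (Q' / (2 * \<Delta>') + (x - V * L / \<Delta>')\<^sup>2 / (2 * s)))"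
    unfolding ex pre ..
  also have "\<dots> = gauss2 (A + V * a\<^sup>2) (B + V * b\<^sup>2) (R + V * a * b) p q * normal_density (V * L / \<Delta>') (sqrt s) x"
    unfolding gauss2_def normal_density_def \<Delta>'_def[symmetric] Q'_def[symmetric] minus_add_distrib exp_add
    using s by simp
  finally show "gauss2 A B R (p - x * a) (q - x * b) * nd V x =
    gauss2 (A + V * a\<^sup>2) (B + V * b\<^sup>2) (R + V * a * b) p q *
    normal_density (V * (B * p * a - R * (p * b + q * a) + A * q * b) / \<Delta>') (sqrt (\<Delta> * V / \<Delta>')) x"
    unfolding L_def s_def .
qed

lemma nn_integral_gauss2_step:
  assumes A: "A > 0" "B > 0" "A * B > R\<^sup>2" and V: "V > 0"
  shows "(\<integral>\<^sup>+x. ennreal (nd V x) * ennreal (gauss2 A B R (p - x * a) (q - x * b)) \<partial>lborel) =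
    ennreal (gauss2 (A + V * a\<^sup>2) (B + V * b\<^sup>2) (R + V * a * b) p q)"
proof -
  let ?\<Delta> = "(A + V * a\<^sup>2) * (B + V * b\<^sup>2) - (R + V * a * b)\<^sup>2"
  have pos: "?\<Delta> > 0" using gauss2_step_pointwise(2)[OF A V] .
  have s: "sqrt ((A * B - R\<^sup>2) * V / ?\<Delta>) > 0"
    using pos A V by simp
  have g: "gauss2 (A + V * a\<^sup>2) (B + V * b\<^sup>2) (R + V * a * b) p q \<ge> 0"
    using pos by (intro gauss2_nonneg) simp
  have "ennreal (nd V x) * ennreal (gauss2 A B R (p - x * a) (q - x * b)) =
     ennreal (gauss2 (A + V * a\<^sup>2) (B + V * b\<^sup>2) (R + V * a * b) p q) *
     ennreal (normal_density (V * (B * p * a - R * (p * b + q * a) + A * q * b) / ?\<Delta>) (sqrt ((A * B - R\<^sup>2) * V / ?\<Delta>)) x)" for x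
    unfolding ennreal_mult''[OF normal_density_nonneg, symmetric]
      ennreal_mult'[OF normal_density_nonneg, symmetric]
    using gauss2_step_pointwise(1)[OF A V, of p x a q b] by (simp add: mult.commute)
  then show ?thesis
    using s by (simp add: nn_integral_cmult nn_integral_normal_density)
qed

text \<open>On the diagonal the exponent is \<open>y\<^sup>2 / (1 + r)\<close>. Dividing by the
  \<open>N(0, 2)\<close> density subtracts \<open>y\<^sup>2 / 4\<close> and leaves an unnormalised
  Gaussian of variance \<open>2 (1 + r) / (3 - r)\<close>, positive for all \<bar>r\<bar> < 1; the
  right-hand side is its total mass.\<close>

lemma gauss2_diag_weighted:
  assumes r: "\<bar>r\<bar> < 1"
  shows "(\<integral>\<^sup>+y. ennreal (gauss2 1 1 r y y / nd 2 y) \<partial>lborel) = ennreal (2 / sqrt ((3 - r) * (1 - r)))"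
proof -
  define s where "s = 2 * (1 + r) / (3 - r)"
  have r1: "1 - r > 0" "1 + r > 0" "3 - r > 0" using r by auto
  have s: "s > 0" using r1 by (simp add: s_def)
  have r2: "1 - r\<^sup>2 = (1 - r) * (1 + r)" by (simp add: algebra_simps power2_eq_square)
  have "gauss2 1 1 r y y / nd 2 y = 2 / sqrt ((3 - r) * (1 - r)) * nd s y" for y
  proof -
    have "1 * y\<^sup>2 - 2 * r * y * y + 1 * y\<^sup>2 = (2 * (1 - r)) * y\<^sup>2"
      "2 * (1 * 1 - r\<^sup>2) = (2 * (1 - r)) * (1 + r)"
      by (simp_all add: algebra_simps power2_eq_square)
    then have e1: "(1 * y\<^sup>2 - 2 * r * y * y + 1 * y\<^sup>2) / (2 * (1 * 1 - r\<^sup>2)) = y\<^sup>2 / (1 + r)"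
      using r1 by (metis mult_divide_mult_cancel_left less_irrefl mult_eq_0_iff zero_neq_numeral)
    have e2: "y\<^sup>2 / (1 + r) - y\<^sup>2 / 4 = y\<^sup>2 / (2 * s)"
      using r1 by (simp add: s_def field_simps)
    have g: "gauss2 1 1 r y y = 1 / (2 * pi * sqrt ((1 - r) * (1 + r))) * exp (- (y\<^sup>2 / (1 + r)))"
      unfolding gauss2_def e1 by (simp add: r2)
    have "gauss2 1 1 r y y / nd 2 y = sqrt (4 * pi) / (2 * pi * sqrt ((1 - r) * (1 + r))) * exp (- (y\<^sup>2 / (1 + r) - y\<^sup>2 / 4))"
    proof -
      have e3: "exp (- (y\<^sup>2 / (1 + r) - y\<^sup>2 / 4)) = exp (- (y\<^sup>2 / (1 + r))) / exp (- (y\<^sup>2 / 4))"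
        by (simp flip: exp_diff)
      have "nd 2 y = 1 / sqrt (4 * pi) * exp (- (y\<^sup>2 / 4))"
        by (subst nd_eq) (simp_all add: mult.commute)
      then show ?thesis unfolding g e3 by simp
    qed
    also have "\<dots> = sqrt (4 * pi) / (2 * pi * sqrt ((1 - r) * (1 + r))) * exp (- (y\<^sup>2 / (2 * s)))"
      unfolding e2 ..
    also have "sqrt (4 * pi) / (2 * pi * sqrt ((1 - r) * (1 + r))) = 2 / sqrt ((3 - r) * (1 - r)) * (1 / sqrt (2 * pi * s))"
    proof -
      have "sqrt (4 * pi) * (sqrt ((3 - r) * (1 - r)) * sqrt (2 * pi * s)) = 2 * (2 * pi * sqrt ((1 - r) * (1 + r)))"
      proof -
        have "sqrt (4 * pi) * (sqrt ((3 - r) * (1 - r)) * sqrt (2 * pi * s)) = sqrt ((4 * pi)\<^sup>2 * ((1 - r) * (1 + r)))"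
          unfolding real_sqrt_mult[symmetric] using r1 by (simp add: s_def power2_eq_square)
        also have "\<dots> = 4 * pi * sqrt ((1 - r) * (1 + r))"
          by (subst real_sqrt_mult) (simp only: real_sqrt_abs abs_of_pos pi_gt_zero zero_less_numeral mult_pos_pos)
        finally show ?thesis by simp
      qed
      then show ?thesis
        using frac_eq_eq[of "2 * pi * sqrt ((1 - r) * (1 + r))" "sqrt ((3 - r) * (1 - r)) * sqrt (2 * pi * s)" "sqrt (4 * pi)" 2] r1 s
        by simp
    qed
    finally show ?thesis using nd_eq[OF s, of y] by simp
  qed
  then have "(\<integral>\<^sup>+y. ennreal (gauss2 1 1 r y y / nd 2 y) \<partial>lborel) =
      (\<integral>\<^sup>+y. ennreal (2 / sqrt ((3 - r) * (1 - r))) * ennreal (nd s y) \<partial>lborel)"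
    by (simp only: ennreal_mult''[OF normal_density_nonneg])
  also have "\<dots> = ennreal (2 / sqrt ((3 - r) * (1 - r)))"
    using s nn_integral_nd_shift[of s 0] by (simp add: nn_integral_cmult)
  finally show ?thesis .
qed

section \<open>The correlation weight and the choice of the smoothing parameter\<close>

text \<open>A nondecreasing second derivative makes the Taylor remainder at 0, divided by the square
  of the argument, largest at the right end, also in comparison with negative \<open>r\<close>.
  Scaling \<open>r\<close> and \<open>R\<close> by a common \<open>s\<close> gives a difference
  \<open>E\<close> with \<open>E 0 = E' 0 = 0\<close>, and \<open>E'' \<ge> 0\<close> because
  \<open>s * r \<le> s * R\<close>.\<close>

lemma second_order_growth:
  fixes f f' f'' :: "real \<Rightarrow> real"
  assumes d1: "\<And>x. x < 1 \<Longrightarrow> (f has_real_derivative f' x) (at x)"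
    and d2: "\<And>x. x < 1 \<Longrightarrow> (f' has_real_derivative f'' x) (at x)"
    and mono: "\<And>x y. x \<le> y \<Longrightarrow> y < 1 \<Longrightarrow> f'' x \<le> f'' y"
    and r: "\<bar>r\<bar> \<le> R" "R < 1"
  shows "R\<^sup>2 * (f r - f 0 - f' 0 * r) \<le> r\<^sup>2 * (f R - f 0 - f' 0 * R)"
proof -
  define E where "E s = r\<^sup>2 * (f (s * R) - f 0 - f' 0 * (s * R)) - R\<^sup>2 * (f (s * r) - f 0 - f' 0 * (s * r))" for s
  define E' where "E' s = r\<^sup>2 * R * (f' (s * R) - f' 0) - R\<^sup>2 * r * (f' (s * r) - f' 0)" for s
  define E'' where "E'' s = r\<^sup>2 * R\<^sup>2 * (f'' (s * R) - f'' (s * r))" for s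
  have lt: "s * R < 1" "s * r < 1" "s * r \<le> s * R" if "0 \<le> s" "s \<le> 1" for s
  proof -
    have "s * R \<le> 1 * R" using that r by (intro mult_right_mono) auto
    then show "s * R < 1" using r by simp
    show "s * r \<le> s * R" using that r by (intro mult_left_mono) auto
    then show "s * r < 1" using \<open>s * R < 1\<close> by simp
  qed
  have E1: "(E has_real_derivative E' s) (at s)" if "0 \<le> s" "s \<le> 1" for s
    unfolding E_def E'_def
    by (rule derivative_eq_intros DERIV_chain2[OF d1] lt that refl)+
       (simp add: algebra_simps power2_eq_square)
  have E2: "(E' has_real_derivative E'' s) (at s)" if "0 \<le> s" "s \<le> 1" for s
    unfolding E'_def E''_def
    by (rule derivative_eq_intros DERIV_chain2[OF d2] lt that refl)+
       (simp add: algebra_simps power2_eq_square)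
  have E'': "E'' s \<ge> 0" if "0 \<le> s" "s \<le> 1" for s
    unfolding E''_def using mono[OF lt(3) lt(1)] that by simp
  have "E' 0 \<le> E' s" if "0 \<le> s" "s \<le> 1" for s
    using that by (intro DERIV_nonneg_imp_nondecreasing[of 0 s E'])
      (auto intro!: exI[of _ "E'' _"] E2 E'')
  then have E': "E' s \<ge> 0" if "0 \<le> s" "s \<le> 1" for s
    using that by (simp add: E'_def)
  have "E 0 \<le> E 1"
    by (intro DERIV_nonneg_imp_nondecreasing[of 0 1 E]) (auto intro!: exI[of _ "E' _"] E1 E')
  then show ?thesis by (simp add: E_def)
qed

text \<open>
  The value of \<open>\<integral> g\<^sub>r(y, y) / w(y) dy\<close>, where \<open>g\<^sub>r\<close> is the standard bivariate normal density with
  correlation \<open>r\<close> and \<open>w\<close> the density of \<open>N(0, 2)\<close>. Variance 2 gives the slowest blow-up as \<open>r \<rightarrow> 1\<close>: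
  with \<open>N(0, 1)\<close> it would be \<open>1 / (1 - r)\<close>, which leads to a worse exponent of \<open>\<beta>\<^sub>2\<close>.
\<close>

definition corr_weight :: "real \<Rightarrow> real" where
  "corr_weight r = 2 / sqrt ((3 - r) * (1 - r))"

lemma corr_weight_pos: "r < 1 \<Longrightarrow> corr_weight r > 0"
  by (simp add: corr_weight_def)

lemma corr_weight_mono:
  assumes "x \<le> y" "y < 1"
  shows "corr_weight x \<le> corr_weight y"
  unfolding corr_weight_def using assms
  by (intro divide_left_mono real_sqrt_le_mono mult_mono mult_pos_pos) auto

text \<open>Written through the logarithmic derivative, which for the \<open>k\<close>-th power is
  simply multiplied by \<open>k\<close>.\<close>

lemma corr_weight_deriv:
  assumes "x < 1"
  shows "(corr_weight has_real_derivative corr_weight x * ((1 / (3 - x) + 1 / (1 - x)) / 2)) (at x)"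
proof -
  have p: "(3 - x) * (1 - x) > 0" using assms by simp
  have s: "sqrt ((3 - x) * (1 - x)) * sqrt ((3 - x) * (1 - x)) = (3 - x) * (1 - x)"
    using p by simp
  have "((\<lambda>x. 2 / sqrt ((3 - x) * (1 - x))) has_real_derivative
      - (2 * ((- (1 - x) - (3 - x)) * (inverse (sqrt ((3 - x) * (1 - x))) / 2))) /
      (sqrt ((3 - x) * (1 - x)) * sqrt ((3 - x) * (1 - x)))) (at x)"
    using p by (auto intro!: derivative_eq_intros)
  moreover have "- (2 * ((- (1 - x) - (3 - x)) * (inverse (sqrt ((3 - x) * (1 - x))) / 2))) /
      (sqrt ((3 - x) * (1 - x)) * sqrt ((3 - x) * (1 - x))) =
      2 / sqrt ((3 - x) * (1 - x)) * ((1 / (3 - x) + 1 / (1 - x)) / 2)"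
    unfolding s
  proof -
    have "1 / (3 - x) + 1 / (1 - x) = (4 - 2 * x) / ((3 - x) * (1 - x))"
      using assms by (subst add_frac_eq) simp_all
    then have 1: "(1 / (3 - x) + 1 / (1 - x)) / 2 = - (- (1 - x) - (3 - x)) / (2 * ((3 - x) * (1 - x)))"
      by simp
    have 2: "- (2 * (a * (inverse r / 2))) / P = 2 / r * (- a / (2 * P))" for a r P :: real
      by (cases "r = 0"; cases "P = 0"; simp add: field_simps)
    show "- (2 * ((- (1 - x) - (3 - x)) * (inverse (sqrt ((3 - x) * (1 - x))) / 2))) /
      ((3 - x) * (1 - x)) = 2 / sqrt ((3 - x) * (1 - x)) * ((1 / (3 - x) + 1 / (1 - x)) / 2)"
      unfolding 1 by (rule 2)
  qed
  ultimately show ?thesis unfolding corr_weight_def[abs_def] by simp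
qed

text \<open>With \<open>u\<close> the logarithmic derivative of the \<open>k\<close>-th power
  \<open>f\<close>, the second derivative is \<open>f * (u\<^sup>2 + u')\<close>, built from
  nonnegative nondecreasing functions, so the remainder at \<open>r\<close> is at most
  \<open>(r / R)\<^sup>2\<close> times that at \<open>R\<close>. There the subtracted terms
  \<open>f 0\<close> and \<open>f 0 * u 0 * R\<close> are dropped;
  \<open>u 0 = k / 2 * (1 / 3 + 1)\<close> is the slope \<open>2 k / 3\<close>.\<close>

lemma corr_weight_power_bound:
  assumes r: "\<bar>r\<bar> \<le> R" "R < 1" and R: "0 < R"
  shows "corr_weight r ^ k \<le> corr_weight 0 ^ k + 2 * real k / 3 * corr_weight 0 ^ k * \<bar>r\<bar>
    + (r / R)\<^sup>2 * corr_weight R ^ k"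
proof -
  define f where "f x = corr_weight x ^ k" for x
  define u where "u x = real k / 2 * (1 / (3 - x) + 1 / (1 - x))" for x :: real
  define u' where "u' x = real k / 2 * (1 / (3 - x)\<^sup>2 + 1 / (1 - x)\<^sup>2)" for x :: real
  have d1: "(f has_real_derivative f x * u x) (at x)" if "x < 1" for x
  proof (cases k)
    case 0
    then show ?thesis by (simp add: f_def[abs_def] u_def)
  next
    case (Suc n)
    show ?thesis
      unfolding f_def[abs_def] u_def
      by (rule derivative_eq_intros corr_weight_deriv that refl)+ (simp add: Suc field_simps)
  qed
  have du: "(u has_real_derivative u' x) (at x)" if "x < 1" for x
    unfolding u_def[abs_def] u'_def using that
    by (auto intro!: derivative_eq_intros simp: power2_eq_square)
  have d2: "((\<lambda>x. f x * u x) has_real_derivative f x * ((u x)\<^sup>2 + u' x)) (at x)" if "x < 1" for x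
    by (rule derivative_eq_intros d1 du that refl)+ (simp add: algebra_simps power2_eq_square)
  have fpos: "f x \<ge> 0" if "x < 1" for x
    unfolding f_def using corr_weight_pos[OF that] by simp
  have umono: "u x \<le> u y" "0 \<le> u x" "0 \<le> u' x" "u' x \<le> u' y" "f x \<le> f y" if "x \<le> y" "y < 1" for x y
  proof -
    show "u x \<le> u y" "u' x \<le> u' y" unfolding u_def u'_def using that
      by (auto intro!: mult_left_mono add_mono divide_left_mono power_mono mult_pos_pos)
    show "0 \<le> u x" "0 \<le> u' x" unfolding u_def u'_def using that by auto
    show "f x \<le> f y" unfolding f_def using that corr_weight_pos[of x]
      by (intro power_mono corr_weight_mono) auto
  qed
  have "R\<^sup>2 * (f r - f 0 - f 0 * u 0 * r) \<le> r\<^sup>2 * (f R - f 0 - f 0 * u 0 * R)"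
  proof (rule second_order_growth[OF d1 d2 _ r])
    fix x y :: real assume xy: "x \<le> y" "y < 1"
    show "f x * ((u x)\<^sup>2 + u' x) \<le> f y * ((u y)\<^sup>2 + u' y)"
      using umono[OF xy] fpos[of y] xy by (intro mult_mono add_mono power_mono) auto
  qed
  also have "\<dots> \<le> r\<^sup>2 * f R"
  proof (intro mult_left_mono)
    have "0 \<le> f 0 * u 0 * R"
      using fpos[of 0] R umono(2)[of 0 0] by (intro mult_nonneg_nonneg) auto
    then show "f R - f 0 - f 0 * u 0 * R \<le> f R" using fpos[of 0] by linarith
  qed auto
  finally have "f r - f 0 - f 0 * u 0 * r \<le> (r / R)\<^sup>2 * f R"
    using R by (simp add: field_simps)
  moreover have "f 0 * u 0 * r \<le> f 0 * u 0 * \<bar>r\<bar>"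
    using fpos[of 0] umono(2)[of 0 0] by (intro mult_left_mono) auto
  moreover have "u 0 = 2 * real k / 3" by (simp add: u_def)
  ultimately show ?thesis unfolding f_def by (simp add: algebra_simps)
qed

section \<open>Numerical estimates behind the constant 40\<close>

lemma sqrt3_bounds: "sqrt 3 \<ge> 173 / 100" "sqrt 3 \<le> 9 / 5"
  by (rule real_le_rsqrt real_le_lsqrt; simp add: power2_eq_square)+

lemma corr_weight_0: "corr_weight 0 = 2 / sqrt 3"
  by (simp add: corr_weight_def)

text \<open>The cruder bound by \<open>t\<close> would not do: at \<open>t = 2 b\<close> the factor
  \<open>3 / 5\<close> turns \<open>5 * 2 * t\<close> into \<open>12 b\<close>, which leaves room
  for \<open>9 b\<close> and \<open>19 b\<close> within \<open>40 b\<close>.\<close>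

lemma one_minus_sqrt_le:
  assumes "0 \<le> t" "t \<le> 1 / 5"
  shows "1 - sqrt (1 - t) \<le> 3 / 5 * t"
proof -
  have "t * t \<le> (1/5) * t" using assms by (intro mult_right_mono) auto
  then have "(1 - 3 / 5 * t)\<^sup>2 \<le> 1 - t"
    using assms by (simp add: power2_eq_square algebra_simps)
  then have "1 - 3 / 5 * t \<le> sqrt (1 - t)"
    by (rule real_le_rsqrt)
  then show ?thesis by simp
qed

text \<open>\<open>13 / 20\<close> bounds \<open>corr_weight 0 * (1 / 10) powr (1 / 4)\<close>, and
  \<open>7 / 10\<close> suffices because \<open>500 * (7 / 10) \<le> 19\<^sup>2\<close>.\<close>

lemma mult_power_decay:
  assumes "k \<ge> 6"
  shows "real k * (13 / 20) ^ k \<le> 7 / 10"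
  using assms
proof (induction k rule: nat_induct_at_least)
  case base
  then show ?case by (simp add: power_numeral_reduce)
next
  case (Suc n)
  have "real (Suc n) * (13 / 20) ^ Suc n = ((real n + 1) * (13 / 20)) * (13 / 20) ^ n" by simp
  also have "\<dots> \<le> real n * (13 / 20) ^ n"
    using Suc(1) by (intro mult_right_mono) auto
  finally show ?case using Suc.IH by linarith
qed

text \<open>Squaring reduces the claim to
  \<open>50 * k powr (3 / 2) * corr_weight 0 ^ k \<le> 1600\<close>. The left side grows
  exponentially, and \<open>k = 5\<close> is the last value for which this holds.\<close>

lemma small_k_coefficient:
  assumes "k \<ge> 1" "k \<le> 5" and b: "b \<ge> 0"
  shows "real k * (5 * sqrt 3 * sqrt (2 * real k / 3 * corr_weight 0 ^ k * b)) \<le>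
    40 * real k powr (3 / 4) * b powr (1 / 2)"
proof -
  define q where "q = real k powr (1 / 4)"
  have q: "q > 0" "q ^ 4 = real k" using assms by (simp_all add: q_def powr_powr flip: powr_realpow)
  have kq: "real k powr (3 / 4) * q = real k"
    using assms by (simp add: q_def flip: powr_add)
  \<comment> \<open>From \<open>q ^ 4 = k \<le> 5 < (9 / 4)\<^sup>2\<close>.\<close>
  have "q\<^sup>2 \<le> 9 / 4"
  proof (rule ccontr)
    assume "\<not> q\<^sup>2 \<le> 9 / 4"
    then have "(9 / 4)\<^sup>2 < (q\<^sup>2)\<^sup>2" by (intro power_strict_mono) auto
    then show False using q(2) assms(2) by (simp add: power2_eq_square power_numeral_reduce)
  qed
  have c1: "corr_weight 0 \<ge> 1"
    using sqrt3_bounds by (simp add: corr_weight_0)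
  have "corr_weight 0 ^ k \<le> corr_weight 0 ^ 5" using c1 assms by (intro power_increasing) auto
  also have "\<dots> = 32 / (9 * sqrt 3)"
  proof -
    have "sqrt 3 ^ 5 = (sqrt 3)\<^sup>2 * (sqrt 3)\<^sup>2 * sqrt 3" by (simp add: power_numeral_reduce)
    then have "sqrt 3 ^ 5 = 9 * sqrt 3" by simp
    then show ?thesis by (simp add: corr_weight_0 power_divide)
  qed
  also have "\<dots> \<le> 21 / 10" using sqrt3_bounds by (simp add: field_simps)
  finally have c: "corr_weight 0 ^ k \<le> 21 / 10" .
  have c0: "corr_weight 0 ^ k \<ge> 0" using corr_weight_pos[of 0] by simp
  have "q * (5 * sqrt 3 * sqrt (2 * real k / 3 * corr_weight 0 ^ k)) =
    sqrt (q\<^sup>2 * (5\<^sup>2 * 3 * (2 * real k / 3 * corr_weight 0 ^ k)))"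
    using q(1) by (simp only: real_sqrt_mult real_sqrt_abs)
  also have "\<dots> \<le> sqrt (40\<^sup>2)"
  proof (rule real_sqrt_le_mono)
    have "q\<^sup>2 * (5\<^sup>2 * 3 * (2 * real k / 3 * corr_weight 0 ^ k)) = q\<^sup>2 * (50 * (real k * corr_weight 0 ^ k))"
      by simp
    also have "\<dots> \<le> (9 / 4) * (50 * (5 * (21 / 10)))"
      using c c0 assms(2) \<open>q\<^sup>2 \<le> 9 / 4\<close> by (intro mult_mono) auto
    also have "\<dots> \<le> 40\<^sup>2" by simp
    finally show "q\<^sup>2 * (5\<^sup>2 * 3 * (2 * real k / 3 * corr_weight 0 ^ k)) \<le> 40\<^sup>2" .
  qed
  finally have *: "q * (5 * sqrt 3 * sqrt (2 * real k / 3 * corr_weight 0 ^ k)) \<le> 40" by simp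
  have "real k * (5 * sqrt 3 * sqrt (2 * real k / 3 * corr_weight 0 ^ k * b)) =
    (real k powr (3 / 4) * sqrt b) * (q * (5 * sqrt 3 * sqrt (2 * real k / 3 * corr_weight 0 ^ k)))"
    by (subst (1) kq[symmetric]) (simp only: real_sqrt_mult mult_ac)
  also have "\<dots> \<le> (real k powr (3 / 4) * sqrt b) * 40"
    using * b by (intro mult_left_mono) auto
  finally show ?thesis using b by (simp add: powr_half_sqrt mult_ac)
qed

text \<open>Here \<open>b powr ((k + 4) / 4)\<close> is \<open>\<beta>\<^sub>2\<close>, inserted for
  \<open>\<beta>\<^sub>1\<close>. Splitting off \<open>b\<^sup>2\<close> leaves
  \<open>b powr ((k - 4) / 4) \<le> 10 * q ^ k\<close> with
  \<open>q = (1 / 10) powr (1 / 4)\<close>, and \<open>corr_weight 0 * q < 1\<close> beats both the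
  exponential coefficient and the factor \<open>k\<close>.\<close>

lemma large_k_coefficient:
  assumes k: "k \<ge> 6" and b: "0 < b" "b \<le> 1 / 10"
  shows "5 * sqrt 3 * sqrt (2 * real k / 3 * corr_weight 0 ^ k * b powr ((real k + 4) / 4)) \<le> 19 * b"
proof -
  define q where "q = (1 / 10 :: real) powr (1 / 4)"
  have q: "q > 0" "q ^ 4 = 1 / 10" by (simp_all add: q_def powr_powr flip: powr_realpow)
  have s3: "sqrt 3 ^ 4 = 9"
    using power_mult[of "sqrt 3" 2 2] by simp
  \<comment> \<open>By fourth powers: \<open>(16 / 9) / 10\<close> against
    \<open>(13 / 20) ^ 4\<close>, a narrow margin.\<close>
  have cq: "corr_weight 0 * q \<le> 13 / 20"
  proof (rule ccontr)
    assume "\<not> corr_weight 0 * q \<le> 13 / 20"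
    then have "(13 / 20) ^ 4 < (corr_weight 0 * q) ^ 4" by (intro power_strict_mono) auto
    also have "\<dots> = 16 / 9 / 10" by (simp add: power_mult_distrib q(2) corr_weight_0 power_divide s3)
    finally show False by (simp add: power_divide)
  qed
  have c0: "corr_weight 0 > 0" using corr_weight_pos[of 0] by simp
  have "b powr ((real k + 4) / 4) = b\<^sup>2 * b powr ((real k - 4) / 4)"
    using b by (simp add: field_simps flip: powr_add powr_numeral)
  also have "b powr ((real k - 4) / 4) \<le> (1 / 10) powr ((real k - 4) / 4)"
    using b k by (intro powr_mono2) auto
  also have "(1 / 10 :: real) powr ((real k - 4) / 4) = 10 * q ^ k"
  proof -
    have "(1 / 10 :: real) powr ((real k - 4) / 4) = (1 / 10) powr (1 / 4 * real k) * (1 / 10) powr (-1)"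
      unfolding powr_add[symmetric] by (simp add: diff_divide_distrib)
    also have "(1 / 10 :: real) powr (1 / 4 * real k) = q ^ k"
      using q(1) by (simp only: q_def powr_powr[symmetric] powr_realpow)
    also have "(1 / 10 :: real) powr (-1) = 10" by (simp add: powr_minus)
    finally show ?thesis by simp
  qed
  finally have b2: "b powr ((real k + 4) / 4) \<le> b\<^sup>2 * (10 * q ^ k)"
    using b by simp
  have "5\<^sup>2 * 3 * (2 * real k / 3 * corr_weight 0 ^ k * b powr ((real k + 4) / 4)) \<le>
     5\<^sup>2 * 3 * (2 * real k / 3 * corr_weight 0 ^ k * (b\<^sup>2 * (10 * q ^ k)))"
    using c0 by (intro mult_left_mono b2) auto
  also have "\<dots> = 500 * b\<^sup>2 * (real k * (corr_weight 0 * q) ^ k)"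
    by (simp add: power_mult_distrib)
  also have "\<dots> \<le> 500 * b\<^sup>2 * (7 / 10)"
  proof (intro mult_left_mono)
    have "real k * (corr_weight 0 * q) ^ k \<le> real k * (13 / 20) ^ k"
      using cq c0 q by (intro mult_left_mono power_mono) auto
    then show "real k * (corr_weight 0 * q) ^ k \<le> 7 / 10"
      using mult_power_decay[OF k] by simp
  qed auto
  also have "\<dots> \<le> (19 * b)\<^sup>2" by (simp add: power_mult_distrib)
  finally have "sqrt (5\<^sup>2 * 3 * (2 * real k / 3 * corr_weight 0 ^ k * b powr ((real k + 4) / 4))) \<le> 19 * b"
    using b by (intro real_le_lsqrt) auto
  then show ?thesis by (simp only: real_sqrt_mult real_sqrt_abs)
qed

text \<open>At \<open>R = 1 - 2 b\<close> the product \<open>(3 - R) * (1 - R)\<close> is at least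
  \<open>4 b\<close>, so the weight is at most \<open>b powr (- 1 / 2)\<close>; the 2 in
  \<open>t = 2 b\<close> serves to cancel the numerator of \<open>corr_weight\<close>. The exponent
  \<open>(k + 4) / 4\<close> is the one that then turns the quadratic term into
  \<open>b\<^sup>2\<close>.\<close>

lemma corr_weight_near_one:
  assumes b: "0 < b" "2 * b < 1"
  shows "(b powr ((real k + 4) / 4))\<^sup>2 * corr_weight (1 - 2 * b) ^ k \<le> b\<^sup>2"
proof -
  have "corr_weight (1 - 2 * b) \<le> 2 / sqrt (4 * b)"
    unfolding corr_weight_def using b
    by (intro divide_left_mono real_sqrt_le_mono mult_pos_pos real_sqrt_gt_zero) (auto simp: algebra_simps)
  also have "\<dots> = b powr (- 1 / 2)"
  proof -
    have "sqrt (4 * b) = 2 * sqrt b" by (simp add: real_sqrt_mult)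
    moreover have "b powr (- 1 / 2) = inverse (sqrt b)"
      using powr_minus[of b "1 / 2"] b by (simp add: powr_half_sqrt)
    ultimately show ?thesis by (simp add: inverse_eq_divide)
  qed
  finally have "corr_weight (1 - 2 * b) ^ k \<le> (b powr (- 1 / 2)) ^ k"
    using corr_weight_pos[of "1 - 2 * b"] b by (intro power_mono) auto
  also have "\<dots> = b powr (- real k / 2)"
    using b by (subst powr_power) simp_all
  finally have "(b powr ((real k + 4) / 4))\<^sup>2 * corr_weight (1 - 2 * b) ^ k \<le>
     (b powr ((real k + 4) / 4))\<^sup>2 * b powr (- real k / 2)"
    by (intro mult_left_mono) auto
  also have "\<dots> = b powr ((real k + 4) / 4 * 2) * b powr (- real k / 2)"
    using b by (subst powr_power) (simp_all add: mult.commute)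
  also have "\<dots> = b powr 2"
    unfolding powr_add[symmetric] by (simp add: field_simps)
  finally show ?thesis using b by simp
qed

text \<open>\<open>w\<close> stands for the expected normalised cost per coordinate,
  \<open>triv\<close> for the bound from the independent coupling, and \<open>main\<close> for the
  bound at smoothing level \<open>t\<close>.\<close>

lemma optimise_smoothing:
  fixes k :: nat and \<alpha> b1 b2 w :: real
  assumes k: "k \<ge> 1" and nn: "\<alpha> \<ge> 0" "b1 \<ge> 0" "b1 \<le> b2"
    and triv: "w \<le> 4"
    and main: "\<And>t. 0 < t \<Longrightarrow> t < 1 \<Longrightarrow> w \<le> 5 * (\<alpha> + 2 * (1 - sqrt (1 - t)))
       + 5 * sqrt 3 * sqrt (2 * real k / 3 * corr_weight 0 ^ k * b1 + b2\<^sup>2 * corr_weight (1 - t) ^ k)"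
  shows "real k * w \<le> 40 * real k * \<alpha> + 40 * real k powr (3 / 4) * b1 powr (1 / 2)
     + 40 * real k * b2 powr (4 / (real k + 4))"
proof (cases "b2 = 0")
  case True
  then have b1: "b1 = 0" using nn by simp
  \<comment> \<open>Both correlation terms vanish, so \<open>t\<close> may tend to 0.\<close>
  have "w \<le> 5 * \<alpha>"
  proof (rule field_le_epsilon)
    fix e :: real assume e: "e > 0"
    define t where "t = min (1 / 2) (e / 10)"
    have t: "0 < t" "t < 1" "10 * t \<le> e" using e by (auto simp: t_def)
    have "1 - t \<le> sqrt (1 - t)"
      using t by (intro real_le_rsqrt) (simp add: power2_eq_square algebra_simps)
    then have "2 * (1 - sqrt (1 - t)) \<le> 2 * t" by simp
    then show "w \<le> 5 * \<alpha> + e"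
      using main[OF t(1,2)] t(3) True b1 by simp
  qed
  then have "real k * w \<le> real k * (40 * \<alpha>)"
    using nn by (intro mult_left_mono) auto
  then show ?thesis using True b1 by simp
next
  case False
  then have b2: "b2 > 0" using nn by simp
  define b where "b = b2 powr (4 / (real k + 4))"
  have b: "b > 0" using b2 by (simp add: b_def)
  have b2_eq: "b2 = b powr ((real k + 4) / 4)"
  proof -
    have "4 / (real k + 4) * ((real k + 4) / 4) = 1" by simp
    then show ?thesis using b2 by (simp only: b_def powr_powr powr_one)
  qed
  have pos: "40 * real k * \<alpha> \<ge> 0" "40 * real k powr (3 / 4) * b1 powr (1 / 2) \<ge> 0"
    using nn by simp_all
  show ?thesis
  \<comment> \<open>The threshold is where the trivial bound 4 meets \<open>40 b\<close>; below it
    \<open>t = 2 b\<close> stays under \<open>1 / 5\<close>.\<close>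
  proof (cases "b \<ge> 1 / 10")
    case True
    have "real k * w \<le> real k * (40 * b)"
      using triv True by (intro mult_left_mono) auto
    then show ?thesis using pos unfolding b_def[symmetric] by linarith
  next
    case False
    have c0: "corr_weight 0 > 0" using corr_weight_pos[of 0] by simp
    let ?h = "2 * real k / 3 * corr_weight 0 ^ k"
    have "w \<le> 5 * (\<alpha> + 2 * (1 - sqrt (1 - 2 * b)))
       + 5 * sqrt 3 * sqrt (?h * b1 + b2\<^sup>2 * corr_weight (1 - 2 * b) ^ k)"
      using b False by (intro main) auto
    also have "1 - sqrt (1 - 2 * b) \<le> 3 / 5 * (2 * b)"
      using b False by (intro one_minus_sqrt_le) auto
    also have "b2\<^sup>2 * corr_weight (1 - 2 * b) ^ k \<le> b\<^sup>2"
      unfolding b2_eq using b False by (intro corr_weight_near_one) auto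
    also have "sqrt (?h * b1 + b\<^sup>2) \<le> sqrt (?h * b1) + b"
      using sqrt_add_le_add_sqrt[of "?h * b1" "b\<^sup>2"] c0 nn b by simp
    finally have "w \<le> 5 * (\<alpha> + 2 * (3 / 5 * (2 * b))) + 5 * sqrt 3 * (sqrt (?h * b1) + b)"
      by simp
    moreover have "5 * sqrt 3 * b \<le> 9 * b"
      using sqrt3_bounds b by (intro mult_right_mono) auto
    \<comment> \<open>\<open>21 = 12 + 9\<close>: 12 is \<open>5 * 2 * (3 / 5) * 2\<close>, and 9
      comes from \<open>5 * sqrt 3 \<le> 9\<close>.\<close>
    ultimately have w: "w \<le> 5 * \<alpha> + 21 * b + 5 * sqrt 3 * sqrt (?h * b1)"
      by (simp add: algebra_simps)
    show ?thesis
    proof (cases "k \<le> 5")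
      case True
      have "real k * w \<le> real k * (5 * \<alpha> + 21 * b + 5 * sqrt 3 * sqrt (?h * b1))"
        using w by (intro mult_left_mono) auto
      also have "\<dots> = real k * (5 * \<alpha>) + real k * (21 * b) + real k * (5 * sqrt 3 * sqrt (?h * b1))"
        by (simp add: algebra_simps)
      also have "\<dots> \<le> real k * (40 * \<alpha>) + real k * (40 * b) + 40 * real k powr (3 / 4) * b1 powr (1 / 2)"
        using nn b small_k_coefficient[OF k True nn(2)] by (intro add_mono mult_left_mono) auto
      finally show ?thesis unfolding b_def[symmetric] by simp
    next
      case large: False
      \<comment> \<open>\<open>b1 \<le> b2\<close> trades the \<open>b1\<close> term for another
        \<open>19 b\<close>, and \<open>21 + 19 = 40\<close>.\<close>
      have "sqrt (?h * b1) \<le> sqrt (?h * b powr ((real k + 4) / 4))"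
        using nn c0 unfolding b2_eq by (intro real_sqrt_le_mono mult_left_mono) auto
      then have "5 * sqrt 3 * sqrt (?h * b1) \<le> 5 * sqrt 3 * sqrt (?h * b powr ((real k + 4) / 4))"
        by (intro mult_left_mono) auto
      also have "\<dots> \<le> 19 * b" using large b False by (intro large_k_coefficient) auto
      finally have "w \<le> 40 * \<alpha> + 40 * b" using w nn by simp
      then have "real k * w \<le> real k * (40 * \<alpha> + 40 * b)" by (intro mult_left_mono) auto
      then show ?thesis using pos unfolding b_def[symmetric] distrib_left by linarith
    qed
  qed
qed

section \<open>Gaussian matrices\<close>

lemma borel_measurable_gauss2 [measurable (raw)]:
  assumes [measurable]: "R \<in> borel_measurable M" "p \<in> borel_measurable M" "q \<in> borel_measurable M"
  shows "(\<lambda>w. gauss2 A B (R w) (p w) (q w)) \<in> borel_measurable M"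
  unfolding gauss2_def by measurable

lemma nn_integral_lborel_vec_prod:
  fixes f :: "'k::finite \<Rightarrow> real \<Rightarrow> ennreal"
  assumes [measurable]: "\<And>i. f i \<in> borel_measurable borel"
  shows "(\<integral>\<^sup>+y. (\<Prod>i\<in>UNIV. f i (y $ i)) \<partial>(lborel :: (real^'k) measure)) = (\<Prod>i\<in>UNIV. \<integral>\<^sup>+x. f i x \<partial>lborel)"
proof -
  \<comment> \<open>Recovers the index from a basis vector, to turn the product over
    \<open>Basis\<close> into one over \<open>UNIV\<close>.\<close>
  define ix :: "real^'k \<Rightarrow> 'k" where "ix b = (THE i. b = axis i 1)" for b
  have ix: "ix (axis i 1) = i" for i
    unfolding ix_def by (rule the_equality) (auto simp: axis_eq_axis)
  have bas: "(Basis :: (real^'k) set) = (\<lambda>i. axis i 1) ` UNIV"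
    by (auto simp: Basis_vec_def)
  have inj: "inj_on (\<lambda>i::'k. axis i (1::real)) UNIV"
    by (auto simp: inj_on_def axis_eq_axis)
  have P: "(\<Prod>b\<in>(Basis :: (real^'k) set). g b) = (\<Prod>i\<in>UNIV. g (axis i 1))" for g :: "real^'k \<Rightarrow> ennreal"
    unfolding bas by (simp add: prod.reindex[OF inj])
  have "(\<integral>\<^sup>+y. (\<Prod>b\<in>Basis. f (ix b) (y \<bullet> b)) \<partial>(lborel :: (real^'k) measure)) = (\<Prod>b\<in>(Basis :: (real^'k) set). \<integral>\<^sup>+x. f (ix b) x \<partial>lborel)"
    by (rule nn_integral_lborel_prod) auto
  then show ?thesis unfolding P by (simp add: ix inner_axis)
qed

text \<open>Each summand is a positive semidefinite rank-one update, which keeps the determinant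
  positive; the single update was settled when completing the square.\<close>

lemma gauss2_covariance_pos:
  fixes A B R V :: real
  assumes A: "A > 0" "B > 0" "A * B > R\<^sup>2" and V: "V > 0" and K: "finite K"
  shows "(A + V * (\<Sum>j\<in>K. (a j)\<^sup>2)) * (B + V * (\<Sum>j\<in>K. (b j)\<^sup>2)) > (R + V * (\<Sum>j\<in>K. a j * b j))\<^sup>2"
  using K
proof (induction K)
  case empty
  then show ?case using A by simp
next
  case (insert j K)
  have "A + V * (\<Sum>j\<in>K. (a j)\<^sup>2) > 0" "B + V * (\<Sum>j\<in>K. (b j)\<^sup>2) > 0"
    using A V by (simp_all add: add_pos_nonneg sum_nonneg)
  from gauss2_step_pointwise(2)[OF this insert.IH V, of "a j" "b j"] show ?case
    using insert.hyps by (simp add: algebra_simps)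
qed

lemma nn_integral_nd_affine_square:
  assumes "V > 0"
  shows "(\<integral>\<^sup>+x. ennreal (nd V x) * ennreal ((p - x * c)\<^sup>2) \<partial>lborel) = ennreal (p\<^sup>2 + V * c\<^sup>2)"
proof (cases "c = 0")
  case True
  then show ?thesis using nn_integral_nd_shift[of V 0] assms by (simp add: nn_integral_multc)
next
  case False
  have "ennreal (nd V x) * ennreal ((p - x * c)\<^sup>2) = ennreal (c\<^sup>2) * ennreal (nd V x * (p / c - x)\<^sup>2)" for x
  proof -
    have "(p - x * c)\<^sup>2 = c\<^sup>2 * (p / c - x)\<^sup>2"
      using False by (simp flip: power_mult_distrib) (simp add: algebra_simps)
    then show ?thesis by (simp add: mult_ac flip: ennreal_mult)
  qed
  then have "(\<integral>\<^sup>+x. ennreal (nd V x) * ennreal ((p - x * c)\<^sup>2) \<partial>lborel) =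
      ennreal (c\<^sup>2) * ennreal ((p / c - 0)\<^sup>2 + (sqrt V)\<^sup>2)"
    using assms by (simp add: nn_integral_cmult nn_integral_normal_density_square del: diff_0_right)
  also have "\<dots> = ennreal (p\<^sup>2 + V * c\<^sup>2)"
  proof -
    have "c\<^sup>2 * ((p / c - 0)\<^sup>2 + (sqrt V)\<^sup>2) = p\<^sup>2 + V * c\<^sup>2"
      using False assms by (simp add: distrib_left power_divide)
    then show ?thesis by (simp only: ennreal_mult'[OF zero_le_power2, symmetric])
  qed
  finally show ?thesis .
qed

abbreviation gaussian_measure :: "real \<Rightarrow> real measure" where
  "gaussian_measure V \<equiv> density lborel (\<lambda>x. ennreal (nd V x))"

lemma prob_space_gaussian_measure: "V > 0 \<Longrightarrow> prob_space (gaussian_measure V)"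
  by (rule prob_space_normal_density) simp

lemma sum_columns_insert:
  fixes x :: "'k \<times> 'n::finite \<Rightarrow> real"
  assumes "(i0, j0) \<notin> J"
  shows "(\<Sum>j | (i, j) \<in> insert (i0, j0) J. (x((i0, j0) := \<tau>)) (i, j) * a j) =
     (if i = i0 then \<tau> * a j0 else 0) + (\<Sum>j | (i, j) \<in> J. x (i, j) * a j)"
proof -
  have "{j. (i, j) \<in> insert (i0, j0) J} = (if i = i0 then insert j0 {j. (i, j) \<in> J} else {j. (i, j) \<in> J})"
    by auto
  moreover have "(\<Sum>j | (i, j) \<in> J. (x((i0, j0) := \<tau>)) (i, j) * a j) = (\<Sum>j | (i, j) \<in> J. x (i, j) * a j)"
    using assms by (intro sum.cong) auto
  ultimately show ?thesis using assms by auto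
qed

lemma sum_columns_insert':
  fixes a :: "'n::finite \<Rightarrow> real"
  assumes "(i0, j0) \<notin> J"
  shows "(\<Sum>j | (i, j) \<in> insert (i0, j0) J. a j) = (if i = i0 then a j0 else 0) + (\<Sum>j | (i, j) \<in> J. a j)"
proof -
  have "{j. (i, j) \<in> insert (i0, j0) J} = (if i = i0 then insert j0 {j. (i, j) \<in> J} else {j. (i, j) \<in> J})"
    by auto
  then show ?thesis using assms by auto
qed

text \<open>Induction on the set \<open>J\<close> of random entries. A new entry in row
  \<open>i0\<close> moves only the point \<open>(p i0, q i0)\<close>, along
  \<open>(a j0, b j0)\<close>, which is the one-dimensional update; this motion is why
  \<open>p\<close> and \<open>q\<close> are generalised.\<close>

lemma nn_integral_PiM_gauss2:
  fixes J :: "('k::finite \<times> 'n::finite) set"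
  assumes A: "A > 0" "B > 0" "A * B > R\<^sup>2" and V: "V > 0"
  shows "(\<integral>\<^sup>+e. (\<Prod>i\<in>UNIV. ennreal (gauss2 A B R (p i - (\<Sum>j | (i, j) \<in> J. e (i, j) * a j))
              (q i - (\<Sum>j | (i, j) \<in> J. e (i, j) * b j)))) \<partial>PiM J (\<lambda>_. gaussian_measure V)) =
    (\<Prod>i\<in>UNIV. ennreal (gauss2 (A + V * (\<Sum>j | (i, j) \<in> J. (a j)\<^sup>2)) (B + V * (\<Sum>j | (i, j) \<in> J. (b j)\<^sup>2))
              (R + V * (\<Sum>j | (i, j) \<in> J. a j * b j)) (p i) (q i)))"
proof -
  interpret prob_space "gaussian_measure V" using V by (rule prob_space_gaussian_measure)
  interpret product_sigma_finite "\<lambda>_::'k \<times> 'n. gaussian_measure V" by standard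
  have "finite J" by simp
  then show ?thesis
  proof (induction J arbitrary: p q)
    case empty
    have "prob_space (PiM {} (\<lambda>_::'k \<times> 'n. gaussian_measure V))"
      using V by (intro prob_space_PiM prob_space_gaussian_measure)
    then show ?case by (simp add: prob_space.emeasure_space_1)
  next
    case (insert e J)
    obtain i0 j0 where e: "e = (i0, j0)" by force
    note notin = insert.hyps(2)[unfolded e]
    let ?A = "\<lambda>i J. A + V * (\<Sum>j | (i, j) \<in> J. (a j)\<^sup>2)"
    let ?B = "\<lambda>i J. B + V * (\<Sum>j | (i, j) \<in> J. (b j)\<^sup>2)"
    let ?R = "\<lambda>i J. R + V * (\<Sum>j | (i, j) \<in> J. a j * b j)"
    let ?G = "\<lambda>p q x J. \<Prod>i\<in>UNIV. ennreal (gauss2 A B R (p i - (\<Sum>j | (i, j) \<in> J. x (i, j) * a j))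
              (q i - (\<Sum>j | (i, j) \<in> J. x (i, j) * b j)))"
    let ?C = "\<Prod>i\<in>UNIV - {i0}. ennreal (gauss2 (?A i J) (?B i J) (?R i J) (p i) (q i))"
    have upd: "?G p q (x(e := \<tau>)) (insert e J) =
      ?G (p(i0 := p i0 - \<tau> * a j0)) (q(i0 := q i0 - \<tau> * b j0)) x J" for x \<tau>
      unfolding e sum_columns_insert[OF notin] by (intro prod.cong) (auto simp: algebra_simps)
    have pos: "?A i0 J > 0" "?B i0 J > 0"
      using A V by (simp_all add: add_pos_nonneg sum_nonneg)
    have cov: "?A i0 J * ?B i0 J > (?R i0 J)\<^sup>2"
      by (rule gauss2_covariance_pos[OF A V]) simp
    have new: "?A i0 (insert e J) = ?A i0 J + V * (a j0)\<^sup>2" "?B i0 (insert e J) = ?B i0 J + V * (b j0)\<^sup>2"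
        "?R i0 (insert e J) = ?R i0 J + V * a j0 * b j0"
      unfolding e sum_columns_insert'[OF notin] by (simp_all add: algebra_simps)
    have "(\<integral>\<^sup>+x. ?G p q x (insert e J) \<partial>PiM (insert e J) (\<lambda>_. gaussian_measure V)) =
      (\<integral>\<^sup>+\<tau>. \<integral>\<^sup>+x. ?G p q (x(e := \<tau>)) (insert e J) \<partial>PiM J (\<lambda>_. gaussian_measure V) \<partial>gaussian_measure V)"
    proof (rule product_nn_integral_insert_rev[OF insert.hyps])
      have "(\<lambda>x. x (i, j)) \<in> borel_measurable (PiM (insert e J) (\<lambda>_. gaussian_measure V))"
        if "(i, j) \<in> insert e J" for i j
        using measurable_component_singleton[OF that, of "\<lambda>_. gaussian_measure V"] by simp
      then show "(\<lambda>x. ?G p q x (insert e J)) \<in> borel_measurable (PiM (insert e J) (\<lambda>_. gaussian_measure V))"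
        by (intro borel_measurable_prod_ennreal measurable_compose[OF _ measurable_ennreal]
            borel_measurable_gauss2 borel_measurable_diff borel_measurable_const borel_measurable_sum
            borel_measurable_times) auto
    qed
    also have "\<dots> = (\<integral>\<^sup>+\<tau>. ?C * ennreal (gauss2 (?A i0 J) (?B i0 J) (?R i0 J) (p i0 - \<tau> * a j0) (q i0 - \<tau> * b j0)) \<partial>gaussian_measure V)"
      unfolding upd insert.IH
    proof (rule nn_integral_cong)
      fix \<tau>
      show "(\<Prod>i\<in>UNIV. ennreal (gauss2 (?A i J) (?B i J) (?R i J) ((p(i0 := p i0 - \<tau> * a j0)) i) ((q(i0 := q i0 - \<tau> * b j0)) i))) =
        ?C * ennreal (gauss2 (?A i0 J) (?B i0 J) (?R i0 J) (p i0 - \<tau> * a j0) (q i0 - \<tau> * b j0))"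
        by (subst prod.remove[of UNIV i0]) (auto simp: mult.commute intro!: prod.cong)
    qed
    also have "\<dots> = ?C * (\<integral>\<^sup>+\<tau>. ennreal (nd V \<tau>) * ennreal (gauss2 (?A i0 J) (?B i0 J) (?R i0 J) (p i0 - \<tau> * a j0) (q i0 - \<tau> * b j0)) \<partial>lborel)"
      by (subst nn_integral_cmult) (simp_all add: nn_integral_density)
    also have "\<dots> = ?C * ennreal (gauss2 (?A i0 (insert e J)) (?B i0 (insert e J)) (?R i0 (insert e J)) (p i0) (q i0))"
      unfolding new by (subst nn_integral_gauss2_step[OF pos cov V]) simp
    also have "?C = (\<Prod>i\<in>UNIV - {i0}. ennreal (gauss2 (?A i (insert e J)) (?B i (insert e J)) (?R i (insert e J)) (p i) (q i)))"
      unfolding e sum_columns_insert'[OF notin] by (intro prod.cong) auto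
    finally show ?case
      by (subst prod.remove[of UNIV i0]) (auto simp: mult.commute)
  qed
qed

text \<open>The same induction over entries: those outside row \<open>i\<close> leave the integrand
  unchanged, those inside add \<open>V * (c j)\<^sup>2\<close>.\<close>

lemma nn_integral_PiM_square:
  fixes J :: "('k::finite \<times> 'n::finite) set"
  assumes V: "V > 0"
  shows "(\<integral>\<^sup>+e. ennreal ((p - (\<Sum>j | (i, j) \<in> J. e (i, j) * c j))\<^sup>2) \<partial>PiM J (\<lambda>_. gaussian_measure V)) =
    ennreal (p\<^sup>2 + V * (\<Sum>j | (i, j) \<in> J. (c j)\<^sup>2))"
proof -
  interpret prob_space "gaussian_measure V" using V by (rule prob_space_gaussian_measure)
  interpret product_sigma_finite "\<lambda>_::'k \<times> 'n. gaussian_measure V" by standard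
  have "finite J" by simp
  then show ?thesis
  proof (induction J arbitrary: p)
    case empty
    have "prob_space (PiM {} (\<lambda>_::'k \<times> 'n. gaussian_measure V))"
      using V by (intro prob_space_PiM prob_space_gaussian_measure)
    then show ?case by (simp add: prob_space.emeasure_space_1)
  next
    case (insert e J)
    obtain i0 j0 where e: "e = (i0, j0)" by force
    note notin = insert.hyps(2)[unfolded e]
    let ?d = "if i = i0 then c j0 else 0"
    let ?S = "V * (\<Sum>j | (i, j) \<in> J. (c j)\<^sup>2)"
    have S: "?S \<ge> 0" using V by (simp add: sum_nonneg)
    have upd: "p - (\<Sum>j | (i, j) \<in> insert e J. (x(e := \<tau>)) (i, j) * c j) =
      (p - \<tau> * ?d) - (\<Sum>j | (i, j) \<in> J. x (i, j) * c j)" for x \<tau>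
      unfolding e sum_columns_insert[OF notin] by simp
    have "(\<integral>\<^sup>+x. ennreal ((p - (\<Sum>j | (i, j) \<in> insert e J. x (i, j) * c j))\<^sup>2) \<partial>PiM (insert e J) (\<lambda>_. gaussian_measure V)) =
      (\<integral>\<^sup>+\<tau>. \<integral>\<^sup>+x. ennreal ((p - (\<Sum>j | (i, j) \<in> insert e J. (x(e := \<tau>)) (i, j) * c j))\<^sup>2) \<partial>PiM J (\<lambda>_. gaussian_measure V) \<partial>gaussian_measure V)"
    proof (rule product_nn_integral_insert_rev[OF insert.hyps])
      have "(\<lambda>x. x (i, j)) \<in> borel_measurable (PiM (insert e J) (\<lambda>_. gaussian_measure V))"
        if "(i, j) \<in> insert e J" for i j
        using measurable_component_singleton[OF that, of "\<lambda>_. gaussian_measure V"] by simp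
      then show "(\<lambda>x. ennreal ((p - (\<Sum>j | (i, j) \<in> insert e J. x (i, j) * c j))\<^sup>2)) \<in> borel_measurable (PiM (insert e J) (\<lambda>_. gaussian_measure V))"
        by (intro measurable_compose[OF _ measurable_ennreal] borel_measurable_power
            borel_measurable_diff borel_measurable_const borel_measurable_sum
            borel_measurable_times) auto
    qed
    also have "\<dots> = (\<integral>\<^sup>+\<tau>. ennreal (nd V \<tau>) * ennreal ((p - \<tau> * ?d)\<^sup>2) + ennreal ?S * ennreal (nd V \<tau>) \<partial>lborel)"
      unfolding upd insert.IH using S
      by (subst nn_integral_density) (auto simp: ennreal_plus distrib_left mult.commute intro!: nn_integral_cong)
    also have "\<dots> = ennreal (p\<^sup>2 + V * ?d\<^sup>2) + ennreal ?S"
      by (subst nn_integral_add)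
        (simp_all add: nn_integral_nd_affine_square[OF V] nn_integral_cmult nn_integral_nd_shift[OF V, of 0, simplified])
    also have "\<dots> = ennreal (p\<^sup>2 + V * (\<Sum>j | (i, j) \<in> insert e J. (c j)\<^sup>2))"
      unfolding e sum_columns_insert'[OF notin] using V S
      by (simp add: distrib_left flip: ennreal_plus) (simp add: algebra_simps)?
    finally show ?case .
  qed
qed

definition gaussian_matrix :: "real \<Rightarrow> (real ^ 'n ^ 'k) measure" where
  "gaussian_matrix V = distr (PiM UNIV (\<lambda>_::'k \<times> 'n. gaussian_measure V)) borel (\<lambda>e. \<chi> i j. e (i, j))"

lemma measurable_vec_lambda [measurable (raw)]:
  fixes f :: "'a \<Rightarrow> 'k::finite \<Rightarrow> 'b::euclidean_space"
  assumes "\<And>i. (\<lambda>x. f x i) \<in> borel_measurable M"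
  shows "(\<lambda>x. \<chi> i. f x i) \<in> borel_measurable M"
proof (subst borel_measurable_euclidean_space, safe)
  fix b :: "'b ^ 'k" assume "b \<in> Basis"
  then obtain i u where "b = axis i u" "u \<in> Basis" by (auto simp: Basis_vec_def)
  then show "(\<lambda>x. (\<chi> i. f x i) \<bullet> b) \<in> borel_measurable M"
    using assms[of i] by (simp add: inner_axis)
qed

lemma measurable_matrix_of_entries:
  "(\<lambda>e. \<chi> i j. e (i, j)) \<in> PiM UNIV (\<lambda>_::'k::finite \<times> 'n::finite. gaussian_measure V) \<rightarrow>\<^sub>M borel"
proof (intro measurable_vec_lambda)
  show "(\<lambda>e. e (i, j)) \<in> borel_measurable (PiM UNIV (\<lambda>_::'k \<times> 'n. gaussian_measure V))" for i j
    using measurable_component_singleton[of "(i, j)" UNIV "\<lambda>_. gaussian_measure V"] by simp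
qed

lemma prob_space_gaussian_matrix: "V > 0 \<Longrightarrow> prob_space (gaussian_matrix V :: (real ^ 'n ^ 'k) measure)"
  unfolding gaussian_matrix_def
  by (intro prob_space.prob_space_distr prob_space_PiM prob_space_gaussian_measure measurable_matrix_of_entries)

lemma sets_gaussian_matrix [simp, measurable_cong]: "sets (gaussian_matrix V) = sets borel"
  by (simp add: gaussian_matrix_def)

lemma measurable_matrix_vector_mult [measurable (raw)]:
  assumes "f \<in> borel_measurable M" "g \<in> borel_measurable M"
  shows "(\<lambda>x. (f x :: real^'n^'k) *v g x) \<in> borel_measurable M"
proof -
  have "continuous_on UNIV (\<lambda>p. (fst p :: real^'n^'k) *v snd p)"
    unfolding matrix_vector_mult_def by (intro continuous_intros)
  then have "(\<lambda>p. (fst p :: real^'n^'k) *v snd p) \<in> borel_measurable (borel \<Otimes>\<^sub>M borel)"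
    unfolding borel_prod by (rule borel_measurable_continuous_onI)
  from measurable_compose[OF measurable_Pair[OF assms] this] show ?thesis by simp
qed

lemma measurable_vec_component [measurable (raw)]:
  assumes "f \<in> borel_measurable M"
  shows "(\<lambda>x. (f x :: ('b::euclidean_space)^'k) $ i) \<in> borel_measurable M"
proof -
  have "(\<lambda>v :: 'b^'k. v $ i) \<in> borel_measurable borel"
    by (intro borel_measurable_continuous_onI continuous_intros)
  from measurable_compose[OF assms this] show ?thesis .
qed

lemma nn_integral_gaussian_matrix_gauss2:
  fixes a b :: "real^'n" and p q :: "real^'k"
  assumes A: "A > 0" "B > 0" "A * B > R\<^sup>2" and V: "V > 0"
  shows "(\<integral>\<^sup>+\<theta>. (\<Prod>i\<in>UNIV. ennreal (gauss2 A B R (p $ i - (\<theta> *v a) $ i) (q $ i - (\<theta> *v b) $ i))) \<partial>gaussian_matrix V) =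
    (\<Prod>i\<in>UNIV. ennreal (gauss2 (A + V * (a \<bullet> a)) (B + V * (b \<bullet> b)) (R + V * (a \<bullet> b)) (p $ i) (q $ i)))"
  unfolding gaussian_matrix_def
  using nn_integral_PiM_gauss2[OF A V, where J = UNIV and p = "\<lambda>i. p $ i" and q = "\<lambda>i. q $ i"
      and a = "\<lambda>j. a $ j" and b = "\<lambda>j. b $ j"]
  by (subst nn_integral_distr[OF measurable_matrix_of_entries])
     (simp_all add: matrix_vector_mult_def inner_vec_def power2_eq_square)

lemma nn_integral_gaussian_matrix_square:
  fixes c :: "real^'n"
  assumes V: "V > 0"
  shows "(\<integral>\<^sup>+\<theta>. ennreal ((p - ((\<theta> :: real^'n^'k) *v c) $ i)\<^sup>2) \<partial>gaussian_matrix V) = ennreal (p\<^sup>2 + V * (c \<bullet> c))"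
  unfolding gaussian_matrix_def
  using nn_integral_PiM_square[OF V, where J = UNIV and p = p and i = i and c = "\<lambda>j. c $ j"]
  by (subst nn_integral_distr[OF measurable_matrix_of_entries])
     (simp_all add: matrix_vector_mult_def inner_vec_def power2_eq_square)

section \<open>Couplings\<close>

lemma W2_square: "(W2 P Q)\<^sup>2 = (INF \<pi>\<in>couplings P Q. \<integral>\<^sup>+p. ennreal ((norm (fst p - snd p))\<^sup>2) \<partial>\<pi>)"
proof -
  have "(ennreal_sqrt x)\<^sup>2 = x" for x
  proof (cases x)
    case (real r)
    then show ?thesis by (simp add: ennreal_sqrt_def ennreal_power)
  qed (simp add: ennreal_sqrt_def)
  then show ?thesis by (simp add: W2_def)
qed

lemma W2_square_le:
  assumes "\<pi> \<in> couplings P Q"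
  shows "(W2 P Q)\<^sup>2 \<le> (\<integral>\<^sup>+p. ennreal ((norm (fst p - snd p))\<^sup>2) \<partial>\<pi>)"
  unfolding W2_square using assms by (rule INF_lower)

text \<open>Every coupling of \<open>P\<close> and \<open>Q\<close> scales to a coupling of the
  images.\<close>

lemma W2_square_scale:
  fixes P Q :: "(real ^ 'k) measure"
  assumes c: "c > 0" and P: "sets P = sets borel" "sets Q = sets borel"
  shows "(W2 (distr P borel (\<lambda>x. c *\<^sub>R x)) (distr Q borel (\<lambda>x. c *\<^sub>R x)))\<^sup>2 \<le> ennreal (c\<^sup>2) * (W2 P Q)\<^sup>2"
proof -
  have "(W2 (distr P borel (\<lambda>x. c *\<^sub>R x)) (distr Q borel (\<lambda>x. c *\<^sub>R x)))\<^sup>2 \<le>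
      ennreal (c\<^sup>2) * (\<integral>\<^sup>+p. ennreal ((norm (fst p - snd p))\<^sup>2) \<partial>\<pi>)" if \<pi>: "\<pi> \<in> couplings P Q" for \<pi>
  proof -
    have [measurable_cong, simp]: "sets \<pi> = sets (borel \<Otimes>\<^sub>M borel)" using \<pi> by (simp add: couplings_def)
    let ?T = "\<lambda>p. (c *\<^sub>R fst p, c *\<^sub>R snd p) :: (real^'k) \<times> (real^'k)"
    have T [measurable]: "?T \<in> \<pi> \<rightarrow>\<^sub>M borel \<Otimes>\<^sub>M borel" by measurable
    have "distr \<pi> (borel \<Otimes>\<^sub>M borel) ?T \<in>
        couplings (distr P borel (\<lambda>x. c *\<^sub>R x)) (distr Q borel (\<lambda>x. c *\<^sub>R x))"
    proof -
      interpret prob_space \<pi> using \<pi> by (simp add: couplings_def)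
      have PQ: "P = distr \<pi> borel fst" "Q = distr \<pi> borel snd" using \<pi> by (auto simp: couplings_def)
      show ?thesis
        unfolding couplings_def PQ
        by (auto intro!: prob_space_distr simp: distr_distr comp_def)
    qed
    from W2_square_le[OF this] have "(W2 (distr P borel (\<lambda>x. c *\<^sub>R x)) (distr Q borel (\<lambda>x. c *\<^sub>R x)))\<^sup>2 \<le>
       (\<integral>\<^sup>+p. ennreal ((norm (c *\<^sub>R fst p - c *\<^sub>R snd p))\<^sup>2) \<partial>\<pi>)"
      by (simp add: nn_integral_distr)
    also have "\<dots> = (\<integral>\<^sup>+p. ennreal (c\<^sup>2) * ennreal ((norm (fst p - snd p))\<^sup>2) \<partial>\<pi>)"
      using c by (simp add: power_mult_distrib flip: scaleR_diff_right ennreal_mult')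
    finally show ?thesis by (subst (asm) nn_integral_cmult) simp_all
  qed
  note bound = this
  let ?W = "(W2 (distr P borel (\<lambda>x. c *\<^sub>R x)) (distr Q borel (\<lambda>x. c *\<^sub>R x)))\<^sup>2"
  \<comment> \<open>The factor is moved to the other side and back, so that a quantity independent
    of the coupling is compared with the infimum.\<close>
  have inv: "ennreal (1 / c\<^sup>2) * (ennreal (c\<^sup>2) * x) = x" "ennreal (c\<^sup>2) * (ennreal (1 / c\<^sup>2) * x) = x" for x
    using c by (simp_all flip: mult.assoc ennreal_mult)
  have "ennreal (1 / c\<^sup>2) * ?W \<le> (W2 P Q)\<^sup>2"
    unfolding W2_square[of P Q]
  proof (rule INF_greatest)
    fix \<pi> assume "\<pi> \<in> couplings P Q"
    from mult_left_mono[OF bound[OF this], of "ennreal (1 / c\<^sup>2)"]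
    show "ennreal (1 / c\<^sup>2) * ?W \<le> (\<integral>\<^sup>+p. ennreal ((norm (fst p - snd p))\<^sup>2) \<partial>\<pi>)"
      by (simp add: inv)
  qed
  from mult_left_mono[OF this, of "ennreal (c\<^sup>2)"] show ?thesis by (simp add: inv)
qed

lemma isotropic_gaussian_scale:
  assumes v: "v > 0"
  shows "distr (isotropic_gaussian 1) borel (\<lambda>x. sqrt v *\<^sub>R x) = (isotropic_gaussian v :: (real ^ 'k) measure)"
proof (rule measure_eqI)
  show "sets (distr (isotropic_gaussian 1) borel (\<lambda>x. sqrt v *\<^sub>R x)) = sets (isotropic_gaussian v :: (real ^ 'k) measure)"
    by (simp add: isotropic_gaussian_def)
next
  fix A assume "A \<in> sets (distr (isotropic_gaussian 1 :: (real^'k) measure) borel (\<lambda>x. sqrt v *\<^sub>R x))"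
  then have A [measurable]: "A \<in> sets borel" by simp
  let ?d = "\<lambda>v z. ennreal (\<Prod>i\<in>UNIV. normal_density 0 (sqrt v) ((z::real^'k) $ i))"
  have m [measurable]: "?d v \<in> borel_measurable borel" for v
    by (intro measurable_compose[OF _ measurable_ennreal] borel_measurable_prod
        measurable_compose[OF _ borel_measurable_normal_density] borel_measurable_continuous_onI continuous_intros)
  have d: "ennreal (sqrt v ^ CARD('k)) * ?d v (sqrt v *\<^sub>R x) = ?d 1 x" for x
  proof -
    have "sqrt v * normal_density 0 (sqrt v) (sqrt v * t) = normal_density 0 1 t" for t
    proof -
      have "(sqrt v * t)\<^sup>2 / (2 * (sqrt v)\<^sup>2) = t\<^sup>2 / 2" using v by (simp add: power_mult_distrib)
      moreover have "sqrt (2 * pi * (sqrt v)\<^sup>2) = sqrt (2 * pi) * sqrt v" using v by (simp add: real_sqrt_mult)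
      ultimately show ?thesis using v by (simp add: normal_density_def)
    qed
    then have "(\<Prod>i\<in>UNIV. sqrt v * normal_density 0 (sqrt v) ((sqrt v *\<^sub>R x) $ i)) = (\<Prod>i\<in>UNIV. normal_density 0 1 (x $ i))"
      by simp
    then show ?thesis using v by (simp add: prod.distrib flip: ennreal_mult')
  qed
  have "emeasure (isotropic_gaussian v) A = (\<integral>\<^sup>+z. ?d v z * indicator A z \<partial>lborel)"
    by (simp add: isotropic_gaussian_def emeasure_density)
  also have "\<dots> = (\<integral>\<^sup>+z. ?d v z * indicator A z \<partial>density (distr lborel borel (\<lambda>x. 0 + sqrt v *\<^sub>R x)) (\<lambda>_. ennreal (\<bar>sqrt v\<bar> ^ DIM(real^'k))))"
    using v by (subst lborel_affine[of "sqrt v" "0::real^'k"]) simp_all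
  also have "\<dots> = (\<integral>\<^sup>+x. ennreal (sqrt v ^ CARD('k)) * ?d v (sqrt v *\<^sub>R x) * indicator A (sqrt v *\<^sub>R x) \<partial>lborel)"
    using v by (simp add: nn_integral_density nn_integral_distr mult.assoc del: vector_scaleR_component)
  also have "\<dots> = (\<integral>\<^sup>+x. ?d 1 x * indicator A (sqrt v *\<^sub>R x) \<partial>lborel)"
    unfolding d ..
  also have "\<dots> = emeasure (distr (isotropic_gaussian 1) borel (\<lambda>x. sqrt v *\<^sub>R x)) A"
  proof -
    have "emeasure (distr (isotropic_gaussian 1) borel (\<lambda>x. sqrt v *\<^sub>R x)) A =
        emeasure (isotropic_gaussian 1) ((\<lambda>x::real^'k. sqrt v *\<^sub>R x) -` A \<inter> space (isotropic_gaussian 1 :: (real^'k) measure))"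
      by (intro emeasure_distr) (simp_all add: isotropic_gaussian_def)
    also have "\<dots> = (\<integral>\<^sup>+x. ?d 1 x * indicator ((\<lambda>x::real^'k. sqrt v *\<^sub>R x) -` A) x \<partial>lborel)"
      unfolding isotropic_gaussian_def
      using measurable_sets[of "\<lambda>x::real^'k. sqrt v *\<^sub>R x" borel borel A]
      by (subst emeasure_density) (auto simp: space_borel)
    finally show ?thesis by (simp add: indicator_def vimage_def)
  qed
  finally show "emeasure (distr (isotropic_gaussian 1) borel (\<lambda>x. sqrt v *\<^sub>R x)) A = emeasure (isotropic_gaussian v) A" ..
qed

text \<open>Stated with the mass multiplied through rather than divided, so that it also covers mass
  0, where \<open>D\<close> is the point mass at 0.\<close>

lemma normalised_density:
  fixes h :: "'a::euclidean_space \<Rightarrow> ennreal"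
  assumes [measurable]: "h \<in> borel_measurable borel" and fin: "(\<integral>\<^sup>+x. h x \<partial>lborel) \<noteq> \<infinity>"
  obtains D where "prob_space D" "sets D = sets borel"
    "\<And>F. F \<in> borel_measurable borel \<Longrightarrow>
       (\<integral>\<^sup>+x. h x \<partial>lborel) * (\<integral>\<^sup>+x. F x \<partial>D) = (\<integral>\<^sup>+x. h x * F x \<partial>lborel)"
proof (cases "(\<integral>\<^sup>+x. h x \<partial>lborel) = 0")
  case True
  then have "AE x in lborel. h x = 0" by (simp add: nn_integral_0_iff_AE)
  then have "(\<integral>\<^sup>+x. h x * F x \<partial>lborel) = 0" for F
    by (subst nn_integral_cong_AE[where v = "\<lambda>_. 0"]) auto
  then show ?thesis
    using True by (intro that[of "return borel 0"]) (auto intro: prob_space_return)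
next
  case False
  let ?m = "\<integral>\<^sup>+x. h x \<partial>lborel"
  show ?thesis
  proof (rule that[of "density lborel (\<lambda>x. h x / ?m)"])
    show "prob_space (density lborel (\<lambda>x. h x / ?m))"
      using False fin by (intro prob_spaceI) (simp add: emeasure_density nn_integral_divide less_top)
    fix F :: "'a \<Rightarrow> ennreal" assume [measurable]: "F \<in> borel_measurable borel"
    have "?m * (\<integral>\<^sup>+x. F x \<partial>density lborel (\<lambda>x. h x / ?m)) = (\<integral>\<^sup>+x. ?m * (h x / ?m * F x) \<partial>lborel)"
      by (simp add: nn_integral_density nn_integral_cmult)
    also have "\<dots> = (\<integral>\<^sup>+x. h x * F x \<partial>lborel)"
    proof (intro nn_integral_cong)
      fix x
      have "?m * (h x / ?m) = h x"
        using False fin by (simp only: ennreal_times_divide mult.commute[of ?m] mult_divide_eq_ennreal infinity_ennreal_def not_False_eq_True)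
      then show "?m * (h x / ?m * F x) = h x * F x" by (simp only: mult.assoc[symmetric])
    qed
    finally show "?m * (\<integral>\<^sup>+x. F x \<partial>density lborel (\<lambda>x. h x / ?m)) = (\<integral>\<^sup>+x. h x * F x \<partial>lborel)" .
  qed simp
qed

text \<open>Young's inequality \<open>2 a b \<le> 4 a\<^sup>2 + b\<^sup>2 / 4\<close>, then the
  parallelogram law. The weighting fixes the factors 5 of the smoothing cost and
  \<open>5 / 2\<close> of the mixing cost.\<close>

lemma weighted_triangle_square:
  fixes u y z :: "'a::real_inner"
  shows "(norm (u - z))\<^sup>2 \<le> 5 * (norm (u - y))\<^sup>2 + 5 / 2 * ((norm y)\<^sup>2 + (norm z)\<^sup>2)"
proof -
  have "norm (u - z) \<le> norm (u - y) + norm (y - z)"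
    using norm_triangle_ineq[of "u - y" "y - z"] by simp
  then have "(norm (u - z))\<^sup>2 \<le> (norm (u - y) + norm (y - z))\<^sup>2"
    by (intro power_mono) auto
  also have "\<dots> \<le> 5 * (norm (u - y))\<^sup>2 + 5 / 4 * (norm (y - z))\<^sup>2"
    using zero_le_power2[of "2 * norm (u - y) - norm (y - z) / 2"]
    by (simp add: power2_eq_square algebra_simps)
  also have "(norm (y - z))\<^sup>2 \<le> 2 * ((norm y)\<^sup>2 + (norm z)\<^sup>2)"
  proof -
    have "(norm (y - z))\<^sup>2 + (norm (y + z))\<^sup>2 = 2 * ((norm y)\<^sup>2 + (norm z)\<^sup>2)"
      by (simp add: power2_norm_eq_inner inner_diff_left inner_diff_right inner_add_left inner_add_right inner_commute)
    then show ?thesis using zero_le_power2[of "norm (y + z)"] by linarith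
  qed
  finally show ?thesis by (simp add: field_simps)
qed

text \<open>
  Given \<open>y\<close>, move to \<open>z = y\<close> with probability \<open>min 1 (g y / f y)\<close> and otherwise draw \<open>z\<close> from the
  normalised excess \<open>(g - f)\<^sup>+\<close>. As this is an explicit kernel, the coupling of \<open>u\<close> and \<open>z\<close> needs no
  general gluing of transport plans.
\<close>

lemma W2_square_le_density_difference:
  fixes S :: "'s measure" and u y :: "'s \<Rightarrow> real ^ 'k" and f g :: "real ^ 'k \<Rightarrow> real"
  assumes S: "prob_space S"
    and [measurable]: "u \<in> borel_measurable S" "y \<in> borel_measurable S"
      "f \<in> borel_measurable borel" "g \<in> borel_measurable borel"
    and nn: "\<And>z. f z \<ge> 0" "\<And>z. g z \<ge> 0"
    and y: "distr S borel y = density lborel f"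
    and g: "(\<integral>\<^sup>+z. g z \<partial>lborel) = 1"
  shows "(W2 (distr S borel u) (density lborel g))\<^sup>2 \<le>
    5 * (\<integral>\<^sup>+s. ennreal ((norm (u s - y s))\<^sup>2) \<partial>S) +
    ennreal (5 / 2) * (\<integral>\<^sup>+z. ennreal ((norm z)\<^sup>2 * \<bar>f z - g z\<bar>) \<partial>lborel)"
proof -
  interpret S: prob_space S by fact
  \<comment> \<open>Acceptance probability. Where \<open>f z = 0\<close> the quotient is 0 by
    convention, and both identities \<open>fr\<close> still hold because of the factor
    \<open>f z\<close>.\<close>
  define r where "r z = min 1 (g z / f z)" for z
  have [measurable]: "r \<in> borel_measurable borel" unfolding r_def by measurable
  have r: "0 \<le> r z" "r z \<le> 1" for z using nn by (auto simp: r_def)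
  have fr: "f z * r z = min (f z) (g z)" "f z * (1 - r z) = max 0 (f z - g z)" for z
    using nn[of z] by (cases "f z = 0"; simp add: r_def min_def max_def field_simps)+
  have int_y: "(\<integral>\<^sup>+s. F (y s) \<partial>S) = (\<integral>\<^sup>+z. ennreal (f z) * F z \<partial>lborel)" if [measurable]: "F \<in> borel_measurable borel" for F
    using arg_cong[OF y, of "\<lambda>M. nn_integral M F"] by (simp add: nn_integral_distr nn_integral_density)
  have f1: "(\<integral>\<^sup>+z. f z \<partial>lborel) = 1"
    using int_y[of "\<lambda>_. 1"] by (simp add: S.emeasure_space_1)
  define h where "h z = ennreal (max 0 (g z - f z))" for z
  have [measurable]: "h \<in> borel_measurable borel" unfolding h_def by measurable
  let ?m = "\<integral>\<^sup>+z. h z \<partial>lborel"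
  let ?min = "\<integral>\<^sup>+z. ennreal (min (f z) (g z)) \<partial>lborel"
  have "?min + ?m = (\<integral>\<^sup>+z. g z \<partial>lborel)"
    unfolding h_def using nn
    by (subst nn_integral_add[symmetric]) (auto intro!: nn_integral_cong simp: min_def max_def simp flip: ennreal_plus)
  also have "\<dots> = (\<integral>\<^sup>+z. f z \<partial>lborel)" using f1 g by simp
  also have "\<dots> = ?min + (\<integral>\<^sup>+z. ennreal (max 0 (f z - g z)) \<partial>lborel)"
    using nn
    by (subst nn_integral_add[symmetric]) (auto intro!: nn_integral_cong simp: min_def max_def simp flip: ennreal_plus)
  finally have "?min + ?m = ?min + (\<integral>\<^sup>+z. ennreal (max 0 (f z - g z)) \<partial>lborel)" .
  moreover have "?min \<le> (\<integral>\<^sup>+z. f z \<partial>lborel)"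
    by (intro nn_integral_mono) (auto simp: nn)
  \<comment> \<open>Equal total masses: the excess of \<open>g\<close> over \<open>f\<close> weighs
    as much as that of \<open>f\<close> over \<open>g\<close>. Cancelling uses that the overlap has
    finite mass.\<close>
  ultimately have m: "?m = (\<integral>\<^sup>+z. ennreal (max 0 (f z - g z)) \<partial>lborel)"
    using f1 by (simp add: ennreal_add_left_cancel) (metis ennreal_one_neq_top top.extremum_unique)
  have "?m \<le> (\<integral>\<^sup>+z. g z \<partial>lborel)"
    unfolding h_def using nn by (intro nn_integral_mono) (auto simp: max_def intro: ennreal_leI)
  then have m_fin: "?m \<noteq> \<infinity>" using g by (auto simp: top_unique)
  obtain D where D: "prob_space D" "sets D = sets borel"
    and int_D: "\<And>F. F \<in> borel_measurable borel \<Longrightarrow> ?m * (\<integral>\<^sup>+x. F x \<partial>D) = (\<integral>\<^sup>+x. h x * F x \<partial>lborel)"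
    using normalised_density[of h] m_fin by auto
  interpret D: prob_space D by fact
  note [measurable_cong] = D(2)
  have res: "(\<integral>\<^sup>+s. ennreal (1 - r (y s)) \<partial>S) = ?m"
    unfolding m by (subst int_y) (auto simp: fr nn r simp flip: ennreal_mult)
  \<comment> \<open>The coin is a third coordinate \<open>b\<close>, with the acceptance probability
    as density against counting measure; \<open>z\<close> is drawn from \<open>D\<close> and ignored
    when \<open>b\<close> holds.\<close>
  define N where "N = density (S \<Otimes>\<^sub>M (D \<Otimes>\<^sub>M count_space (UNIV :: bool set)))
      (\<lambda>(s, z, b). ennreal (if b then r (y s) else 1 - r (y s)))"
  define T where "T = (\<lambda>(s, z, b). (u s, if b then y s else z))"
  define \<pi> where "\<pi> = distr N (borel \<Otimes>\<^sub>M borel) T"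
  have [measurable]: "T \<in> S \<Otimes>\<^sub>M (D \<Otimes>\<^sub>M count_space (UNIV :: bool set)) \<rightarrow>\<^sub>M borel \<Otimes>\<^sub>M borel"
    unfolding T_def by measurable
  then have T [measurable]: "T \<in> N \<rightarrow>\<^sub>M borel \<Otimes>\<^sub>M borel"
    by (simp add: N_def)
  interpret B: sigma_finite_measure "count_space (UNIV :: bool set)"
    by (rule sigma_finite_measure_count_space)
  interpret DB: pair_sigma_finite D "count_space (UNIV :: bool set)" ..
  have int_\<pi>: "(\<integral>\<^sup>+p. F p \<partial>\<pi>) = (\<integral>\<^sup>+s. ennreal (r (y s)) * F (u s, y s) \<partial>S) +
      (\<integral>\<^sup>+s. \<integral>\<^sup>+z. ennreal (1 - r (y s)) * F (u s, z) \<partial>D \<partial>S)"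
    if [measurable]: "F \<in> borel_measurable (borel \<Otimes>\<^sub>M borel)" for F :: "(real^'k) \<times> (real^'k) \<Rightarrow> ennreal"
  proof -
    have "(\<integral>\<^sup>+p. F p \<partial>\<pi>) = (\<integral>\<^sup>+(s, z, b). ennreal (if b then r (y s) else 1 - r (y s)) * F (u s, if b then y s else z)
        \<partial>(S \<Otimes>\<^sub>M (D \<Otimes>\<^sub>M count_space (UNIV :: bool set))))"
      unfolding \<pi>_def
      by (subst nn_integral_distr, simp, simp, unfold N_def, subst nn_integral_density)
         (auto simp: T_def split_beta' intro!: nn_integral_cong)
    also have "\<dots> = (\<integral>\<^sup>+s. \<integral>\<^sup>+z. \<integral>\<^sup>+b. ennreal (if b then r (y s) else 1 - r (y s)) * F (u s, if b then y s else z)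
        \<partial>count_space (UNIV :: bool set) \<partial>D \<partial>S)"
      by (subst sigma_finite_measure.nn_integral_fst[OF DB.sigma_finite_measure_axioms, symmetric], simp, intro nn_integral_cong, simp,
          subst B.nn_integral_fst[symmetric]) (auto intro!: nn_integral_cong)
    also have "\<dots> = (\<integral>\<^sup>+s. \<integral>\<^sup>+z. ennreal (r (y s)) * F (u s, y s) + ennreal (1 - r (y s)) * F (u s, z) \<partial>D \<partial>S)"
      by (simp add: nn_integral_count_space_finite UNIV_bool add.commute)
    also have "\<dots> = (\<integral>\<^sup>+s. (ennreal (r (y s)) * F (u s, y s) + (\<integral>\<^sup>+z. ennreal (1 - r (y s)) * F (u s, z) \<partial>D)) \<partial>S)"
      by (intro nn_integral_cong, subst nn_integral_add) (auto simp: D.emeasure_space_1)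
    also have "\<dots> = (\<integral>\<^sup>+s. ennreal (r (y s)) * F (u s, y s) \<partial>S) + (\<integral>\<^sup>+s. \<integral>\<^sup>+z. ennreal (1 - r (y s)) * F (u s, z) \<partial>D \<partial>S)"
      by (subst nn_integral_add) auto
    finally show ?thesis .
  qed
  have one: "ennreal (r z) + ennreal (1 - r z) = 1" for z
    using r[of z] by (simp flip: ennreal_plus)
  have left: "(\<integral>\<^sup>+p. F (fst p) \<partial>\<pi>) = (\<integral>\<^sup>+s. F (u s) \<partial>S)" if [measurable]: "F \<in> borel_measurable borel" for F
  proof -
    have "(\<integral>\<^sup>+p. F (fst p) \<partial>\<pi>) = (\<integral>\<^sup>+s. (ennreal (r (y s)) + ennreal (1 - r (y s))) * F (u s) \<partial>S)"
      by (subst int_\<pi>) (simp_all add: D.emeasure_space_1 distrib_right nn_integral_add)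
    then show ?thesis by (simp add: one)
  qed
  have right: "(\<integral>\<^sup>+p. F (snd p) \<partial>\<pi>) = (\<integral>\<^sup>+z. ennreal (g z) * F z \<partial>lborel)" if [measurable]: "F \<in> borel_measurable borel" for F
  proof -
    have "(\<integral>\<^sup>+p. F (snd p) \<partial>\<pi>) = (\<integral>\<^sup>+s. ennreal (r (y s)) * F (y s) \<partial>S) + (\<integral>\<^sup>+s. ennreal (1 - r (y s)) * (\<integral>\<^sup>+z. F z \<partial>D) \<partial>S)"
      by (subst int_\<pi>) (simp_all add: nn_integral_cmult)
    also have "\<dots> = (\<integral>\<^sup>+z. ennreal (min (f z) (g z)) * F z \<partial>lborel) + ?m * (\<integral>\<^sup>+z. F z \<partial>D)"
      by (subst int_y) (simp_all add: nn_integral_multc res nn r fr flip: mult.assoc ennreal_mult)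
    also have "\<dots> = (\<integral>\<^sup>+z. (ennreal (min (f z) (g z)) + h z) * F z \<partial>lborel)"
      by (subst int_D) (simp_all add: distrib_right nn_integral_add)
    also have "\<dots> = (\<integral>\<^sup>+z. ennreal (g z) * F z \<partial>lborel)"
      unfolding h_def using nn
      by (intro nn_integral_cong arg_cong2[where f = "(*)"]) (auto simp: min_def max_def simp flip: ennreal_plus)
    finally show ?thesis .
  qed
  have "\<pi> \<in> couplings (distr S borel u) (density lborel g)"
    unfolding couplings_def
  proof (intro CollectI conjI)
    show s: "sets \<pi> = sets (borel \<Otimes>\<^sub>M borel)" by (simp add: \<pi>_def)
    show "prob_space \<pi>"
      using left[of "\<lambda>_. 1"] by (intro prob_spaceI) (simp add: S.emeasure_space_1)
    note [measurable_cong] = s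
    show "distr \<pi> borel fst = distr S borel u"
    proof (rule measure_eqI)
      fix A assume "A \<in> sets (distr \<pi> borel fst)"
      then have [measurable]: "A \<in> sets borel" by simp
      have "emeasure (distr \<pi> borel fst) A = (\<integral>\<^sup>+p. indicator A (fst p) \<partial>\<pi>)"
        by (simp add: nn_integral_distr flip: nn_integral_indicator)
      also have "\<dots> = emeasure (distr S borel u) A"
        by (simp add: left) (simp add: nn_integral_distr flip: nn_integral_indicator)
      finally show "emeasure (distr \<pi> borel fst) A = emeasure (distr S borel u) A" .
    qed simp
    show "distr \<pi> borel snd = density lborel g"
    proof (rule measure_eqI)
      fix A assume "A \<in> sets (distr \<pi> borel snd)"
      then have [measurable]: "A \<in> sets borel" by simp
      have "emeasure (distr \<pi> borel snd) A = (\<integral>\<^sup>+p. indicator A (snd p) \<partial>\<pi>)"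
        by (simp add: nn_integral_distr flip: nn_integral_indicator)
      also have "\<dots> = emeasure (density lborel g) A"
        by (simp add: right emeasure_density)
      finally show "emeasure (distr \<pi> borel snd) A = emeasure (density lborel g) A" .
    qed simp
  qed
  then have "(W2 (distr S borel u) (density lborel g))\<^sup>2 \<le> (\<integral>\<^sup>+p. ennreal ((norm (fst p - snd p))\<^sup>2) \<partial>\<pi>)"
    by (rule W2_square_le)
  also have "\<dots> = (\<integral>\<^sup>+s. ennreal (r (y s)) * ennreal ((norm (u s - y s))\<^sup>2) \<partial>S) +
      (\<integral>\<^sup>+s. \<integral>\<^sup>+z. ennreal (1 - r (y s)) * ennreal ((norm (u s - z))\<^sup>2) \<partial>D \<partial>S)"
    by (subst int_\<pi>) simp_all
  \<comment> \<open>On the accepted branch a factor 5 is given away, so that the two probabilities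
    add up to 1 in front of the smoothing cost.\<close>
  also have "\<dots> \<le> (\<integral>\<^sup>+s. ennreal (r (y s)) * (5 * ennreal ((norm (u s - y s))\<^sup>2)) \<partial>S) +
      (\<integral>\<^sup>+s. \<integral>\<^sup>+z. ennreal (1 - r (y s)) * (5 * ennreal ((norm (u s - y s))\<^sup>2) +
         ennreal (5 / 2) * (ennreal ((norm (y s))\<^sup>2) + ennreal ((norm z)\<^sup>2))) \<partial>D \<partial>S)"
  proof (intro add_mono nn_integral_mono mult_left_mono)
    show "ennreal ((norm (u s - y s))\<^sup>2) \<le> 5 * ennreal ((norm (u s - y s))\<^sup>2)" for s
      using mult_right_mono[of 1 "5::ennreal"] by simp
    show "ennreal ((norm (u s - z))\<^sup>2) \<le> 5 * ennreal ((norm (u s - y s))\<^sup>2) +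
         ennreal (5 / 2) * (ennreal ((norm (y s))\<^sup>2) + ennreal ((norm z)\<^sup>2))" for s z
    proof -
      have "ennreal ((norm (u s - z))\<^sup>2) \<le> ennreal (5 * (norm (u s - y s))\<^sup>2 + 5 / 2 * ((norm (y s))\<^sup>2 + (norm z)\<^sup>2))"
        by (intro ennreal_leI weighted_triangle_square)
      also have "\<dots> = ennreal 5 * ennreal ((norm (u s - y s))\<^sup>2) +
         ennreal (5 / 2) * (ennreal ((norm (y s))\<^sup>2) + ennreal ((norm z)\<^sup>2))"
        by (simp del: ennreal_numeral flip: ennreal_plus ennreal_mult)
      finally show ?thesis by simp
    qed
  qed auto
  also have "\<dots> = 5 * (\<integral>\<^sup>+s. (ennreal (r (y s)) + ennreal (1 - r (y s))) * ennreal ((norm (u s - y s))\<^sup>2) \<partial>S) +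
     ennreal (5 / 2) * ((\<integral>\<^sup>+s. ennreal (1 - r (y s)) * ennreal ((norm (y s))\<^sup>2) \<partial>S) +
      (\<integral>\<^sup>+s. ennreal (1 - r (y s)) \<partial>S) * (\<integral>\<^sup>+z. ennreal ((norm z)\<^sup>2) \<partial>D))"
  proof -
    let ?c = "\<lambda>s. ennreal ((norm (u s - y s))\<^sup>2)" and ?a = "\<lambda>s. ennreal ((norm (y s))\<^sup>2)"
    let ?B = "\<integral>\<^sup>+z. ennreal ((norm z)\<^sup>2) \<partial>D" and ?r = "\<lambda>s. ennreal (r (y s))" and ?r' = "\<lambda>s. ennreal (1 - r (y s))"
    have "(\<integral>\<^sup>+z. ?r' s * (5 * ?c s + ennreal (5 / 2) * (?a s + ennreal ((norm z)\<^sup>2))) \<partial>D) =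
        ?r' s * (5 * ?c s + ennreal (5 / 2) * (?a s + ?B))" for s
      by (simp add: nn_integral_cmult nn_integral_add D.emeasure_space_1)
    then have "(\<integral>\<^sup>+s. ?r s * (5 * ?c s) \<partial>S) +
      (\<integral>\<^sup>+s. \<integral>\<^sup>+z. ?r' s * (5 * ?c s + ennreal (5 / 2) * (?a s + ennreal ((norm z)\<^sup>2))) \<partial>D \<partial>S) =
      (\<integral>\<^sup>+s. ?r s * (5 * ?c s) + ?r' s * (5 * ?c s + ennreal (5 / 2) * (?a s + ?B)) \<partial>S)"
      by (simp add: nn_integral_add)
    also have "\<dots> = (\<integral>\<^sup>+s. 5 * ((?r s + ?r' s) * ?c s) + ennreal (5 / 2) * (?r' s * ?a s + ?r' s * ?B) \<partial>S)"
      by (intro nn_integral_cong) (simp only: distrib_left distrib_right mult_ac add_ac)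
    also have "\<dots> = 5 * (\<integral>\<^sup>+s. (?r s + ?r' s) * ?c s \<partial>S) +
        ennreal (5 / 2) * ((\<integral>\<^sup>+s. ?r' s * ?a s \<partial>S) + (\<integral>\<^sup>+s. ?r' s \<partial>S) * ?B)"
      by (simp add: nn_integral_add nn_integral_cmult nn_integral_multc)
    finally show ?thesis .
  qed
  \<comment> \<open>The rejection probability equals the mass of \<open>h\<close>, so the
    unnormalised excess reappears; together with the rejected part of \<open>f\<close> it makes up
    the absolute difference of \<open>f\<close> and \<open>g\<close>.\<close>
  also have "(\<integral>\<^sup>+s. ennreal (1 - r (y s)) \<partial>S) * (\<integral>\<^sup>+z. ennreal ((norm z)\<^sup>2) \<partial>D) = (\<integral>\<^sup>+z. h z * ennreal ((norm z)\<^sup>2) \<partial>lborel)"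
    unfolding res by (rule int_D) simp
  also have "(\<integral>\<^sup>+s. ennreal (1 - r (y s)) * ennreal ((norm (y s))\<^sup>2) \<partial>S) =
      (\<integral>\<^sup>+z. ennreal (max 0 (f z - g z)) * ennreal ((norm z)\<^sup>2) \<partial>lborel)"
    by (subst int_y) (simp_all only: mult.assoc[symmetric] ennreal_mult'[OF nn(1), symmetric] fr, measurable)
  also have "(\<integral>\<^sup>+z. ennreal (max 0 (f z - g z)) * ennreal ((norm z)\<^sup>2) \<partial>lborel) + (\<integral>\<^sup>+z. h z * ennreal ((norm z)\<^sup>2) \<partial>lborel) =
      (\<integral>\<^sup>+z. ennreal ((norm z)\<^sup>2 * \<bar>f z - g z\<bar>) \<partial>lborel)"
  proof -
    have "ennreal (max 0 (f z - g z)) * ennreal ((norm z)\<^sup>2) + h z * ennreal ((norm z)\<^sup>2) =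
        ennreal ((norm z)\<^sup>2 * \<bar>f z - g z\<bar>)" for z
      by (cases "f z \<ge> g z") (simp_all add: h_def max_def mult.commute ennreal_mult' ennreal_neg)
    then show ?thesis by (subst nn_integral_add[symmetric]) simp_all
  qed
  finally show ?thesis by (simp add: one)
qed

section \<open>Shrinking and smoothing\<close>

text \<open>
  Dividing by \<open>max 1 (\<parallel>x\<parallel> / sqrt n)\<close> caps the norm of long vectors only: normalising short vectors as well
  would destroy the control of their inner products by \<open>\<beta>\<^sub>1\<close> and \<open>\<beta>\<^sub>2\<close>.
\<close>

definition shrink :: "real \<Rightarrow> real^'n \<Rightarrow> real^'n" where
  "shrink t x = (sqrt (1 - t) / max 1 (norm x / sqrt (real CARD('n)))) *\<^sub>R x"

definition noise :: "real \<Rightarrow> real^'n \<Rightarrow> real" where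
  "noise t x = 1 - 1 / real CARD('n) * (shrink t x \<bullet> shrink t x)"

lemma measurable_shrink [measurable]: "shrink t \<in> borel_measurable borel"
  unfolding shrink_def[abs_def] by measurable

lemma measurable_noise [measurable]: "noise t \<in> borel_measurable borel"
  unfolding noise_def[abs_def] by measurable

lemma shrink_inner_self_le:
  fixes x :: "real^'n"
  assumes "0 < t" "t < 1"
  shows "1 / real CARD('n) * (shrink t x \<bullet> shrink t x) \<le> 1 - t"
proof -
  define r where "r = norm x / sqrt (real CARD('n))"
  have r: "r \<ge> 0" by (simp add: r_def)
  have r2: "r\<^sup>2 = 1 / real CARD('n) * (x \<bullet> x)"
    by (simp add: r_def power_divide power2_norm_eq_inner)
  have "1 / real CARD('n) * (shrink t x \<bullet> shrink t x) = (1 - t) * (r\<^sup>2 / (max 1 r)\<^sup>2)"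
    using assms unfolding r2 by (simp add: shrink_def r_def[symmetric] power2_eq_square)
  also have "r\<^sup>2 / (max 1 r)\<^sup>2 \<le> 1"
  proof -
    have "r\<^sup>2 \<le> (max 1 r)\<^sup>2" using r by (intro power_mono) auto
    moreover have "(max 1 r)\<^sup>2 > 0" by (simp add: max_def)
    ultimately show ?thesis by simp
  qed
  finally show ?thesis using assms by (simp add: mult_left_mono)
qed

lemma noise_bounds:
  assumes "0 < t" "t < 1"
  shows "t \<le> noise t x" "noise t x \<le> 1" "0 < noise t x"
  using shrink_inner_self_le[OF assms, of x] assms unfolding noise_def
    by (linarith, simp, linarith)

text \<open>The first bound keeps the correlation at distance \<open>t\<close> from 1. The second
  retains the factor \<open>1 - t\<close>, which later cancels the division by
  \<open>R = 1 - t\<close> in the quadratic term.\<close>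

lemma shrink_inner_le:
  fixes x y :: "real^'n"
  assumes "0 < t" "t < 1"
  shows "\<bar>1 / real CARD('n) * (shrink t x \<bullet> shrink t y)\<bar> \<le> 1 - t"
    and "\<bar>1 / real CARD('n) * (shrink t x \<bullet> shrink t y)\<bar> \<le> (1 - t) * (\<bar>x \<bullet> y\<bar> / real CARD('n))"
proof -
  have "\<bar>shrink t x \<bullet> shrink t y\<bar> \<le> norm (shrink t x) * norm (shrink t y)"
    by (rule Cauchy_Schwarz_ineq2)
  also have "\<dots> \<le> ((norm (shrink t x))\<^sup>2 + (norm (shrink t y))\<^sup>2) / 2"
    using sum_squares_bound[of "norm (shrink t x)" "norm (shrink t y)"] by simp
  finally have "\<bar>1 / real CARD('n) * (shrink t x \<bullet> shrink t y)\<bar> \<le>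
      (1 / real CARD('n) * (shrink t x \<bullet> shrink t x) + 1 / real CARD('n) * (shrink t y \<bullet> shrink t y)) / 2"
    by (simp add: power2_norm_eq_inner abs_mult field_simps)
  also have "\<dots> \<le> ((1 - t) + (1 - t)) / 2"
    by (intro divide_right_mono add_mono shrink_inner_self_le assms) simp
  also have "((1 - t) + (1 - t)) / 2 = 1 - t" by simp
  finally show "\<bar>1 / real CARD('n) * (shrink t x \<bullet> shrink t y)\<bar> \<le> 1 - t" .
next
  define a where "a = max 1 (norm x / sqrt (real CARD('n)))"
  define b where "b = max 1 (norm y / sqrt (real CARD('n)))"
  have ab: "a \<ge> 1" "b \<ge> 1" by (simp_all add: a_def b_def)
  have sq: "sqrt (1 - t) * (sqrt (1 - t) * z) = (1 - t) * z" for z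
    using assms by (simp flip: mult.assoc)
  have "\<bar>1 / real CARD('n) * (shrink t x \<bullet> shrink t y)\<bar> = (1 - t) * (\<bar>x \<bullet> y\<bar> / real CARD('n)) * (1 / (a * b))"
    using assms ab by (simp add: shrink_def a_def[symmetric] b_def[symmetric] abs_mult sq mult.commute)
  also have "\<dots> \<le> (1 - t) * (\<bar>x \<bullet> y\<bar> / real CARD('n)) * 1"
    using assms ab mult_mono[of 1 a 1 b] by (intro mult_left_mono) auto
  finally show "\<bar>1 / real CARD('n) * (shrink t x \<bullet> shrink t y)\<bar> \<le> (1 - t) * (\<bar>x \<bullet> y\<bar> / real CARD('n))"
    by simp
qed

text \<open>The left side is the expected squared displacement per coordinate. With
  \<open>r = \<parallel>x\<parallel> / sqrt n\<close>, \<open>m = max 1 r\<close> and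
  \<open>c = sqrt (1 - t)\<close> it equals \<open>r\<^sup>2 + 1 - 2 * c * r\<^sup>2 / m\<close>;
  writing \<open>c = 1 - (1 - c)\<close> separates the effect of capping from that of
  shrinking.\<close>

lemma shrink_cost_le:
  fixes x :: "real^'n"
  assumes "0 < t" "t < 1"
  shows "1 / real CARD('n) * ((x - shrink t x) \<bullet> (x - shrink t x)) + noise t x \<le>
    \<bar>(norm x)\<^sup>2 / real CARD('n) - 1\<bar> + 2 * (1 - sqrt (1 - t)) * ((norm x)\<^sup>2 / real CARD('n))"
proof -
  define r where "r = norm x / sqrt (real CARD('n))"
  define m where "m = max 1 r"
  define c where "c = sqrt (1 - t)"
  have c: "0 \<le> c" "c \<le> 1" using assms by (simp_all add: c_def)
  have r: "r \<ge> 0" by (simp add: r_def)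
  have m: "m \<ge> 1" by (simp add: m_def)
  have r2: "r\<^sup>2 = 1 / real CARD('n) * (x \<bullet> x)" "(norm x)\<^sup>2 / real CARD('n) = r\<^sup>2"
    by (simp_all add: r_def power_divide power2_norm_eq_inner)
  have sh: "shrink t x = (c / m) *\<^sub>R x"
    by (simp add: shrink_def c_def m_def r_def)
  have diff: "x - shrink t x = (1 - c / m) *\<^sub>R x"
    by (simp add: sh algebra_simps)
  have "1 / real CARD('n) * ((x - shrink t x) \<bullet> (x - shrink t x)) + noise t x =
    (1 - c / m)\<^sup>2 * r\<^sup>2 + (1 - (c / m)\<^sup>2 * r\<^sup>2)"
  proof -
    have *: "1 / real CARD('n) * ((a *\<^sub>R x) \<bullet> (a *\<^sub>R x)) = a\<^sup>2 * r\<^sup>2" for a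
      unfolding r2 by (simp add: power2_eq_square)
    show ?thesis unfolding noise_def diff unfolding sh * ..
  qed
  also have "\<dots> = (r\<^sup>2 + 1 - 2 * (r\<^sup>2 / m)) + 2 * (1 - c) * (r\<^sup>2 / m)"
    by (simp add: power2_eq_square algebra_simps)
  \<comment> \<open>This is \<open>1 - r\<^sup>2\<close> for \<open>r \<le> 1\<close>, and beyond
    that \<open>(r - 1)\<^sup>2 \<le> r\<^sup>2 - 1\<close>.\<close>
  also have "r\<^sup>2 + 1 - 2 * (r\<^sup>2 / m) \<le> \<bar>r\<^sup>2 - 1\<bar>"
  proof (cases "r \<le> 1")
    case True
    then show ?thesis by (simp add: m_def)
  next
    case False
    then have "r\<^sup>2 / m = r" by (simp add: m_def power2_eq_square)
    moreover have "r * 1 \<le> r * r" using False by (intro mult_left_mono) auto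
    ultimately show ?thesis using False by (simp add: power2_eq_square)
  qed
  also have "2 * (1 - c) * (r\<^sup>2 / m) \<le> 2 * (1 - c) * r\<^sup>2"
    using c m divide_left_mono[of 1 m "r\<^sup>2"] by (intro mult_left_mono) auto
  finally show ?thesis unfolding r2 c_def by simp
qed

text \<open>The independent coupling with the parallelogram law; the source of the trivial bound 4
  per coordinate.\<close>

lemma W2_square_le_moments:
  fixes P Q :: "(real^'k) measure"
  assumes P: "prob_space P" "sets P = sets borel" and Q: "prob_space Q" "sets Q = sets borel"
  shows "(W2 P Q)\<^sup>2 \<le> 2 * (\<integral>\<^sup>+x. ennreal ((norm x)\<^sup>2) \<partial>P) + 2 * (\<integral>\<^sup>+x. ennreal ((norm x)\<^sup>2) \<partial>Q)"
proof -
  interpret P: prob_space P by fact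
  interpret Q: prob_space Q by fact
  interpret PQ: pair_prob_space P Q ..
  note [measurable_cong] = P(2) Q(2)
  have "distr (P \<Otimes>\<^sub>M Q) borel fst = P"
  proof (rule measure_eqI)
    fix A assume "A \<in> sets (distr (P \<Otimes>\<^sub>M Q) borel fst)"
    then have [measurable]: "A \<in> sets borel" by simp
    have "emeasure (distr (P \<Otimes>\<^sub>M Q) borel fst) A = (\<integral>\<^sup>+p. indicator A (fst p) \<partial>(P \<Otimes>\<^sub>M Q))"
      by (simp add: nn_integral_distr flip: nn_integral_indicator)
    also have "\<dots> = emeasure P A"
      using P(2) by (subst Q.nn_integral_fst[symmetric]) (simp_all add: Q.emeasure_space_1)
    finally show "emeasure (distr (P \<Otimes>\<^sub>M Q) borel fst) A = emeasure P A" .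
  qed (simp add: P)
  moreover have "distr (P \<Otimes>\<^sub>M Q) borel snd = Q"
  proof (rule measure_eqI)
    fix A assume "A \<in> sets (distr (P \<Otimes>\<^sub>M Q) borel snd)"
    then have [measurable]: "A \<in> sets borel" by simp
    have "emeasure (distr (P \<Otimes>\<^sub>M Q) borel snd) A = (\<integral>\<^sup>+p. indicator A (snd p) \<partial>(P \<Otimes>\<^sub>M Q))"
      by (simp add: nn_integral_distr flip: nn_integral_indicator)
    also have "\<dots> = emeasure Q A"
      using Q(2) by (subst Q.nn_integral_fst[symmetric]) (simp_all add: P.emeasure_space_1)
    finally show "emeasure (distr (P \<Otimes>\<^sub>M Q) borel snd) A = emeasure Q A" .
  qed (simp add: Q)
  moreover have "prob_space (P \<Otimes>\<^sub>M Q)" by (rule PQ.prob_space_axioms)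
  moreover have "sets (P \<Otimes>\<^sub>M Q) = sets (borel \<Otimes>\<^sub>M borel)"
    by (intro sets_pair_measure_cong P Q)
  ultimately have "P \<Otimes>\<^sub>M Q \<in> couplings P Q" by (simp add: couplings_def)
  then have "(W2 P Q)\<^sup>2 \<le> (\<integral>\<^sup>+p. ennreal ((norm (fst p - snd p))\<^sup>2) \<partial>(P \<Otimes>\<^sub>M Q))"
    by (rule W2_square_le)
  also have "\<dots> \<le> (\<integral>\<^sup>+p. 2 * ennreal ((norm (fst p))\<^sup>2) + 2 * ennreal ((norm (snd p))\<^sup>2) \<partial>(P \<Otimes>\<^sub>M Q))"
  proof (intro nn_integral_mono)
    fix p :: "(real^'k) \<times> (real^'k)"
    have "(norm (fst p - snd p))\<^sup>2 + (norm (fst p + snd p))\<^sup>2 = 2 * (norm (fst p))\<^sup>2 + 2 * (norm (snd p))\<^sup>2"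
      by (simp add: power2_norm_eq_inner inner_diff_left inner_diff_right inner_add_left inner_add_right inner_commute)
    then have "(norm (fst p - snd p))\<^sup>2 \<le> 2 * (norm (fst p))\<^sup>2 + 2 * (norm (snd p))\<^sup>2"
      using zero_le_power2[of "norm (fst p + snd p)"] by linarith
    then have "ennreal ((norm (fst p - snd p))\<^sup>2) \<le> ennreal (2 * (norm (fst p))\<^sup>2 + 2 * (norm (snd p))\<^sup>2)"
      by (rule ennreal_leI)
    also have "\<dots> = ennreal 2 * ennreal ((norm (fst p))\<^sup>2) + ennreal 2 * ennreal ((norm (snd p))\<^sup>2)"
      by (simp del: ennreal_numeral flip: ennreal_plus ennreal_mult)
    finally show "ennreal ((norm (fst p - snd p))\<^sup>2) \<le> 2 * ennreal ((norm (fst p))\<^sup>2) + 2 * ennreal ((norm (snd p))\<^sup>2)"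
      by simp
  qed
  also have "\<dots> = 2 * (\<integral>\<^sup>+x. ennreal ((norm x)\<^sup>2) \<partial>P) + 2 * (\<integral>\<^sup>+x. ennreal ((norm x)\<^sup>2) \<partial>Q)"
    by (subst Q.nn_integral_fst[symmetric])
       (simp_all add: nn_integral_add nn_integral_cmult Q.emeasure_space_1 P.emeasure_space_1)
  finally show ?thesis .
qed

section \<open>The Gaussian smoothing kernel and its averages over the random matrix\<close>

definition shifted_gaussian :: "real \<Rightarrow> real^'k \<Rightarrow> real^'k \<Rightarrow> real" where
  "shifted_gaussian v m y = (\<Prod>i\<in>UNIV. nd v (y $ i - m $ i))"

lemma shifted_gaussian_nonneg [simp]: "0 \<le> shifted_gaussian v m y"
  by (simp add: shifted_gaussian_def prod_nonneg)

lemma measurable_normal_density_all [measurable (raw)]: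
  assumes [measurable]: "s \<in> borel_measurable M" "x \<in> borel_measurable M"
  shows "(\<lambda>w. normal_density 0 (s w) (x w)) \<in> borel_measurable M"
  unfolding normal_density_def by measurable

lemma measurable_shifted_gaussian [measurable (raw)]:
  assumes [measurable]: "v \<in> borel_measurable M" "m \<in> borel_measurable M" "y \<in> borel_measurable M"
  shows "(\<lambda>w. shifted_gaussian (v w) (m w) (y w)) \<in> borel_measurable M"
  unfolding shifted_gaussian_def by measurable

lemma nn_integral_shifted_gaussian:
  assumes "v > 0"
  shows "(\<integral>\<^sup>+y. ennreal (shifted_gaussian v m y) \<partial>lborel) = 1"
  unfolding shifted_gaussian_def prod_ennreal[OF normal_density_nonneg, symmetric]
  using assms nn_integral_lborel_vec_prod[of "\<lambda>i x. ennreal (nd v (x - m $ i))"]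
  by (simp add: nn_integral_nd_shift)

lemma nn_integral_shifted_gaussian_component:
  fixes m :: "real^'k"
  assumes v: "v > 0" and [measurable]: "h \<in> borel_measurable borel"
  shows "(\<integral>\<^sup>+y. ennreal (shifted_gaussian v m y) * h (y $ i) \<partial>lborel) = (\<integral>\<^sup>+x. ennreal (nd v (x - m $ i)) * h x \<partial>lborel)"
proof -
  let ?g = "\<lambda>j x. ennreal (nd v (x - m $ j)) * (if j = i then h x else 1)"
  have "ennreal (shifted_gaussian v m y) * h (y $ i) = (\<Prod>j\<in>UNIV. ?g j (y $ j))" for y
    unfolding shifted_gaussian_def prod_ennreal[OF normal_density_nonneg, symmetric]
    by (simp add: prod.distrib prod.delta)
  then have "(\<integral>\<^sup>+y. ennreal (shifted_gaussian v m y) * h (y $ i) \<partial>lborel) = (\<Prod>j\<in>UNIV. \<integral>\<^sup>+x. ?g j x \<partial>lborel)"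
    by (simp only:) (rule nn_integral_lborel_vec_prod, measurable)
  also have "\<dots> = (\<integral>\<^sup>+x. ?g i x \<partial>lborel) * (\<Prod>j\<in>UNIV - {i}. \<integral>\<^sup>+x. ?g j x \<partial>lborel)"
    by (rule prod.remove) auto
  also have "(\<Prod>j\<in>UNIV - {i}. \<integral>\<^sup>+x. ?g j x \<partial>lborel) = 1"
    using v by (intro prod.neutral) (auto simp: nn_integral_nd_shift)
  finally show ?thesis by simp
qed

lemma norm_square_eq_sum: "(norm (x :: real^'k))\<^sup>2 = (\<Sum>i\<in>UNIV. (x $ i)\<^sup>2)"
  unfolding power2_norm_eq_inner inner_vec_def by (simp add: power2_eq_square)

lemma nn_integral_shifted_gaussian_square:
  fixes m p :: "real^'k"
  assumes v: "v > 0"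
  shows "(\<integral>\<^sup>+y. ennreal (shifted_gaussian v m y) * ennreal ((norm (p - y))\<^sup>2) \<partial>lborel) =
    (\<Sum>i\<in>UNIV. ennreal ((p $ i - m $ i)\<^sup>2 + v))"
proof -
  have "(\<integral>\<^sup>+y. ennreal (shifted_gaussian v m y) * ennreal ((norm (p - y))\<^sup>2) \<partial>lborel) =
     (\<integral>\<^sup>+y. (\<Sum>i\<in>UNIV. ennreal (shifted_gaussian v m y) * ennreal ((p $ i - y $ i)\<^sup>2)) \<partial>lborel)"
    unfolding sum_distrib_left[symmetric] by (simp add: norm_square_eq_sum)
  also have "\<dots> = (\<Sum>i\<in>UNIV. \<integral>\<^sup>+y. ennreal (shifted_gaussian v m y) * ennreal ((p $ i - y $ i)\<^sup>2) \<partial>lborel)"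
    by (rule nn_integral_sum) measurable
  also have "\<dots> = (\<Sum>i\<in>UNIV. ennreal ((p $ i - m $ i)\<^sup>2 + v))"
  proof (intro sum.cong refl)
    fix i
    have "(\<integral>\<^sup>+y. ennreal (shifted_gaussian v m y) * ennreal ((p $ i - y $ i)\<^sup>2) \<partial>lborel) =
        (\<integral>\<^sup>+x. ennreal (nd v (x - m $ i)) * ennreal ((p $ i - x)\<^sup>2) \<partial>lborel)"
      by (rule nn_integral_shifted_gaussian_component[OF v, of "\<lambda>x. ennreal ((p $ i - x)\<^sup>2)"]) measurable
    also have "\<dots> = ennreal ((p $ i - m $ i)\<^sup>2 + v)"
      using nn_integral_normal_density_square[of "sqrt v" "m $ i" "p $ i"] v
      by (simp add: normal_density_shift ennreal_mult')
    finally show "(\<integral>\<^sup>+y. ennreal (shifted_gaussian v m y) * ennreal ((p $ i - y $ i)\<^sup>2) \<partial>lborel) =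
      ennreal ((p $ i - m $ i)\<^sup>2 + v)" .
  qed
  finally show ?thesis .
qed

lemma isotropic_gaussian_eq:
  "(isotropic_gaussian v :: (real^'k) measure) = density lborel (\<lambda>z. ennreal (shifted_gaussian v 0 z))"
  by (simp add: isotropic_gaussian_def shifted_gaussian_def)

definition kernel :: "real \<Rightarrow> real^'n^'k \<Rightarrow> real^'n \<Rightarrow> real^'k \<Rightarrow> real" where
  "kernel t \<theta> x y = shifted_gaussian (noise t x) (\<theta> *v shrink t x) y"

lemma kernel_nonneg [simp]: "kernel t \<theta> x y \<ge> 0"
  by (simp add: kernel_def)

lemma measurable_kernel [measurable (raw)]:
  assumes [measurable]: "\<theta> \<in> borel_measurable M" "x \<in> borel_measurable M" "y \<in> borel_measurable M"
  shows "(\<lambda>w. kernel t (\<theta> w) (x w) (y w)) \<in> borel_measurable M"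
  unfolding kernel_def by measurable

lemma nd_le: "0 < t \<Longrightarrow> t \<le> v \<Longrightarrow> nd v x \<le> 1 / sqrt (2 * pi * t)"
proof -
  assume t: "0 < t" "t \<le> v"
  have "nd v x = 1 / sqrt (2 * pi * v) * exp (- (x\<^sup>2 / (2 * v)))" using t by (intro nd_eq) simp
  also have "\<dots> \<le> 1 / sqrt (2 * pi * t) * 1"
    using t by (intro mult_mono divide_left_mono real_sqrt_le_mono) auto
  finally show ?thesis by simp
qed

text \<open>The noise variance is at least \<open>t\<close>. This uniform bound keeps the mixture
  density finite.\<close>

lemma kernel_le:
  fixes \<theta> :: "real^'n^'k"
  assumes "0 < t" "t < 1"
  shows "kernel t \<theta> x y \<le> (1 / sqrt (2 * pi * t)) ^ CARD('k)"
proof -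
  have "kernel t \<theta> x y \<le> (\<Prod>i\<in>(UNIV::'k set). 1 / sqrt (2 * pi * t))"
    unfolding kernel_def shifted_gaussian_def
    using noise_bounds(1)[OF assms] assms by (intro prod_mono) (auto intro: nd_le)
  then show ?thesis by simp
qed

text \<open>The bivariate formula is used with a dummy second coordinate, of variance 1 and vector 0
  and evaluated at 0, which contributes a constant \<open>nd 1 0\<close> per row and is cancelled at
  the end. The first variance becomes
  \<open>noise t x + \<parallel>shrink t x\<parallel>\<^sup>2 / n = 1\<close>.\<close>

lemma nn_integral_kernel_matrix:
  fixes x :: "real^'n" and y :: "real^'k"
  assumes t: "0 < t" "t < 1"
  shows "(\<integral>\<^sup>+\<theta>. ennreal (kernel t \<theta> x y) \<partial>gaussian_matrix (1 / real CARD('n))) = ennreal (shifted_gaussian 1 0 y)"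
proof -
  let ?V = "1 / real CARD('n)"
  have V: "?V > 0" by simp
  note v = noise_bounds[OF t, of x]
  let ?c = "\<Prod>i\<in>(UNIV::'k set). ennreal (nd 1 0)"
  have "?c = ennreal (nd 1 0 ^ CARD('k))"
    by (simp add: ennreal_power)
  then have c: "?c \<noteq> 0" "?c \<noteq> \<top>"
    using normal_density_pos[of 1 0 0] by simp_all
  have pw: "gauss2 (noise t x) 1 0 p 0 = nd (noise t x) p * nd 1 0" for p
    using v by (intro gauss2_zero) auto
  have "ennreal (kernel t \<theta> x y) * ?c =
      (\<Prod>i\<in>UNIV. ennreal (gauss2 (noise t x) 1 0 (y $ i - (\<theta> *v shrink t x) $ i) ((0::real^'k) $ i - (\<theta> *v 0) $ i)))" for \<theta> :: "real^'n^'k"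
    by (simp add: pw kernel_def shifted_gaussian_def ennreal_mult'' prod.distrib prod_ennreal[OF normal_density_nonneg] del: prod_constant)
  then have "(\<integral>\<^sup>+\<theta>. ennreal (kernel t \<theta> x y) * ?c \<partial>gaussian_matrix ?V) =
      (\<integral>\<^sup>+\<theta>. (\<Prod>i\<in>UNIV. ennreal (gauss2 (noise t x) 1 0 (y $ i - ((\<theta> :: real^'n^'k) *v shrink t x) $ i) ((0::real^'k) $ i - (\<theta> *v 0) $ i))) \<partial>gaussian_matrix ?V)"
    by (simp only:)
  also have "\<dots> = (\<Prod>i\<in>(UNIV::'k set). ennreal (gauss2 1 1 0 (y $ i) 0))"
    using v by (subst nn_integral_gaussian_matrix_gauss2[OF _ _ _ V]) (simp_all add: noise_def)
  also have "\<dots> = ennreal (shifted_gaussian 1 0 y) * ?c"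
    using gauss2_zero[of 1 1 _ 0]
    by (simp add: shifted_gaussian_def ennreal_mult'' prod.distrib prod_ennreal[OF normal_density_nonneg] del: prod_constant)
  finally have "(\<integral>\<^sup>+\<theta>. ennreal (kernel t \<theta> x y) \<partial>gaussian_matrix ?V) * ?c = ennreal (shifted_gaussian 1 0 y) * ?c"
    by (subst (asm) nn_integral_multc) simp_all
  then show ?thesis using c mult_divide_eq_ennreal by metis
qed

definition shrunk_corr :: "real \<Rightarrow> real^'n \<Rightarrow> real^'n \<Rightarrow> real" where
  "shrunk_corr t x x' = 1 / real CARD('n) * (shrink t x \<bullet> shrink t x')"

text \<open>The two noises are independent, hence the start at covariance 0. The common matrix
  completes both variances to 1 and creates the covariance \<open>shrunk_corr\<close>.\<close>

lemma nn_integral_kernel_kernel_matrix: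
  fixes x x' :: "real^'n" and y :: "real^'k"
  assumes t: "0 < t" "t < 1"
  shows "(\<integral>\<^sup>+\<theta>. ennreal (kernel t \<theta> x y) * ennreal (kernel t \<theta> x' y) \<partial>gaussian_matrix (1 / real CARD('n))) =
    (\<Prod>i\<in>UNIV. ennreal (gauss2 1 1 (shrunk_corr t x x') (y $ i) (y $ i)))"
proof -
  let ?V = "1 / real CARD('n)"
  have V: "?V > 0" by simp
  note v = noise_bounds[OF t, of x] and v' = noise_bounds[OF t, of x']
  have pw: "gauss2 (noise t x) (noise t x') 0 p q = nd (noise t x) p * nd (noise t x') q" for p q
    using v v' by (intro gauss2_zero) auto
  have "ennreal (kernel t \<theta> x y) * ennreal (kernel t \<theta> x' y) =
      (\<Prod>i\<in>UNIV. ennreal (gauss2 (noise t x) (noise t x') 0 (y $ i - (\<theta> *v shrink t x) $ i) (y $ i - (\<theta> *v shrink t x') $ i)))" for \<theta> :: "real^'n^'k"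
    by (simp add: pw kernel_def shifted_gaussian_def ennreal_mult'' prod.distrib prod_ennreal[OF normal_density_nonneg])
  then have "(\<integral>\<^sup>+\<theta>. ennreal (kernel t \<theta> x y) * ennreal (kernel t \<theta> x' y) \<partial>gaussian_matrix ?V) =
      (\<integral>\<^sup>+\<theta>. (\<Prod>i\<in>UNIV. ennreal (gauss2 (noise t x) (noise t x') 0 (y $ i - ((\<theta> :: real^'n^'k) *v shrink t x) $ i) (y $ i - (\<theta> *v shrink t x') $ i))) \<partial>gaussian_matrix ?V)"
    by (simp only:)
  also have "\<dots> = (\<Prod>i\<in>UNIV. ennreal (gauss2 1 1 (shrunk_corr t x x') (y $ i) (y $ i)))"
    using v v' by (subst nn_integral_gaussian_matrix_gauss2[OF _ _ _ V]) (simp_all add: noise_def shrunk_corr_def)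
  finally show ?thesis .
qed

text \<open>The reciprocal density of \<open>N(0, 2 I)\<close>, kept as a reciprocal so that
  weighting is a multiplication in \<open>ennreal\<close>.\<close>

definition inv_weight :: "real^'k \<Rightarrow> real" where
  "inv_weight y = (\<Prod>i\<in>UNIV. 1 / nd 2 (y $ i))"

lemma inv_weight_pos: "inv_weight y > 0"
  unfolding inv_weight_def by (intro prod_pos) (auto intro: normal_density_pos)

lemma measurable_inv_weight [measurable]: "inv_weight \<in> borel_measurable borel"
  unfolding inv_weight_def[abs_def] by measurable

lemma nn_integral_gauss2_weighted:
  assumes r: "\<bar>r\<bar> < 1"
  shows "(\<integral>\<^sup>+y. (\<Prod>i\<in>UNIV. ennreal (gauss2 1 1 r (y $ i) (y $ i))) * ennreal (inv_weight y) \<partial>(lborel :: (real^'k) measure)) =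
    ennreal (corr_weight r ^ CARD('k))"
proof -
  have r2: "r\<^sup>2 < 1" using r by (simp add: abs_square_less_1)
  have g: "gauss2 1 1 r p q \<ge> 0" for p q using r2 by (intro gauss2_nonneg) simp
  have "(\<Prod>i\<in>UNIV. ennreal (gauss2 1 1 r (y $ i) (y $ i))) * ennreal (inv_weight y) =
      (\<Prod>i\<in>UNIV. ennreal (gauss2 1 1 r (y $ i) (y $ i) / nd 2 (y $ i)))" for y :: "real^'k"
  proof -
    have "ennreal (inv_weight y) = (\<Prod>i\<in>UNIV. ennreal (1 / nd 2 (y $ i)))"
      unfolding inv_weight_def by (rule prod_ennreal[symmetric]) simp
    then show ?thesis
      by (simp add: g divide_inverse flip: prod.distrib ennreal_mult')
  qed
  then have "(\<integral>\<^sup>+y. (\<Prod>i\<in>UNIV. ennreal (gauss2 1 1 r (y $ i) (y $ i))) * ennreal (inv_weight y) \<partial>(lborel :: (real^'k) measure)) =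
    (\<Prod>i\<in>(UNIV::'k set). \<integral>\<^sup>+y. ennreal (gauss2 1 1 r y y / nd 2 y) \<partial>lborel)"
    by (simp only:) (rule nn_integral_lborel_vec_prod, measurable)
  also have "\<dots> = ennreal (corr_weight r) ^ CARD('k)"
    unfolding gauss2_diag_weighted[OF r] corr_weight_def by simp
  also have "\<dots> = ennreal (corr_weight r ^ CARD('k))"
    using corr_weight_pos[of r] r by (intro ennreal_power less_imp_le) auto
  finally show ?thesis .
qed

text \<open>\<open>12 = 3 * 2\<^sup>2\<close>, the fourth moment of \<open>N(0, 2)\<close>; it is
  the first factor in the Cauchy-Schwarz step.\<close>

lemma nn_integral_weight_fourth:
  "(\<integral>\<^sup>+y. ennreal ((y $ i) ^ 4 / inv_weight y) \<partial>(lborel :: (real^'k) measure)) = 12"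
proof -
  have "ennreal ((y $ i) ^ 4 / inv_weight y) = ennreal (shifted_gaussian 2 0 y) * ennreal ((y $ i) ^ 4)" for y :: "real^'k"
    by (simp add: inv_weight_def shifted_gaussian_def prod_dividef prod_nonneg mult.commute flip: ennreal_mult')
  then have "(\<integral>\<^sup>+y. ennreal ((y $ i) ^ 4 / inv_weight y) \<partial>(lborel :: (real^'k) measure)) =
     (\<integral>\<^sup>+x. ennreal (nd 2 (x - (0::real^'k) $ i)) * ennreal (x ^ 4) \<partial>lborel)"
    by (simp only:) (rule nn_integral_shifted_gaussian_component[where h = "\<lambda>x. ennreal (x ^ 4)"], simp, measurable)
  also have "\<dots> = 12"
    using nn_integral_nd_fourth[of 2] by (simp add: ennreal_mult')
  finally show ?thesis .
qed

section \<open>The smoothed density and its weighted square distance from the normal density\<close>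

definition mixture :: "real \<Rightarrow> (real^'n) measure \<Rightarrow> real^'n^'k \<Rightarrow> real^'k \<Rightarrow> real" where
  "mixture t \<mu> \<theta> y = enn2real (\<integral>\<^sup>+x. ennreal (kernel t \<theta> x y) \<partial>\<mu>)"

lemma mixture_nonneg [simp]: "mixture t \<mu> \<theta> y \<ge> 0"
  by (simp add: mixture_def)

context
  fixes \<mu> :: "(real^'n) measure" and t :: real
  assumes \<mu>: "prob_space \<mu>" and sets_\<mu> [measurable_cong]: "sets \<mu> = sets borel" and t: "0 < t" "t < 1"
begin

interpretation prob_space \<mu> by (rule \<mu>)

lemma prob_space_matrix: "prob_space (gaussian_matrix (1 / real CARD('n)) :: (real^'n^'k) measure)"
  by (rule prob_space_gaussian_matrix) simp

lemma sigma_finite_matrix: "sigma_finite_measure (gaussian_matrix (1 / real CARD('n)) :: (real^'n^'k) measure)"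
  using prob_space_matrix by (rule prob_space_imp_sigma_finite)

text \<open>The uniform kernel bound makes the conversion to a real number lossless. Real values are
  wanted because the difference with the normal density is squared.\<close>

lemma ennreal_mixture:
  fixes \<theta> :: "real^'n^'k"
  shows "ennreal (mixture t \<mu> \<theta> y) = (\<integral>\<^sup>+x. ennreal (kernel t \<theta> x y) \<partial>\<mu>)"
proof -
  have "(\<integral>\<^sup>+x. ennreal (kernel t \<theta> x y) \<partial>\<mu>) \<le> (\<integral>\<^sup>+x. ennreal ((1 / sqrt (2 * pi * t)) ^ CARD('k)) \<partial>\<mu>)"
    using kernel_le[OF t] by (intro nn_integral_mono ennreal_leI)
  also have "\<dots> < \<top>" by (simp add: emeasure_space_1)
  finally show ?thesis by (simp add: mixture_def)
qed

lemma measurable_mixture [measurable (raw)]: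
  assumes [measurable]: "\<theta> \<in> borel_measurable M" "y \<in> borel_measurable M"
  shows "(\<lambda>w. mixture t \<mu> (\<theta> w) (y w)) \<in> borel_measurable M"
  unfolding mixture_def by measurable

lemma nn_integral_mixture:
  fixes y :: "real^'k"
  shows "(\<integral>\<^sup>+\<theta>. ennreal (mixture t \<mu> \<theta> y) \<partial>gaussian_matrix (1 / real CARD('n))) = ennreal (shifted_gaussian 1 0 y)"
proof -
  interpret T: sigma_finite_measure "gaussian_matrix (1 / real CARD('n)) :: (real^'n^'k) measure" by (rule sigma_finite_matrix)
  interpret P: pair_sigma_finite \<mu> "gaussian_matrix (1 / real CARD('n)) :: (real^'n^'k) measure" ..
  have "(\<integral>\<^sup>+\<theta>. ennreal (mixture t \<mu> \<theta> y) \<partial>(gaussian_matrix (1 / real CARD('n)) :: (real^'n^'k) measure)) = (\<integral>\<^sup>+x. \<integral>\<^sup>+\<theta>. ennreal (kernel t \<theta> x y) \<partial>(gaussian_matrix (1 / real CARD('n)) :: (real^'n^'k) measure) \<partial>\<mu>)"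
    unfolding ennreal_mixture by (rule P.Fubini') measurable
  then show ?thesis by (simp add: nn_integral_kernel_matrix[OF t] emeasure_space_1)
qed

text \<open>The square of an average over \<open>\<mu>\<close> is an average over two independent
  points; this is where the independent copies of \<open>X\<close> enter.\<close>

lemma nn_integral_mixture_square:
  fixes y :: "real^'k"
  shows "(\<integral>\<^sup>+\<theta>. ennreal ((mixture t \<mu> \<theta> y)\<^sup>2) \<partial>gaussian_matrix (1 / real CARD('n))) =
    (\<integral>\<^sup>+x. \<integral>\<^sup>+x'. (\<Prod>i\<in>UNIV. ennreal (gauss2 1 1 (shrunk_corr t x x') (y $ i) (y $ i))) \<partial>\<mu> \<partial>\<mu>)"
proof -
  interpret T: sigma_finite_measure "gaussian_matrix (1 / real CARD('n)) :: (real^'n^'k) measure" by (rule sigma_finite_matrix)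
  interpret P: pair_sigma_finite \<mu> "gaussian_matrix (1 / real CARD('n)) :: (real^'n^'k) measure" ..
  have "ennreal ((mixture t \<mu> \<theta> y)\<^sup>2) = (\<integral>\<^sup>+x. \<integral>\<^sup>+x'. ennreal (kernel t \<theta> x y) * ennreal (kernel t \<theta> x' y) \<partial>\<mu> \<partial>\<mu>)" for \<theta> :: "real^'n^'k"
    by (simp add: power2_eq_square ennreal_mult ennreal_mixture nn_integral_cmult nn_integral_multc)
  then have "(\<integral>\<^sup>+\<theta>. ennreal ((mixture t \<mu> \<theta> y)\<^sup>2) \<partial>(gaussian_matrix (1 / real CARD('n)) :: (real^'n^'k) measure)) =
     (\<integral>\<^sup>+\<theta>. \<integral>\<^sup>+x. \<integral>\<^sup>+x'. ennreal (kernel t \<theta> x y) * ennreal (kernel t \<theta> x' y) \<partial>\<mu> \<partial>\<mu> \<partial>(gaussian_matrix (1 / real CARD('n)) :: (real^'n^'k) measure))"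
    by simp
  also have "\<dots> = (\<integral>\<^sup>+x. \<integral>\<^sup>+\<theta>. \<integral>\<^sup>+x'. ennreal (kernel t \<theta> x y) * ennreal (kernel t \<theta> x' y) \<partial>\<mu> \<partial>(gaussian_matrix (1 / real CARD('n)) :: (real^'n^'k) measure) \<partial>\<mu>)"
    by (rule P.Fubini') measurable
  also have "\<dots> = (\<integral>\<^sup>+x. \<integral>\<^sup>+x'. \<integral>\<^sup>+\<theta>. ennreal (kernel t \<theta> x y) * ennreal (kernel t \<theta> x' y) \<partial>(gaussian_matrix (1 / real CARD('n)) :: (real^'n^'k) measure) \<partial>\<mu> \<partial>\<mu>)"
    by (intro nn_integral_cong P.Fubini') measurable
  finally show ?thesis by (simp only: nn_integral_kernel_kernel_matrix[OF t])
qed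

lemma shrunk_corr_bounds:
  fixes x x' :: "real^'n"
  shows "\<bar>shrunk_corr t x x'\<bar> \<le> 1 - t" "\<bar>shrunk_corr t x x'\<bar> < 1"
    "\<bar>shrunk_corr t x x'\<bar> \<le> \<bar>x \<bullet> x'\<bar> / real CARD('n)"
    "(shrunk_corr t x x' / (1 - t))\<^sup>2 \<le> (\<bar>x \<bullet> x'\<bar> / real CARD('n))\<^sup>2"
proof -
  note b = shrink_inner_le[OF t, of x x', folded shrunk_corr_def]
  show "\<bar>shrunk_corr t x x'\<bar> \<le> 1 - t" by (rule b)
  then show "\<bar>shrunk_corr t x x'\<bar> < 1" using t by simp
  have "(1 - t) * (\<bar>x \<bullet> x'\<bar> / real CARD('n)) \<le> 1 * (\<bar>x \<bullet> x'\<bar> / real CARD('n))"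
    using t by (intro mult_right_mono) auto
  then show "\<bar>shrunk_corr t x x'\<bar> \<le> \<bar>x \<bullet> x'\<bar> / real CARD('n)" using b by linarith
  have "\<bar>shrunk_corr t x x' / (1 - t)\<bar> \<le> \<bar>x \<bullet> x'\<bar> / real CARD('n)"
    using b(2) t by (simp add: pos_divide_le_eq mult.commute)
  from power_mono[OF this abs_ge_zero, of 2]
  show "(shrunk_corr t x x' / (1 - t))\<^sup>2 \<le> (\<bar>x \<bullet> x'\<bar> / real CARD('n))\<^sup>2"
    by (simp only: power2_abs)
qed

lemma measurable_shrunk_corr [measurable (raw)]:
  assumes [measurable]: "x \<in> borel_measurable M" "x' \<in> borel_measurable M"
  shows "(\<lambda>w. shrunk_corr t (x w) (x' w :: real^'n)) \<in> borel_measurable M"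
  unfolding shrunk_corr_def by measurable

lemma measurable_corr_weight [measurable]: "corr_weight \<in> borel_measurable borel"
  unfolding corr_weight_def[abs_def] by measurable

text \<open>
  The argument only fixes the dimension of the projection.
\<close>

definition chi2 :: "'k::finite itself \<Rightarrow> ennreal" where
  "chi2 _ = (\<integral>\<^sup>+y. \<integral>\<^sup>+\<theta>. ennreal ((mixture t \<mu> \<theta> y - shifted_gaussian 1 0 y)\<^sup>2 * inv_weight y) \<partial>(gaussian_matrix (1 / real CARD('n)) :: (real^'n^'k) measure) \<partial>lborel)"

text \<open>Variance formula: the mixture has the normal density as its mean over the matrix, so its
  mean square is variance plus squared mean, and the weighted integral of the latter is the value at
  correlation 0. The additive form avoids subtraction in \<open>ennreal\<close>.\<close>

lemma chi2_eq:
  "chi2 TYPE('k::finite) + ennreal (corr_weight 0 ^ CARD('k)) =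
    (\<integral>\<^sup>+x. \<integral>\<^sup>+x'. ennreal (corr_weight (shrunk_corr t x x') ^ CARD('k)) \<partial>\<mu> \<partial>\<mu>)"
proof -
  interpret T: prob_space "gaussian_matrix (1 / real CARD('n)) :: (real^'n^'k) measure" by (rule prob_space_matrix)
  interpret P: pair_sigma_finite \<mu> "lborel :: (real^'k) measure" ..
  let ?\<phi> = "shifted_gaussian 1 (0::real^'k)"
  let ?G = "\<lambda>x x' y. \<Prod>i\<in>UNIV. ennreal (gauss2 1 1 (shrunk_corr t x x') ((y::real^'k) $ i) (y $ i))"
  have var: "(\<integral>\<^sup>+\<theta>. ennreal ((mixture t \<mu> \<theta> y - ?\<phi> y)\<^sup>2) \<partial>gaussian_matrix (1 / real CARD('n))) + ennreal ((?\<phi> y)\<^sup>2) =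
      (\<integral>\<^sup>+x. \<integral>\<^sup>+x'. ?G x x' y \<partial>\<mu> \<partial>\<mu>)" for y
  proof -
    let ?c = "ennreal ((?\<phi> y)\<^sup>2)"
    have "ennreal ((mixture t \<mu> \<theta> y - ?\<phi> y)\<^sup>2) + ennreal (2 * ?\<phi> y) * ennreal (mixture t \<mu> \<theta> y) =
       ennreal ((mixture t \<mu> \<theta> y)\<^sup>2) + ?c" for \<theta> :: "real^'n^'k"
    proof -
      have "(mixture t \<mu> \<theta> y - ?\<phi> y)\<^sup>2 + 2 * ?\<phi> y * mixture t \<mu> \<theta> y = (mixture t \<mu> \<theta> y)\<^sup>2 + (?\<phi> y)\<^sup>2"
        by (simp add: power2_eq_square algebra_simps)
      then show ?thesis by (simp flip: ennreal_plus ennreal_mult)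
    qed
    then have "(\<integral>\<^sup>+\<theta>. ennreal ((mixture t \<mu> \<theta> y - ?\<phi> y)\<^sup>2) + ennreal (2 * ?\<phi> y) * ennreal (mixture t \<mu> \<theta> y) \<partial>gaussian_matrix (1 / real CARD('n))) =
      (\<integral>\<^sup>+\<theta>. ennreal ((mixture t \<mu> \<theta> y)\<^sup>2) + ?c \<partial>gaussian_matrix (1 / real CARD('n)))"
      by simp
    then have "(\<integral>\<^sup>+\<theta>. ennreal ((mixture t \<mu> \<theta> y - ?\<phi> y)\<^sup>2) \<partial>gaussian_matrix (1 / real CARD('n))) + ennreal (2 * ?\<phi> y) * ennreal (?\<phi> y) =
      (\<integral>\<^sup>+\<theta>. ennreal ((mixture t \<mu> \<theta> y)\<^sup>2) \<partial>gaussian_matrix (1 / real CARD('n))) + ?c"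
      by (simp add: nn_integral_add nn_integral_cmult nn_integral_mixture T.emeasure_space_1)
    moreover have "ennreal (2 * ?\<phi> y) * ennreal (?\<phi> y) = ?c + ?c"
      by (simp add: power2_eq_square flip: ennreal_mult ennreal_plus)
    ultimately have "?c + ((\<integral>\<^sup>+\<theta>. ennreal ((mixture t \<mu> \<theta> y - ?\<phi> y)\<^sup>2) \<partial>gaussian_matrix (1 / real CARD('n))) + ?c) =
      ?c + (\<integral>\<^sup>+\<theta>. ennreal ((mixture t \<mu> \<theta> y)\<^sup>2) \<partial>gaussian_matrix (1 / real CARD('n)))"
      by (simp add: add_ac)
    then show ?thesis unfolding nn_integral_mixture_square ennreal_add_left_cancel by simp
  qed
  have zero: "ennreal (corr_weight 0 ^ CARD('k)) = (\<integral>\<^sup>+y. ennreal ((?\<phi> y)\<^sup>2) * ennreal (inv_weight y) \<partial>lborel)"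
  proof -
    have "(\<Prod>i\<in>UNIV. ennreal (gauss2 1 1 0 (y $ i) (y $ i))) = ennreal ((?\<phi> y)\<^sup>2)" for y
      by (simp add: gauss2_zero shifted_gaussian_def power2_eq_square prod.distrib prod_ennreal)
    moreover have "(\<integral>\<^sup>+y. (\<Prod>i\<in>UNIV. ennreal (gauss2 1 1 0 (y $ i) (y $ i))) * ennreal (inv_weight y) \<partial>(lborel :: (real^'k) measure)) =
        ennreal (corr_weight 0 ^ CARD('k))"
      by (rule nn_integral_gauss2_weighted) simp
    ultimately show ?thesis by simp
  qed
  have "chi2 TYPE('k) = (\<integral>\<^sup>+y. (\<integral>\<^sup>+\<theta>. ennreal ((mixture t \<mu> \<theta> y - ?\<phi> y)\<^sup>2) \<partial>gaussian_matrix (1 / real CARD('n))) * ennreal (inv_weight y) \<partial>lborel)"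
    unfolding chi2_def ennreal_mult''[OF less_imp_le[OF inv_weight_pos]]
    by (simp add: nn_integral_multc)
  then have "chi2 TYPE('k) + ennreal (corr_weight 0 ^ CARD('k)) =
     (\<integral>\<^sup>+y. ((\<integral>\<^sup>+\<theta>. ennreal ((mixture t \<mu> \<theta> y - ?\<phi> y)\<^sup>2) \<partial>gaussian_matrix (1 / real CARD('n))) + ennreal ((?\<phi> y)\<^sup>2)) * ennreal (inv_weight y) \<partial>lborel)"
    unfolding zero distrib_right by (simp add: nn_integral_add)
  also have "\<dots> = (\<integral>\<^sup>+y. \<integral>\<^sup>+x. \<integral>\<^sup>+x'. ?G x x' y * ennreal (inv_weight y) \<partial>\<mu> \<partial>\<mu> \<partial>lborel)"
    unfolding var by (simp add: nn_integral_multc)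
  also have "\<dots> = (\<integral>\<^sup>+x. \<integral>\<^sup>+y. \<integral>\<^sup>+x'. ?G x x' y * ennreal (inv_weight y) \<partial>\<mu> \<partial>lborel \<partial>\<mu>)"
    by (rule P.Fubini') measurable
  also have "\<dots> = (\<integral>\<^sup>+x. \<integral>\<^sup>+x'. \<integral>\<^sup>+y. ?G x x' y * ennreal (inv_weight y) \<partial>lborel \<partial>\<mu> \<partial>\<mu>)"
    by (intro nn_integral_cong P.Fubini') measurable
  finally show ?thesis by (simp only: nn_integral_gauss2_weighted shrunk_corr_bounds)
qed

text \<open>The quadratic expansion is taken with \<open>R = 1 - t\<close>: its constant term
  cancels, the linear one integrates to \<open>b1\<close>, and in the quadratic one the division by
  \<open>1 - t\<close> is undone by the shrinking.\<close>

lemma chi2_le: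
  assumes b1: "(\<integral>\<^sup>+x. \<integral>\<^sup>+x'. ennreal (\<bar>x \<bullet> x'\<bar> / real CARD('n)) \<partial>\<mu> \<partial>\<mu>) = ennreal b1" "b1 \<ge> 0"
    and b2: "(\<integral>\<^sup>+x. \<integral>\<^sup>+x'. ennreal ((\<bar>x \<bullet> x'\<bar> / real CARD('n))\<^sup>2) \<partial>\<mu> \<partial>\<mu>) = ennreal (b2\<^sup>2)"
  shows "chi2 TYPE('k::finite) \<le> ennreal (2 * real CARD('k) / 3 * corr_weight 0 ^ CARD('k) * b1 + b2\<^sup>2 * corr_weight (1 - t) ^ CARD('k))"
proof -
  let ?k = "CARD('k)"
  let ?c0 = "corr_weight 0 ^ ?k" and ?c1 = "2 * real ?k / 3 * corr_weight 0 ^ ?k" and ?c2 = "corr_weight (1 - t) ^ ?k"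
  let ?\<rho> = "\<lambda>x x'. \<bar>x \<bullet> x'\<bar> / real CARD('n) :: real"
  have c: "?c0 \<ge> 0" "?c1 \<ge> 0" "?c2 \<ge> 0"
    using corr_weight_pos[of 0] corr_weight_pos[of "1 - t"] t by simp_all
  have "ennreal (corr_weight (shrunk_corr t x x') ^ ?k) \<le> ennreal ?c0 + (ennreal ?c1 * ennreal (?\<rho> x x') + ennreal ?c2 * ennreal ((?\<rho> x x')\<^sup>2))" for x x' :: "real^'n"
  proof -
    have "corr_weight (shrunk_corr t x x') ^ ?k \<le> ?c0 + ?c1 * \<bar>shrunk_corr t x x'\<bar> + (shrunk_corr t x x' / (1 - t))\<^sup>2 * ?c2"
      using shrunk_corr_bounds(1)[of x x'] t by (intro corr_weight_power_bound) auto
    also have "\<dots> \<le> ?c0 + ?c1 * ?\<rho> x x' + (?\<rho> x x')\<^sup>2 * ?c2"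
      using c shrunk_corr_bounds[of x x'] by (intro add_mono mult_left_mono mult_right_mono) auto
    finally have "ennreal (corr_weight (shrunk_corr t x x') ^ ?k) \<le> ennreal (?c0 + ?c1 * ?\<rho> x x' + (?\<rho> x x')\<^sup>2 * ?c2)"
      by (rule ennreal_leI)
    also have "\<dots> = ennreal ?c0 + (ennreal ?c1 * ennreal (?\<rho> x x') + ennreal ?c2 * ennreal ((?\<rho> x x')\<^sup>2))"
      using c by (simp add: mult.commute add.assoc del: zero_le_mult_iff zero_le_power_eq flip: ennreal_plus ennreal_mult)
    finally show ?thesis .
  qed
  then have "chi2 TYPE('k) + ennreal ?c0 \<le>
     (\<integral>\<^sup>+x. \<integral>\<^sup>+x'. ennreal ?c0 + (ennreal ?c1 * ennreal (?\<rho> x x') + ennreal ?c2 * ennreal ((?\<rho> x x')\<^sup>2)) \<partial>\<mu> \<partial>\<mu>)"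
    unfolding chi2_eq by (intro nn_integral_mono)
  also have "\<dots> = ennreal ?c0 + (ennreal ?c1 * ennreal b1 + ennreal ?c2 * ennreal (b2\<^sup>2))"
    by (simp add: nn_integral_add nn_integral_cmult emeasure_space_1 b1(1) b2)
  also have "\<dots> = ennreal ?c0 + ennreal (?c1 * b1 + b2\<^sup>2 * ?c2)"
    using c b1(2) by (simp add: mult.commute del: zero_le_mult_iff zero_le_power_eq flip: ennreal_plus ennreal_mult)
  finally show ?thesis by (simp add: add.commute[of _ "ennreal ?c0"] ennreal_add_left_cancel_le)
qed

end

section \<open>Expected transport cost at a fixed smoothing level\<close>

context
  fixes \<mu> :: "(real^'n) measure" and t :: real
  assumes \<mu>: "prob_space \<mu>" and sets_\<mu> [measurable_cong]: "sets \<mu> = sets borel" and t: "0 < t" "t < 1"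
begin

interpretation prob_space \<mu> by (rule \<mu>)

lemmas [measurable (raw)] = measurable_mixture[OF \<mu> sets_\<mu> t]

definition smoothing_cost :: "real^'n^'k \<Rightarrow> ennreal" where
  "smoothing_cost \<theta> = (\<integral>\<^sup>+x. \<integral>\<^sup>+y. ennreal (kernel t \<theta> x y) * ennreal ((norm (\<theta> *v x - y))\<^sup>2) \<partial>lborel \<partial>\<mu>)"

definition mixing_cost :: "real^'n^'k \<Rightarrow> ennreal" where
  "mixing_cost \<theta> = (\<integral>\<^sup>+y. ennreal ((norm y)\<^sup>2 * \<bar>mixture t \<mu> \<theta> y - shifted_gaussian 1 0 y\<bar>) \<partial>lborel)"

lemma measurable_smoothing_cost [measurable]: "smoothing_cost \<in> borel_measurable borel"
  unfolding smoothing_cost_def[abs_def] by measurable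

lemma measurable_mixing_cost [measurable]: "mixing_cost \<in> borel_measurable borel"
  unfolding mixing_cost_def[abs_def] by measurable

text \<open>The transport bound is applied on the joint law \<open>S\<close> of a point and its
  smoothed projection: the second marginal has the mixture as density, and the unsmoothed projection
  is a function of the first component.\<close>

lemma W2_projection_le:
  fixes \<theta> :: "real^'n^'k"
  shows "(W2 (distr \<mu> borel (\<lambda>x. \<theta> *v x)) (isotropic_gaussian 1))\<^sup>2 \<le>
    5 * smoothing_cost \<theta> + ennreal (5 / 2) * mixing_cost \<theta>"
proof -
  interpret P: pair_sigma_finite \<mu> "lborel :: (real^'k) measure" ..
  have ker1: "(\<integral>\<^sup>+y. ennreal (kernel t \<theta> x y) \<partial>lborel) = 1" for x
    unfolding kernel_def using noise_bounds[OF t, of x] by (intro nn_integral_shifted_gaussian)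
  define S where "S = density (\<mu> \<Otimes>\<^sub>M (lborel :: (real^'k) measure)) (\<lambda>p. ennreal (kernel t \<theta> (fst p) (snd p)))"
  have [measurable_cong]: "sets S = sets (borel \<Otimes>\<^sub>M borel)"
    unfolding S_def by (simp add: sets_\<mu> cong: sets_pair_measure_cong)
  have int_S: "(\<integral>\<^sup>+p. F p \<partial>S) = (\<integral>\<^sup>+x. \<integral>\<^sup>+y. ennreal (kernel t \<theta> x y) * F (x, y) \<partial>lborel \<partial>\<mu>)"
    if [measurable]: "F \<in> borel_measurable (borel \<Otimes>\<^sub>M borel)" for F
  proof -
    have "(\<integral>\<^sup>+p. F p \<partial>S) = (\<integral>\<^sup>+p. ennreal (kernel t \<theta> (fst p) (snd p)) * F p \<partial>(\<mu> \<Otimes>\<^sub>M lborel))"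
      unfolding S_def by (rule nn_integral_density) measurable
    also have "\<dots> = (\<integral>\<^sup>+x. \<integral>\<^sup>+y. ennreal (kernel t \<theta> x y) * F (x, y) \<partial>lborel \<partial>\<mu>)"
      by (subst lborel.nn_integral_fst[symmetric]) simp_all
    finally show ?thesis .
  qed
  have "prob_space S"
    using int_S[of "\<lambda>_. 1"] by (intro prob_spaceI) (simp add: ker1 emeasure_space_1)
  moreover have "distr S borel snd = density lborel (\<lambda>y. ennreal (mixture t \<mu> \<theta> y))"
  proof (rule measure_eqI)
    fix B assume "B \<in> sets (distr S borel snd)"
    then have [measurable]: "B \<in> sets borel" by simp
    have "emeasure (distr S borel snd) B = (\<integral>\<^sup>+p. indicator B (snd p) \<partial>S)"
      by (simp add: nn_integral_distr flip: nn_integral_indicator)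
    also have "\<dots> = (\<integral>\<^sup>+x. \<integral>\<^sup>+y. ennreal (kernel t \<theta> x y) * indicator B y \<partial>lborel \<partial>\<mu>)"
      by (subst int_S) simp_all
    also have "\<dots> = (\<integral>\<^sup>+y. \<integral>\<^sup>+x. ennreal (kernel t \<theta> x y) * indicator B y \<partial>\<mu> \<partial>lborel)"
      by (rule P.Fubini'[symmetric]) measurable
    also have "\<dots> = emeasure (density lborel (\<lambda>y. ennreal (mixture t \<mu> \<theta> y))) B"
      by (simp add: emeasure_density nn_integral_multc ennreal_mixture[OF \<mu> sets_\<mu> t])
    finally show "emeasure (distr S borel snd) B = emeasure (density lborel (\<lambda>y. ennreal (mixture t \<mu> \<theta> y))) B" .
  qed simp
  ultimately have "(W2 (distr S borel (\<lambda>p. \<theta> *v fst p)) (density lborel (\<lambda>y. ennreal (shifted_gaussian 1 0 y))))\<^sup>2 \<le>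
    5 * (\<integral>\<^sup>+p. ennreal ((norm (\<theta> *v fst p - snd p))\<^sup>2) \<partial>S) +
    ennreal (5 / 2) * (\<integral>\<^sup>+y. ennreal ((norm y)\<^sup>2 * \<bar>mixture t \<mu> \<theta> y - shifted_gaussian 1 0 y\<bar>) \<partial>lborel)"
    by (intro W2_square_le_density_difference) (simp_all add: nn_integral_shifted_gaussian)
  also have "distr S borel (\<lambda>p. \<theta> *v fst p) = distr \<mu> borel (\<lambda>x. \<theta> *v x)"
  proof (rule measure_eqI)
    fix B assume "B \<in> sets (distr S borel (\<lambda>p. \<theta> *v fst p))"
    then have [measurable]: "B \<in> sets borel" by simp
    have "emeasure (distr S borel (\<lambda>p. \<theta> *v fst p)) B = (\<integral>\<^sup>+p. indicator B (\<theta> *v fst p) \<partial>S)"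
      by (simp add: nn_integral_distr flip: nn_integral_indicator)
    also have "\<dots> = (\<integral>\<^sup>+x. indicator B (\<theta> *v x) \<partial>\<mu>)"
      by (subst int_S) (simp_all add: nn_integral_multc ker1)
    also have "\<dots> = emeasure (distr \<mu> borel (\<lambda>x. \<theta> *v x)) B"
      by (simp add: nn_integral_distr flip: nn_integral_indicator)
    finally show "emeasure (distr S borel (\<lambda>p. \<theta> *v fst p)) B = emeasure (distr \<mu> borel (\<lambda>x. \<theta> *v x)) B" .
  qed simp
  also have "(\<integral>\<^sup>+p. ennreal ((norm (\<theta> *v fst p - snd p))\<^sup>2) \<partial>S) = smoothing_cost \<theta>"
    unfolding smoothing_cost_def by (subst int_S) simp_all
  finally show ?thesis unfolding isotropic_gaussian_eq mixing_cost_def .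
qed

text \<open>For fixed \<open>x\<close> the cost is bias plus noise: each coordinate of
  \<open>\<theta> *v (x - shrink t x)\<close> has second moment
  \<open>\<parallel>x - shrink t x\<parallel>\<^sup>2 / n\<close>, to which \<open>noise t x\<close>
  is added. The pointwise bound \<open>shrink_cost_le\<close> is then averaged over
  \<open>\<mu>\<close>.\<close>

lemma nn_integral_smoothing_cost:
  assumes \<alpha>: "(\<integral>\<^sup>+x. ennreal \<bar>(norm x)\<^sup>2 / real CARD('n) - 1\<bar> \<partial>\<mu>) = ennreal \<alpha>" "\<alpha> \<ge> 0"
    and second: "(\<integral>\<^sup>+x. ennreal ((norm x)\<^sup>2 / real CARD('n)) \<partial>\<mu>) = 1"
  shows "(\<integral>\<^sup>+\<theta>. smoothing_cost \<theta> \<partial>(gaussian_matrix (1 / real CARD('n)) :: (real^'n^'k) measure)) \<le>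
    ennreal (real CARD('k) * (\<alpha> + 2 * (1 - sqrt (1 - t))))"
proof -
  let ?T = "gaussian_matrix (1 / real CARD('n)) :: (real^'n^'k) measure"
  interpret T: prob_space ?T by (rule prob_space_gaussian_matrix) simp
  interpret P: pair_sigma_finite \<mu> ?T ..
  let ?s = "\<lambda>x. x - shrink t x"
  have v: "noise t x \<ge> 0" for x using noise_bounds[OF t, of x] by simp
  have cost: "smoothing_cost \<theta> = (\<integral>\<^sup>+x. (\<Sum>i\<in>UNIV. ennreal ((0 - (\<theta> *v ?s x) $ i)\<^sup>2) + ennreal (noise t x)) \<partial>\<mu>)" for \<theta> :: "real^'n^'k"
    unfolding smoothing_cost_def kernel_def
  proof (intro nn_integral_cong)
    fix x
    have "(\<theta> *v x) $ i - (\<theta> *v shrink t x) $ i = (\<theta> *v ?s x) $ i" for i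
      by (simp add: matrix_vector_mult_diff_distrib)
    then show "(\<integral>\<^sup>+y. ennreal (shifted_gaussian (noise t x) (\<theta> *v shrink t x) y) * ennreal ((norm (\<theta> *v x - y))\<^sup>2) \<partial>lborel) =
      (\<Sum>i\<in>UNIV. ennreal ((0 - (\<theta> *v ?s x) $ i)\<^sup>2) + ennreal (noise t x))"
      using noise_bounds(3)[OF t, of x] v[of x]
      by (subst nn_integral_shifted_gaussian_square) (simp_all add: ennreal_plus)
  qed
  have "(\<integral>\<^sup>+\<theta>. smoothing_cost \<theta> \<partial>?T) =
     (\<integral>\<^sup>+x. \<integral>\<^sup>+\<theta>. (\<Sum>i\<in>UNIV. ennreal ((0 - ((\<theta> :: real^'n^'k) *v ?s x) $ i)\<^sup>2) + ennreal (noise t x)) \<partial>?T \<partial>\<mu>)"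
    unfolding cost by (rule P.Fubini') measurable
  also have "\<dots> = (\<integral>\<^sup>+x. (\<Sum>i\<in>(UNIV::'k set). ennreal (1 / real CARD('n) * (?s x \<bullet> ?s x) + noise t x)) \<partial>\<mu>)"
  proof (intro nn_integral_cong)
    fix x
    have "(\<integral>\<^sup>+\<theta>. (\<Sum>i\<in>UNIV. ennreal ((0 - (\<theta> *v ?s x) $ i)\<^sup>2) + ennreal (noise t x)) \<partial>?T) =
       (\<Sum>i\<in>UNIV. (\<integral>\<^sup>+\<theta>. ennreal ((0 - (\<theta> *v ?s x) $ i)\<^sup>2) \<partial>?T) + ennreal (noise t x))"
      by (subst nn_integral_sum) (simp_all add: nn_integral_add T.emeasure_space_1 del: diff_0 power2_minus)
    also have "\<dots> = (\<Sum>i\<in>(UNIV::'k set). ennreal (1 / real CARD('n) * (?s x \<bullet> ?s x)) + ennreal (noise t x))"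
      by (subst nn_integral_gaussian_matrix_square) simp_all
    also have "\<dots> = (\<Sum>i\<in>(UNIV::'k set). ennreal (1 / real CARD('n) * (?s x \<bullet> ?s x) + noise t x))"
      using v[of x] by (subst ennreal_plus) auto
    finally show "(\<integral>\<^sup>+\<theta>. (\<Sum>i\<in>UNIV. ennreal ((0 - (\<theta> *v ?s x) $ i)\<^sup>2) + ennreal (noise t x)) \<partial>?T) =
      (\<Sum>i\<in>(UNIV::'k set). ennreal (1 / real CARD('n) * (?s x \<bullet> ?s x) + noise t x))" .
  qed
  also have "\<dots> \<le> (\<integral>\<^sup>+x. (\<Sum>i\<in>(UNIV::'k set). ennreal \<bar>(norm x)\<^sup>2 / real CARD('n) - 1\<bar> +
       ennreal (2 * (1 - sqrt (1 - t))) * ennreal ((norm x)\<^sup>2 / real CARD('n))) \<partial>\<mu>)"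
  proof (intro nn_integral_mono sum_mono)
    fix x :: "real^'n"
    have "ennreal (1 / real CARD('n) * (?s x \<bullet> ?s x) + noise t x) \<le>
        ennreal (\<bar>(norm x)\<^sup>2 / real CARD('n) - 1\<bar> + 2 * (1 - sqrt (1 - t)) * ((norm x)\<^sup>2 / real CARD('n)))"
      by (intro ennreal_leI shrink_cost_le t)
    also have "\<dots> = ennreal \<bar>(norm x)\<^sup>2 / real CARD('n) - 1\<bar> + ennreal (2 * (1 - sqrt (1 - t))) * ennreal ((norm x)\<^sup>2 / real CARD('n))"
    proof -
      have c: "0 \<le> 2 * (1 - sqrt (1 - t))" using t by simp
      show ?thesis
        unfolding ennreal_mult'[OF c, symmetric] by (intro ennreal_plus mult_nonneg_nonneg c) auto
    qed
    finally show "ennreal (1 / real CARD('n) * (?s x \<bullet> ?s x) + noise t x) \<le> \<dots>" .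
  qed
  also have "\<dots> = of_nat CARD('k) * (ennreal \<alpha> + ennreal (2 * (1 - sqrt (1 - t))) * 1)"
    by (simp add: nn_integral_cmult nn_integral_add \<alpha>(1) second del: mult_1_right)
  also have "\<dots> = ennreal (real CARD('k) * (\<alpha> + 2 * (1 - sqrt (1 - t))))"
    using t \<alpha>(2) by (simp add: ennreal_mult ennreal_plus ennreal_of_nat_eq_real_of_nat)
  finally show ?thesis .
qed

text \<open>Cauchy-Schwarz jointly over \<open>y\<close> and the matrix, with
  \<open>sqrt (inv_weight y)\<close> moved from one factor to the other. Working coordinate by
  coordinate requires only a one-dimensional fourth moment, and summation gives the factor
  \<open>k\<close>.\<close>

lemma nn_integral_mixing_cost:
  assumes Y: "chi2 \<mu> t TYPE('k::finite) \<le> ennreal Y" "Y \<ge> 0"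
  shows "(\<integral>\<^sup>+\<theta>. mixing_cost \<theta> \<partial>(gaussian_matrix (1 / real CARD('n)) :: (real^'n^'k) measure)) \<le>
    ennreal (real CARD('k) * sqrt (12 * Y))"
proof -
  let ?T = "gaussian_matrix (1 / real CARD('n)) :: (real^'n^'k) measure"
  interpret T: prob_space ?T by (rule prob_space_gaussian_matrix) simp
  interpret P: pair_sigma_finite "lborel :: (real^'k) measure" ?T ..
  let ?d = "\<lambda>(\<theta> :: real^'n^'k) y. \<bar>mixture t \<mu> \<theta> y - shifted_gaussian 1 0 y\<bar>"
  have comp: "(\<integral>\<^sup>+y. \<integral>\<^sup>+\<theta>. ennreal ((y $ i)\<^sup>2 * ?d \<theta> y) \<partial>?T \<partial>lborel) \<le> ennreal (sqrt (12 * Y))" (is "?I \<le> _") for i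
  proof -
    let ?Q = "(lborel :: (real^'k) measure) \<Otimes>\<^sub>M ?T"
    let ?f = "\<lambda>p. ennreal ((fst p $ i)\<^sup>2 / sqrt (inv_weight (fst p)))"
    let ?g = "\<lambda>p. ennreal (?d (snd p) (fst p) * sqrt (inv_weight (fst p)))"
    have fg: "?f p * ?g p = ennreal ((fst p $ i)\<^sup>2 * ?d (snd p) (fst p))" for p
      using inv_weight_pos[of "fst p"] by (simp flip: ennreal_mult)
    have f2: "?f p ^ 2 = ennreal ((fst p $ i) ^ 4 / inv_weight (fst p))" for p
      using inv_weight_pos[of "fst p"] by (simp add: ennreal_power power_divide less_imp_le flip: power_mult)
    have g2: "?g p ^ 2 = ennreal ((mixture t \<mu> (snd p) (fst p) - shifted_gaussian 1 0 (fst p))\<^sup>2 * inv_weight (fst p))" for p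
      using inv_weight_pos[of "fst p"] by (simp add: ennreal_power power_mult_distrib less_imp_le)
    have "?I = (\<integral>\<^sup>+p. ?f p * ?g p \<partial>?Q)"
      unfolding fg by (subst T.nn_integral_fst[symmetric]) simp_all
    then have "?I\<^sup>2 \<le> (\<integral>\<^sup>+p. ?f p ^ 2 \<partial>?Q) * (\<integral>\<^sup>+p. ?g p ^ 2 \<partial>?Q)"
      by (simp only:) (rule Cauchy_Schwarz_nn_integral, measurable)
    also have "(\<integral>\<^sup>+p. ?f p ^ 2 \<partial>?Q) = 12"
      unfolding f2 by (subst T.nn_integral_fst[symmetric]) (simp_all add: T.emeasure_space_1 nn_integral_weight_fourth)
    also have "(\<integral>\<^sup>+p. ?g p ^ 2 \<partial>?Q) = chi2 \<mu> t TYPE('k)"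
      unfolding g2 chi2_def[OF \<mu> sets_\<mu> t] by (subst T.nn_integral_fst[symmetric]) simp_all
    also have "12 * chi2 \<mu> t TYPE('k) \<le> 12 * ennreal Y"
      by (intro mult_left_mono Y) simp
    also have "12 * ennreal Y = (ennreal (sqrt (12 * Y)))\<^sup>2"
      using Y(2) ennreal_mult[of 12 Y] by (simp add: ennreal_power)
    finally have *: "?I\<^sup>2 \<le> (ennreal (sqrt (12 * Y)))\<^sup>2" .
    show ?thesis
    proof (cases ?I)
      case (real r)
      have "(ennreal r)\<^sup>2 \<le> (ennreal (sqrt (12 * Y)))\<^sup>2" using * unfolding real(2) .
      then have "r\<^sup>2 \<le> (sqrt (12 * Y))\<^sup>2" using real(1) Y(2) by (simp add: ennreal_power)
      then have "r \<le> sqrt (12 * Y)" by (rule power2_le_imp_le) (simp add: Y(2))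
      then show ?thesis unfolding real(2) by (rule ennreal_leI)
    next
      case top
      have "(\<top>::ennreal)\<^sup>2 \<le> (ennreal (sqrt (12 * Y)))\<^sup>2" using * unfolding top .
      then show ?thesis using Y(2) by (simp add: ennreal_power top_unique)
    qed
  qed
  have "(\<integral>\<^sup>+\<theta>. mixing_cost \<theta> \<partial>?T) = (\<integral>\<^sup>+y. \<integral>\<^sup>+\<theta>. ennreal ((norm y)\<^sup>2 * ?d \<theta> y) \<partial>?T \<partial>lborel)"
    unfolding mixing_cost_def by (rule P.Fubini') measurable
  also have "\<dots> = (\<integral>\<^sup>+y. \<integral>\<^sup>+\<theta>. (\<Sum>i\<in>UNIV. ennreal ((y $ i)\<^sup>2 * ?d \<theta> y)) \<partial>?T \<partial>lborel)"
    by (simp add: norm_square_eq_sum sum_distrib_right)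
  also have "\<dots> = (\<Sum>i\<in>UNIV. \<integral>\<^sup>+y. \<integral>\<^sup>+\<theta>. ennreal ((y $ i)\<^sup>2 * ?d \<theta> y) \<partial>?T \<partial>lborel)"
    by (simp add: nn_integral_sum del: sum_ennreal)
  also have "\<dots> \<le> (\<Sum>i\<in>(UNIV::'k set). ennreal (sqrt (12 * Y)))"
    by (intro sum_mono comp)
  also have "\<dots> = ennreal (real CARD('k) * sqrt (12 * Y))"
    using Y(2) by (simp add: ennreal_mult ennreal_of_nat_eq_real_of_nat)
  finally show ?thesis .
qed

text \<open>A measurable majorant \<open>F\<close> is produced instead of a bound on the integral of
  the cost itself, whose measurability in \<open>\<theta>\<close> is left open. The constant
  \<open>5 * sqrt 3\<close> is \<open>5 / 2 * sqrt 12\<close>.\<close>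

lemma expected_projection_cost:
  assumes \<alpha>: "(\<integral>\<^sup>+x. ennreal \<bar>(norm x)\<^sup>2 / real CARD('n) - 1\<bar> \<partial>\<mu>) = ennreal \<alpha>" "\<alpha> \<ge> 0"
    and second: "(\<integral>\<^sup>+x. ennreal ((norm x)\<^sup>2 / real CARD('n)) \<partial>\<mu>) = 1"
    and b1: "(\<integral>\<^sup>+x. \<integral>\<^sup>+x'. ennreal (\<bar>x \<bullet> x'\<bar> / real CARD('n)) \<partial>\<mu> \<partial>\<mu>) = ennreal b1" "b1 \<ge> 0"
    and b2: "(\<integral>\<^sup>+x. \<integral>\<^sup>+x'. ennreal ((\<bar>x \<bullet> x'\<bar> / real CARD('n))\<^sup>2) \<partial>\<mu> \<partial>\<mu>) = ennreal (b2\<^sup>2)"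
  obtains F :: "real^'n^'k \<Rightarrow> ennreal"
  where "F \<in> borel_measurable borel"
    and "\<And>\<theta>. (W2 (distr \<mu> borel (\<lambda>x. \<theta> *v x)) (isotropic_gaussian 1))\<^sup>2 \<le> F \<theta>"
    and "(\<integral>\<^sup>+\<theta>. F \<theta> \<partial>gaussian_matrix (1 / real CARD('n))) \<le> ennreal (real CARD('k) *
      (5 * (\<alpha> + 2 * (1 - sqrt (1 - t))) + 5 * sqrt 3 *
        sqrt (2 * real CARD('k) / 3 * corr_weight 0 ^ CARD('k) * b1 + b2\<^sup>2 * corr_weight (1 - t) ^ CARD('k))))"
proof
  let ?T = "gaussian_matrix (1 / real CARD('n)) :: (real^'n^'k) measure"
  let ?Y = "2 * real CARD('k) / 3 * corr_weight 0 ^ CARD('k) * b1 + b2\<^sup>2 * corr_weight (1 - t) ^ CARD('k)"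
  let ?F = "\<lambda>\<theta>::real^'n^'k. 5 * smoothing_cost \<theta> + ennreal (5 / 2) * mixing_cost \<theta>"
  have Y: "?Y \<ge> 0"
    using b1(2) corr_weight_pos[of 0] corr_weight_pos[of "1 - t"] t by (intro add_nonneg_nonneg mult_nonneg_nonneg) auto
  have c: "\<alpha> + 2 * (1 - sqrt (1 - t)) \<ge> 0" using \<alpha>(2) t by simp
  show "?F \<in> borel_measurable borel" by measurable
  show "(W2 (distr \<mu> borel (\<lambda>x. \<theta> *v x)) (isotropic_gaussian 1))\<^sup>2 \<le> ?F \<theta>" for \<theta>
    by (rule W2_projection_le)
  have "(\<integral>\<^sup>+\<theta>. ?F \<theta> \<partial>?T) = 5 * (\<integral>\<^sup>+\<theta>. smoothing_cost \<theta> \<partial>?T) + ennreal (5 / 2) * (\<integral>\<^sup>+\<theta>. mixing_cost \<theta> \<partial>?T)"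
    by (simp add: nn_integral_add nn_integral_cmult)
  also have "\<dots> \<le> ennreal 5 * ennreal (real CARD('k) * (\<alpha> + 2 * (1 - sqrt (1 - t)))) +
      ennreal (5 / 2) * ennreal (real CARD('k) * sqrt (12 * ?Y))"
  proof (intro add_mono mult_mono)
    show "(\<integral>\<^sup>+\<theta>. smoothing_cost \<theta> \<partial>?T) \<le> ennreal (real CARD('k) * (\<alpha> + 2 * (1 - sqrt (1 - t))))"
      by (rule nn_integral_smoothing_cost[OF \<alpha> second])
    show "(\<integral>\<^sup>+\<theta>. mixing_cost \<theta> \<partial>?T) \<le> ennreal (real CARD('k) * sqrt (12 * ?Y))"
      by (rule nn_integral_mixing_cost[OF chi2_le[OF \<mu> sets_\<mu> t b1 b2] Y])
  qed auto
  also have "\<dots> = ennreal (5 * (real CARD('k) * (\<alpha> + 2 * (1 - sqrt (1 - t)))) + 5 / 2 * (real CARD('k) * sqrt (12 * ?Y)))"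
  proof -
    have "ennreal 5 * ennreal p + ennreal (5 / 2) * ennreal q = ennreal (5 * p + 5 / 2 * q)" if "p \<ge> 0" "q \<ge> 0" for p q
      using that by (simp del: ennreal_numeral flip: ennreal_mult ennreal_plus)
    moreover have "real CARD('k) * (\<alpha> + 2 * (1 - sqrt (1 - t))) \<ge> 0" "real CARD('k) * sqrt (12 * ?Y) \<ge> 0"
      by (intro mult_nonneg_nonneg c real_sqrt_ge_zero Y of_nat_0_le_iff zero_le_numeral)+
    ultimately show ?thesis by blast
  qed
  also have "sqrt (12 * ?Y) = 2 * (sqrt 3 * sqrt ?Y)"
  proof -
    have "sqrt (12 * ?Y) = sqrt (2\<^sup>2 * (3 * ?Y))" by simp
    also have "\<dots> = 2 * (sqrt 3 * sqrt ?Y)" by (simp only: real_sqrt_mult real_sqrt_abs)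
    finally show ?thesis .
  qed
  finally show "(\<integral>\<^sup>+\<theta>. ?F \<theta> \<partial>?T) \<le> ennreal (real CARD('k) *
      (5 * (\<alpha> + 2 * (1 - sqrt (1 - t))) + 5 * sqrt 3 * sqrt ?Y))"
    by (simp add: algebra_simps)
qed

end

section \<open>Conditional distributions\<close>

text \<open>By the independent coupling: averaged over the matrix, the projected law has second
  moment \<open>k\<close>, as has the normal law, and twice their sum is \<open>4 k\<close>.\<close>

lemma trivial_projection_cost:
  fixes \<mu> :: "(real^'n) measure"
  assumes \<mu>: "prob_space \<mu>" and sets_\<mu>: "sets \<mu> = sets borel"
    and second: "(\<integral>\<^sup>+x. ennreal ((norm x)\<^sup>2 / real CARD('n)) \<partial>\<mu>) = 1"
  obtains F :: "real^'n^'k \<Rightarrow> ennreal"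
  where "F \<in> borel_measurable borel"
    and "\<And>\<theta>. (W2 (distr \<mu> borel (\<lambda>x. \<theta> *v x)) (isotropic_gaussian 1))\<^sup>2 \<le> F \<theta>"
    and "(\<integral>\<^sup>+\<theta>. F \<theta> \<partial>gaussian_matrix (1 / real CARD('n))) \<le> ennreal (real CARD('k) * 4)"
proof
  interpret prob_space \<mu> by fact
  note [measurable_cong] = sets_\<mu>
  let ?T = "gaussian_matrix (1 / real CARD('n)) :: (real^'n^'k) measure"
  interpret T: prob_space ?T by (rule prob_space_gaussian_matrix) simp
  interpret P: pair_sigma_finite \<mu> ?T ..
  let ?F = "\<lambda>\<theta>::real^'n^'k. 2 * (\<integral>\<^sup>+x. ennreal ((norm (\<theta> *v x))\<^sup>2) \<partial>\<mu>) + 2 * of_nat CARD('k)"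
  show "?F \<in> borel_measurable borel" by measurable
  have gauss: "(\<integral>\<^sup>+z. ennreal ((norm z)\<^sup>2) \<partial>(isotropic_gaussian 1 :: (real^'k) measure)) = of_nat CARD('k)"
    using nn_integral_shifted_gaussian_square[of 1 "0::real^'k" 0]
    by (simp add: isotropic_gaussian_eq nn_integral_density)
  have iso: "prob_space (isotropic_gaussian 1 :: (real^'k) measure)" "sets (isotropic_gaussian 1 :: (real^'k) measure) = sets borel"
    unfolding isotropic_gaussian_eq
    by (auto intro!: prob_spaceI simp: emeasure_density nn_integral_shifted_gaussian)
  show "(W2 (distr \<mu> borel (\<lambda>x. \<theta> *v x)) (isotropic_gaussian 1))\<^sup>2 \<le> ?F \<theta>" for \<theta>
    using W2_square_le_moments[of "distr \<mu> borel (\<lambda>x. \<theta> *v x)", OF _ _ iso] gauss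
    by (simp add: nn_integral_distr prob_space_distr)
  have "(\<integral>\<^sup>+\<theta>. \<integral>\<^sup>+x. ennreal ((norm (\<theta> *v x))\<^sup>2) \<partial>\<mu> \<partial>?T) = (\<integral>\<^sup>+x. \<integral>\<^sup>+\<theta>. ennreal ((norm (\<theta> *v x))\<^sup>2) \<partial>?T \<partial>\<mu>)"
    by (rule P.Fubini') measurable
  also have "\<dots> = (\<integral>\<^sup>+x. of_nat CARD('k) * ennreal ((norm x)\<^sup>2 / real CARD('n)) \<partial>\<mu>)"
  proof (intro nn_integral_cong)
    fix x :: "real^'n"
    have "(\<integral>\<^sup>+\<theta>. ennreal ((norm ((\<theta> :: real^'n^'k) *v x))\<^sup>2) \<partial>?T) = (\<integral>\<^sup>+\<theta>. (\<Sum>i\<in>UNIV. ennreal ((0 - (\<theta> *v x) $ i)\<^sup>2)) \<partial>?T)"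
      by (simp add: norm_square_eq_sum)
    also have "\<dots> = (\<Sum>i\<in>(UNIV :: 'k set). ennreal (0\<^sup>2 + 1 / real CARD('n) * (x \<bullet> x)))"
      by (subst nn_integral_sum, measurable, subst nn_integral_gaussian_matrix_square) auto
    finally show "(\<integral>\<^sup>+\<theta>. ennreal ((norm ((\<theta> :: real^'n^'k) *v x))\<^sup>2) \<partial>?T) = of_nat CARD('k) * ennreal ((norm x)\<^sup>2 / real CARD('n))"
      by (simp add: power2_norm_eq_inner)
  qed
  also have "\<dots> = of_nat CARD('k)"
    by (subst nn_integral_cmult) (simp_all add: second)
  finally have "(\<integral>\<^sup>+\<theta>. ?F \<theta> \<partial>?T) = 2 * of_nat CARD('k) + 2 * of_nat CARD('k)"
    by (simp add: nn_integral_add nn_integral_cmult T.emeasure_space_1)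
  also have "\<dots> = ennreal (real CARD('k) * 4)"
    by (simp add: ennreal_mult ennreal_of_nat_eq_real_of_nat flip: distrib_right) (simp add: mult.commute)
  finally show "(\<integral>\<^sup>+\<theta>. ?F \<theta> \<partial>?T) \<le> ennreal (real CARD('k) * 4)" by simp
qed

text \<open>For each single set the kernels agree almost everywhere, by uniqueness of densities with
  respect to \<open>T\<close>. A countable generator closed under intersection leaves only countably
  many exceptional null sets and still determines the measures.\<close>

lemma AE_kernel_unique:
  fixes \<kappa> \<kappa>' :: "'b::topological_space \<Rightarrow> 'c::second_countable_topology measure"
  assumes T: "finite_measure T" and [measurable_cong]: "sets T = sets borel"
    and \<kappa> [measurable]: "\<kappa> \<in> borel \<rightarrow>\<^sub>M prob_algebra borel" and \<kappa>' [measurable]: "\<kappa>' \<in> borel \<rightarrow>\<^sub>M prob_algebra borel"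
    and eq: "\<And>A B. A \<in> sets borel \<Longrightarrow> B \<in> sets borel \<Longrightarrow>
      (\<integral>\<^sup>+y\<in>A. emeasure (\<kappa> y) B \<partial>T) = (\<integral>\<^sup>+y\<in>A. emeasure (\<kappa>' y) B \<partial>T)"
  shows "AE y in T. \<kappa> y = \<kappa>' y"
proof -
  interpret finite_measure T by fact
  obtain \<B> :: "'c set set" where \<B>: "countable \<B>" "topological_basis \<B>"
    using ex_countable_basis by blast
  \<comment> \<open>Finite intersections of basis sets; the empty intersection supplies
    \<open>UNIV\<close>.\<close>
  define E where "E = Inter ` {F. finite F \<and> F \<subseteq> \<B>}"
  have "countable E" unfolding E_def using \<B>(1) by (intro countable_image countable_Collect_finite_subset)
  have open_E: "open e" if "e \<in> E" for e
    using that topological_basis_open[OF \<B>(2)] by (auto simp: E_def intro!: open_Inter)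
  have "UNIV \<in> E" unfolding E_def by (auto intro!: image_eqI[of _ _ "{}"])
  have stable: "Int_stable E"
  proof (unfold Int_stable_def, safe)
    fix a b assume "a \<in> E" "b \<in> E"
    then obtain F G where "finite F" "F \<subseteq> \<B>" "a = \<Inter>F" "finite G" "G \<subseteq> \<B>" "b = \<Inter>G"
      by (auto simp: E_def)
    then show "a \<inter> b \<in> E"
      unfolding E_def by (intro image_eqI[of _ _ "F \<union> G"]) auto
  qed
  have sets_E: "sets (borel :: 'c measure) = sigma_sets UNIV E"
  proof
    have "\<B> \<subseteq> E" unfolding E_def by (auto intro!: image_eqI[of _ _ "{_}"])
    then have "sigma_sets UNIV \<B> \<subseteq> sigma_sets UNIV E" by (rule sigma_sets_mono')
    then show "sets (borel :: 'c measure) \<subseteq> sigma_sets UNIV E"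
      by (subst borel_eq_countable_basis[OF \<B>]) simp
    have "sigma_sets (space (borel :: 'c measure)) E \<subseteq> sets borel"
      using open_E by (intro sets.sigma_sets_subset) auto
    then show "sigma_sets UNIV E \<subseteq> sets (borel :: 'c measure)" by simp
  qed
  have "AE y in T. emeasure (\<kappa> y) e = emeasure (\<kappa>' y) e" if "e \<in> E" for e
  proof (rule density_unique_finite_measure)
    have [measurable]: "e \<in> sets borel" using open_E[OF that] by simp
    have "(\<lambda>y. emeasure (\<kappa> y) e) \<in> borel_measurable borel" "(\<lambda>y. emeasure (\<kappa>' y) e) \<in> borel_measurable borel"
      using measurable_compose[OF measurable_prob_algebraD[OF \<kappa>] measurable_emeasure_subprob_algebra[of e]]
        measurable_compose[OF measurable_prob_algebraD[OF \<kappa>'] measurable_emeasure_subprob_algebra[of e]]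
      by simp_all
    then show "(\<lambda>y. emeasure (\<kappa> y) e) \<in> borel_measurable T" "(\<lambda>y. emeasure (\<kappa>' y) e) \<in> borel_measurable T"
      by (simp_all cong: measurable_cong_sets add: assms(2))
    show "(\<integral>\<^sup>+y. emeasure (\<kappa> y) e * indicator A y \<partial>T) = (\<integral>\<^sup>+y. emeasure (\<kappa>' y) e * indicator A y \<partial>T)"
      if "A \<in> sets T" for A
      using eq[of A e] that assms(2) by simp
  qed auto
  then have "AE y in T. \<forall>e\<in>E. emeasure (\<kappa> y) e = emeasure (\<kappa>' y) e"
    using \<open>countable E\<close> by (subst AE_ball_countable) auto
  then show ?thesis
  proof (rule AE_mp, intro AE_I2 impI)
    fix y assume e: "\<forall>e\<in>E. emeasure (\<kappa> y) e = emeasure (\<kappa>' y) e"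
    have k: "\<kappa> y \<in> space (prob_algebra borel)" "\<kappa>' y \<in> space (prob_algebra borel)"
      using measurable_space[OF \<kappa>] measurable_space[OF \<kappa>'] by simp_all
    show "\<kappa> y = \<kappa>' y"
    proof (rule measure_eqI_generator_eq[OF stable])
      show "sets (\<kappa> y) = sigma_sets UNIV E" "sets (\<kappa>' y) = sigma_sets UNIV E"
        using k by (simp_all add: space_prob_algebra sets_E)
      interpret K: prob_space "\<kappa> y" using k by (simp add: space_prob_algebra)
      show "emeasure (\<kappa> y) ((\<lambda>_::nat. UNIV) i) \<noteq> \<infinity>" for i by simp
    qed (use e \<open>UNIV \<in> E\<close> in auto)
  qed
qed

text \<open>By independence, the law of \<open>\<theta> *v X\<close> with \<open>\<theta>\<close>
  frozen is itself a conditional distribution given \<open>\<Theta>\<close>, so every version agrees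
  with it almost everywhere.\<close>

lemma conditional_distribution_projection:
  fixes M :: "'a measure" and X :: "'a \<Rightarrow> real^'n" and \<Theta> :: "'a \<Rightarrow> real^'n^'k"
  assumes M: "prob_space M" and X [measurable]: "X \<in> borel_measurable M" and \<Theta> [measurable]: "\<Theta> \<in> borel_measurable M"
    and indep: "distr M borel \<Theta> \<Otimes>\<^sub>M distr M borel X = distr M (borel \<Otimes>\<^sub>M borel) (\<lambda>\<omega>. (\<Theta> \<omega>, X \<omega>))"
    and P: "is_conditional_distribution M \<Theta> (\<lambda>\<omega>. \<Theta> \<omega> *v X \<omega>) P"
  shows "AE \<theta> in distr M borel \<Theta>. P \<theta> = distr (distr M borel X) borel (\<lambda>x. \<theta> *v x)"
proof (rule AE_kernel_unique)
  interpret prob_space M by fact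
  interpret T: prob_space "distr M borel \<Theta>" by (rule prob_space_distr) measurable
  interpret X: prob_space "distr M borel X" by (rule prob_space_distr) measurable
  show "finite_measure (distr M borel \<Theta>)" by (rule T.finite_measure_axioms)
  show "P \<in> borel \<rightarrow>\<^sub>M prob_algebra borel" using P by (simp add: is_conditional_distribution_def)
  show "(\<lambda>\<theta> :: real^'n^'k. distr (distr M borel X) borel (\<lambda>x. \<theta> *v x)) \<in> borel \<rightarrow>\<^sub>M prob_algebra borel"
  proof (rule measurable_prob_algebraI)
    show "prob_space (distr (distr M borel X) borel (\<lambda>x. \<theta> *v x))" if "\<theta> \<in> space borel" for \<theta> :: "real^'n^'k"
      by (rule X.prob_space_distr) measurable
    show "(\<lambda>\<theta> :: real^'n^'k. distr (distr M borel X) borel (\<lambda>x. \<theta> *v x)) \<in> (borel :: (real^'n^'k) measure) \<rightarrow>\<^sub>M subprob_algebra borel"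
      by (rule measurable_distr2[where M = borel]) (auto intro!: measurable_const simp: space_subprob_algebra X.subprob_space_axioms)
  qed
  fix A :: "(real^'n^'k) set" and B :: "(real^'k) set"
  assume [measurable]: "A \<in> sets borel" "B \<in> sets borel"
  have "(\<integral>\<^sup>+y\<in>A. emeasure (P y) B \<partial>distr M borel \<Theta>) = emeasure M {\<omega> \<in> space M. \<Theta> \<omega> \<in> A \<and> \<Theta> \<omega> *v X \<omega> \<in> B}"
    using P \<open>A \<in> sets borel\<close> \<open>B \<in> sets borel\<close> by (simp add: is_conditional_distribution_def)
  also have "\<dots> = (\<integral>\<^sup>+\<omega>. indicator {\<omega> \<in> space M. \<Theta> \<omega> \<in> A \<and> \<Theta> \<omega> *v X \<omega> \<in> B} \<omega> \<partial>M)"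
    by (rule nn_integral_indicator[symmetric]) measurable
  also have "\<dots> = (\<integral>\<^sup>+\<omega>. indicator A (\<Theta> \<omega>) * indicator B (\<Theta> \<omega> *v X \<omega>) \<partial>M)"
    by (intro nn_integral_cong) (auto split: split_indicator)
  also have "\<dots> = (\<integral>\<^sup>+p. indicator A (fst p) * indicator B (fst p *v snd p) \<partial>distr M (borel \<Otimes>\<^sub>M borel) (\<lambda>\<omega>. (\<Theta> \<omega>, X \<omega>)))"
    by (subst nn_integral_distr) simp_all
  also have "\<dots> = (\<integral>\<^sup>+\<theta>. \<integral>\<^sup>+x. indicator A \<theta> * indicator B (\<theta> *v x) \<partial>distr M borel X \<partial>distr M borel \<Theta>)"
    unfolding indep[symmetric] by (subst X.nn_integral_fst[symmetric]) simp_all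
  also have "\<dots> = (\<integral>\<^sup>+y\<in>A. emeasure (distr (distr M borel X) borel (\<lambda>x. y *v x)) B \<partial>distr M borel \<Theta>)"
  proof (intro nn_integral_cong)
    fix \<theta> :: "real^'n^'k"
    have "emeasure (distr (distr M borel X) borel (\<lambda>x. \<theta> *v x)) B = (\<integral>\<^sup>+x. indicator B (\<theta> *v x) \<partial>distr M borel X)"
      by (simp add: nn_integral_distr flip: nn_integral_indicator)
    then show "(\<integral>\<^sup>+x. indicator A \<theta> * indicator B (\<theta> *v x) \<partial>distr M borel X) =
      emeasure (distr (distr M borel X) borel (\<lambda>x. \<theta> *v x)) B * indicator A \<theta>"
      by (simp add: nn_integral_cmult mult.commute)
  qed
  finally show "(\<integral>\<^sup>+y\<in>A. emeasure (P y) B \<partial>distr M borel \<Theta>) =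
    (\<integral>\<^sup>+y\<in>A. emeasure (distr (distr M borel X) borel (\<lambda>x. y *v x)) B \<partial>distr M borel \<Theta>)" .
qed simp

section \<open>From the hypotheses on the random variables to laws and moments\<close>

lemma distr_gaussian_entries:
  fixes \<Theta> :: "'a \<Rightarrow> real^'n^'k"
  assumes M: "prob_space M"
    and ind: "prob_space.indep_vars M (\<lambda>_. borel) (\<lambda>(i, j) \<omega>. \<Theta> \<omega> $ i $ j) UNIV"
    and dist: "\<And>i j. distributed M lborel (\<lambda>\<omega>. \<Theta> \<omega> $ i $ j) (\<lambda>x. ennreal (nd V x))"
  shows "\<Theta> \<in> borel_measurable M" "distr M borel \<Theta> = gaussian_matrix V"
proof -
  interpret prob_space M by fact
  have ent [measurable]: "(\<lambda>\<omega>. \<Theta> \<omega> $ i $ j) \<in> borel_measurable M" for i j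
    using distributed_measurable[OF dist, of i j] by simp
  have "(\<lambda>\<omega>. \<chi> i j. \<Theta> \<omega> $ i $ j) \<in> borel_measurable M"
    by (intro measurable_vec_lambda ent)
  then show [measurable]: "\<Theta> \<in> borel_measurable M" by (simp add: vec_lambda_eta)
  let ?X = "\<lambda>p \<omega>. \<Theta> \<omega> $ fst p $ snd p"
  let ?e = "\<lambda>\<omega>. \<lambda>p\<in>UNIV. ?X p \<omega>"
  have D: "distr M borel (?X p) = gaussian_measure V" for p
  proof -
    have "distr M borel (?X p) = distr M lborel (?X p)"
      by (rule distr_cong) simp_all
    then show ?thesis using distributed_distr_eq_density[OF dist] by simp
  qed
  have "indep_vars (\<lambda>_. borel) ?X UNIV"
    using ind by (simp add: case_prod_unfold)
  then have e: "distr M (PiM UNIV (\<lambda>_. borel)) ?e = PiM UNIV (\<lambda>_. gaussian_measure V)"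
    using indep_vars_iff_distr_eq_PiM[where I = UNIV and M' = "\<lambda>_. borel" and X = ?X] unfolding D by simp
  have me: "?e \<in> M \<rightarrow>\<^sub>M PiM UNIV (\<lambda>_. borel)"
    by (intro measurable_restrict ent)
  have mm: "(\<lambda>e. \<chi> i j. e (i, j)) \<in> PiM UNIV (\<lambda>_::'k \<times> 'n. borel :: real measure) \<rightarrow>\<^sub>M borel"
    by (intro measurable_vec_lambda) measurable
  have "gaussian_matrix V = distr (distr M (PiM UNIV (\<lambda>_. borel)) ?e) borel (\<lambda>e. \<chi> i j. e (i, j))"
    unfolding gaussian_matrix_def e ..
  also have "\<dots> = distr M borel \<Theta>"
    by (subst distr_distr[OF mm me]) (simp add: comp_def vec_lambda_eta)
  finally show "distr M borel \<Theta> = gaussian_matrix V" ..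
qed

lemma joint_distribution_of_indep_set:
  fixes Y :: "'a \<Rightarrow> 'b::topological_space" and X :: "'a \<Rightarrow> 'c::topological_space"
  assumes M: "prob_space M" and Y [measurable]: "Y \<in> borel_measurable M" and X [measurable]: "X \<in> borel_measurable M"
    and indep: "prob_space.indep_set M (sets (vimage_algebra (space M) Y borel)) (sets (vimage_algebra (space M) X borel))"
  shows "distr M borel Y \<Otimes>\<^sub>M distr M borel X = distr M (borel \<Otimes>\<^sub>M borel) (\<lambda>\<omega>. (Y \<omega>, X \<omega>))"
proof (rule pair_measure_eqI)
  interpret prob_space M by fact
  show "sigma_finite_measure (distr M borel Y)" "sigma_finite_measure (distr M borel X)"
    by (intro prob_space_imp_sigma_finite prob_space_distr; measurable)+
  fix A :: "'b set" and B :: "'c set" assume "A \<in> sets (distr M borel Y)" "B \<in> sets (distr M borel X)"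
  then have [measurable]: "A \<in> sets borel" "B \<in> sets borel" by simp_all
  have "prob ((Y -` A \<inter> space M) \<inter> (X -` B \<inter> space M)) = prob (Y -` A \<inter> space M) * prob (X -` B \<inter> space M)"
    by (rule indep_setD[OF indep]) (auto intro!: in_vimage_algebra)
  moreover have "(Y -` A \<inter> space M) \<inter> (X -` B \<inter> space M) = (\<lambda>\<omega>. (Y \<omega>, X \<omega>)) -` (A \<times> B) \<inter> space M"
    by auto
  ultimately show "emeasure (distr M borel Y) A * emeasure (distr M borel X) B =
      emeasure (distr M (borel \<Otimes>\<^sub>M borel) (\<lambda>\<omega>. (Y \<omega>, X \<omega>))) (A \<times> B)"
    by (simp add: emeasure_distr emeasure_eq_measure ennreal_mult)
qed (simp cong: sets_pair_measure_cong)

text \<open>Cauchy-Schwarz bounds \<open>Z\<close> by a product of two independent norms, which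
  gives square integrability. Nonnegativity of the variance of \<open>Z\<close> gives the last
  inequality, the source of \<open>\<beta>\<^sub>1 \<le> \<beta>\<^sub>2\<close>.\<close>

lemma correlation_moments:
  fixes M :: "'a measure" and X :: "'a \<Rightarrow> real^'n"
  assumes M: "prob_space M" and X [measurable]: "X \<in> borel_measurable M"
    and int: "integrable M (\<lambda>\<omega>. (norm (X \<omega>))\<^sup>2)"
  defines "Z \<equiv> \<lambda>p. \<bar>X (fst p) \<bullet> X (snd p)\<bar>"
  shows "integrable (M \<Otimes>\<^sub>M M) (\<lambda>p. (Z p)\<^sup>2)" "integrable (M \<Otimes>\<^sub>M M) Z"
    "(\<integral>p. Z p \<partial>(M \<Otimes>\<^sub>M M)) \<le> sqrt (\<integral>p. (Z p)\<^sup>2 \<partial>(M \<Otimes>\<^sub>M M))"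
proof -
  interpret prob_space M by fact
  interpret MM: pair_prob_space M M ..
  have [measurable]: "Z \<in> borel_measurable (M \<Otimes>\<^sub>M M)" unfolding Z_def by measurable
  let ?E = "\<integral>\<^sup>+\<omega>. ennreal ((norm (X \<omega>))\<^sup>2) \<partial>M"
  have E: "?E < \<infinity>" using int by (simp add: integrable_iff_bounded)
  have "(\<integral>\<^sup>+p. ennreal (norm ((Z p)\<^sup>2)) \<partial>(M \<Otimes>\<^sub>M M)) \<le> (\<integral>\<^sup>+p. ennreal ((norm (X (fst p)))\<^sup>2) * ennreal ((norm (X (snd p)))\<^sup>2) \<partial>(M \<Otimes>\<^sub>M M))"
  proof (intro nn_integral_mono)
    fix p
    have "(Z p)\<^sup>2 \<le> (norm (X (fst p)) * norm (X (snd p)))\<^sup>2"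
      unfolding Z_def by (intro power_mono Cauchy_Schwarz_ineq2) simp
    then show "ennreal (norm ((Z p)\<^sup>2)) \<le> ennreal ((norm (X (fst p)))\<^sup>2) * ennreal ((norm (X (snd p)))\<^sup>2)"
      by (simp add: power_mult_distrib flip: ennreal_mult)
  qed
  also have "\<dots> = ?E * ?E"
    by (subst nn_integral_fst[symmetric]) (simp_all add: nn_integral_cmult nn_integral_multc)
  also have "\<dots> < \<infinity>" using E by (simp add: ennreal_mult_less_top)
  finally show Z2: "integrable (M \<Otimes>\<^sub>M M) (\<lambda>p. (Z p)\<^sup>2)"
    by (intro integrableI_bounded) simp_all
  show Z1: "integrable (M \<Otimes>\<^sub>M M) Z"
  proof (rule Bochner_Integration.integrable_bound)
    show "integrable (M \<Otimes>\<^sub>M M) (\<lambda>p. 1 + (Z p)\<^sup>2)" using Z2 by simp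
    have "norm (Z p) \<le> norm (1 + (Z p)\<^sup>2)" for p
    proof -
      have "2 * \<bar>Z p\<bar> * 1 \<le> \<bar>Z p\<bar>\<^sup>2 + 1\<^sup>2" by (rule sum_squares_bound)
      then show ?thesis by simp
    qed
    then show "AE p in M \<Otimes>\<^sub>M M. norm (Z p) \<le> norm (1 + (Z p)\<^sup>2)" by simp
  qed simp
  have "0 \<le> MM.variance Z" by (rule MM.variance_positive)
  then have "(\<integral>p. Z p \<partial>(M \<Otimes>\<^sub>M M))\<^sup>2 \<le> (\<integral>p. (Z p)\<^sup>2 \<partial>(M \<Otimes>\<^sub>M M))"
    by (subst (asm) MM.variance_eq[OF Z1 Z2]) simp
  then show "(\<integral>p. Z p \<partial>(M \<Otimes>\<^sub>M M)) \<le> sqrt (\<integral>p. (Z p)\<^sup>2 \<partial>(M \<Otimes>\<^sub>M M))"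
    by (rule real_le_rsqrt)
qed

theorem theorem1:
  fixes M :: "'a measure"
    and X :: "'a \<Rightarrow> real ^ 'n"
    and \<Theta> :: "'a \<Rightarrow> real ^ 'n ^ 'k"
    and P :: "real ^ 'n ^ 'k \<Rightarrow> (real ^ 'k) measure"
    and \<gamma> :: real
  assumes "prob_space M"
    and "X \<in> borel_measurable M"
    and "integrable M (\<lambda>\<omega>. (norm (X \<omega>))\<^sup>2)"
    and "1 / real CARD('n) * (\<integral>\<omega>. (norm (X \<omega>))\<^sup>2 \<partial>M) = \<gamma>"
    and "\<gamma> > 0"
    and "prob_space.indep_vars M (\<lambda>_. borel) (\<lambda>(i, j) \<omega>. \<Theta> \<omega> $ i $ j) UNIV"
    and "\<And>i j. distributed M lborel (\<lambda>\<omega>. \<Theta> \<omega> $ i $ j)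
           (\<lambda>x. ennreal (normal_density 0 (sqrt (1 / real CARD('n))) x))"
    and "prob_space.indep_set M (sets (vimage_algebra (space M) \<Theta> borel))
           (sets (vimage_algebra (space M) X borel))"
    and "is_conditional_distribution M \<Theta> (\<lambda>\<omega>. \<Theta> \<omega> *v X \<omega>) P"
  shows "ennreal (1 / \<gamma>) * (\<integral>\<^sup>+\<omega>. (W2 (P (\<Theta> \<omega>)) (isotropic_gaussian \<gamma>))\<^sup>2 \<partial>M)
    \<le> ennreal (40 * real CARD('k) * (alpha M X / \<gamma>)
        + 40 * real CARD('k) powr (3 / 4) * (beta 1 M X / \<gamma>) powr (1 / 2)
        + 40 * real CARD('k) * (beta 2 M X / \<gamma>) powr (4 / (real CARD('k) + 4)))"
proof -
  note M = assms(1)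
  note X [measurable] = assms(2)
  note int = assms(3)
  note mean = assms(4)
  note \<gamma> = assms(5)
  note ind = assms(6)
  note dist = assms(7)
  note indep = assms(8)
  note P = assms(9)
  interpret prob_space M by fact
  interpret MM: pair_prob_space M M ..
  note \<Theta> [measurable] = distr_gaussian_entries(1)[OF M ind dist]
  note \<Theta>_distr = distr_gaussian_entries(2)[OF M ind dist]
  let ?T = "gaussian_matrix (1 / real CARD('n)) :: (real^'n^'k) measure"
  define n where "n = real CARD('n)"
  have n: "n > 0" by (simp add: n_def)
  define c where "c = 1 / sqrt \<gamma>"
  have c: "c > 0" "c\<^sup>2 = 1 / \<gamma>" "sqrt \<gamma> * c = 1" using \<gamma> by (simp_all add: c_def power_divide)
  \<comment> \<open>Normalised to second moment \<open>n\<close>, so that the target becomes the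
    standard normal law; \<open>law\<close> and \<open>isotropic_gaussian_scale\<close> undo
    this.\<close>
  define \<mu> where "\<mu> = distr M borel (\<lambda>\<omega>. c *\<^sub>R X \<omega>)"
  have \<mu>: "prob_space \<mu>" "sets \<mu> = sets borel"
    unfolding \<mu>_def by (auto intro!: prob_space_distr)
  interpret \<mu>: prob_space \<mu> by (rule \<mu>)
  note [measurable_cong] = \<mu>(2)
  define E where "E = (\<integral>\<omega>. (norm (X \<omega>))\<^sup>2 \<partial>M)"
  have E: "E = n * \<gamma>" using mean n by (auto simp: E_def n_def field_simps)
  have int_\<mu>: "(\<integral>\<^sup>+x. F x \<partial>\<mu>) = (\<integral>\<^sup>+\<omega>. F (c *\<^sub>R X \<omega>) \<partial>M)" if [measurable]: "F \<in> borel_measurable borel" for F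
    unfolding \<mu>_def by (rule nn_integral_distr) measurable
  have scale: "(norm (c *\<^sub>R x))\<^sup>2 / n = (norm x)\<^sup>2 / (n * \<gamma>)" for x :: "real^'n"
    using c n \<gamma> by (simp add: power_mult_distrib)
  have second: "(\<integral>\<^sup>+x. ennreal ((norm x)\<^sup>2 / real CARD('n)) \<partial>\<mu>) = 1"
  proof -
    have "(\<integral>\<^sup>+x. ennreal ((norm x)\<^sup>2 / n) \<partial>\<mu>) = (\<integral>\<^sup>+\<omega>. ennreal ((norm (X \<omega>))\<^sup>2 / (n * \<gamma>)) \<partial>M)"
      by (subst int_\<mu>) (simp_all only: scale, measurable)
    also have "\<dots> = ennreal (E / (n * \<gamma>))"
      unfolding E_def using int n \<gamma> by (subst nn_integral_eq_integral) auto
    also have "\<dots> = 1" using n \<gamma> by (simp add: E)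
    finally show ?thesis unfolding n_def .
  qed
  have alpha: "(\<integral>\<^sup>+x. ennreal \<bar>(norm x)\<^sup>2 / real CARD('n) - 1\<bar> \<partial>\<mu>) = ennreal (alpha M X / \<gamma>)"
  proof -
    have *: "\<bar>(norm (c *\<^sub>R x))\<^sup>2 / n - 1\<bar> = \<bar>(norm x)\<^sup>2 - E\<bar> / (n * \<gamma>)" for x :: "real^'n"
    proof -
      have "(norm (c *\<^sub>R x))\<^sup>2 / n - 1 = ((norm x)\<^sup>2 - E) / (n * \<gamma>)"
        unfolding scale E using n \<gamma> by (simp add: diff_divide_distrib)
      moreover have "\<bar>n * \<gamma>\<bar> = n * \<gamma>" using n \<gamma> by simp
      ultimately show ?thesis by (simp only: abs_divide)
    qed
    have "(\<integral>\<^sup>+x. ennreal \<bar>(norm x)\<^sup>2 / n - 1\<bar> \<partial>\<mu>) = (\<integral>\<^sup>+\<omega>. ennreal (\<bar>(norm (X \<omega>))\<^sup>2 - E\<bar> / (n * \<gamma>)) \<partial>M)"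
      by (subst int_\<mu>) (simp_all only: *, measurable)
    also have "\<dots> = ennreal ((\<integral>\<omega>. \<bar>(norm (X \<omega>))\<^sup>2 - E\<bar> \<partial>M) / (n * \<gamma>))"
      using int n \<gamma> by (subst nn_integral_eq_integral) auto
    also have "(\<integral>\<omega>. \<bar>(norm (X \<omega>))\<^sup>2 - E\<bar> \<partial>M) / (n * \<gamma>) = alpha M X / \<gamma>"
      by (simp add: alpha_def E_def n_def)
    finally show ?thesis unfolding n_def .
  qed
  have alpha_nonneg: "alpha M X / \<gamma> \<ge> 0"
    using \<gamma> by (simp add: alpha_def)
  let ?Z = "\<lambda>p. \<bar>X (fst p) \<bullet> X (snd p)\<bar>"
  note Z = correlation_moments[OF M X int]
  define b1 where "b1 = beta 1 M X / \<gamma>"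
  define b2 where "b2 = beta 2 M X / \<gamma>"
  have b1_eq: "b1 = (\<integral>p. ?Z p \<partial>(M \<Otimes>\<^sub>M M)) / (n * \<gamma>)"
    unfolding b1_def beta_def n_def by simp
  have b2_eq: "b2 = sqrt (\<integral>p. (?Z p)\<^sup>2 \<partial>(M \<Otimes>\<^sub>M M)) / (n * \<gamma>)"
    unfolding b2_def beta_def n_def by (simp add: powr_half_sqrt)
  have b: "b1 \<ge> 0" "b1 \<le> b2"
    unfolding b1_eq b2_eq using Z(3) n \<gamma> by (auto intro!: divide_right_mono divide_nonneg_nonneg)
  have scale_inner: "\<bar>(c *\<^sub>R x) \<bullet> (c *\<^sub>R x')\<bar> / n = \<bar>x \<bullet> x'\<bar> / (n * \<gamma>)" for x x' :: "real^'n"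
  proof -
    have "(c *\<^sub>R x) \<bullet> (c *\<^sub>R x') = c\<^sup>2 * (x \<bullet> x')" by (simp add: power2_eq_square)
    then show ?thesis using n \<gamma> unfolding c(2) by (simp add: abs_mult)
  qed
  \<comment> \<open>One transfer for both correlation moments, \<open>h\<close> being the identity
    or the square.\<close>
  have corr: "(\<integral>\<^sup>+x. \<integral>\<^sup>+x'. ennreal (h (\<bar>x \<bullet> x'\<bar> / n)) \<partial>\<mu> \<partial>\<mu>) = (\<integral>\<^sup>+p. ennreal (h (?Z p / (n * \<gamma>))) \<partial>(M \<Otimes>\<^sub>M M))"
    if [measurable]: "h \<in> borel_measurable borel" for h :: "real \<Rightarrow> real"
  proof -
    have "(\<integral>\<^sup>+x. \<integral>\<^sup>+x'. ennreal (h (\<bar>x \<bullet> x'\<bar> / n)) \<partial>\<mu> \<partial>\<mu>) =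
      (\<integral>\<^sup>+\<omega>. \<integral>\<^sup>+\<omega>'. ennreal (h (\<bar>(c *\<^sub>R X \<omega>) \<bullet> (c *\<^sub>R X \<omega>')\<bar> / n)) \<partial>M \<partial>M)"
      by (subst int_\<mu>, measurable, intro nn_integral_cong, subst int_\<mu>) simp_all
    also have "\<dots> = (\<integral>\<^sup>+p. ennreal (h (?Z p / (n * \<gamma>))) \<partial>(M \<Otimes>\<^sub>M M))"
      unfolding scale_inner by (subst nn_integral_fst[symmetric]) simp_all
    finally show ?thesis .
  qed
  have b1: "(\<integral>\<^sup>+x. \<integral>\<^sup>+x'. ennreal (\<bar>x \<bullet> x'\<bar> / real CARD('n)) \<partial>\<mu> \<partial>\<mu>) = ennreal b1"
    using corr[of "\<lambda>x. x"] Z(2) n \<gamma> unfolding b1_eq n_def[symmetric]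
    by (simp add: nn_integral_eq_integral)
  have b2: "(\<integral>\<^sup>+x. \<integral>\<^sup>+x'. ennreal ((\<bar>x \<bullet> x'\<bar> / real CARD('n))\<^sup>2) \<partial>\<mu> \<partial>\<mu>) = ennreal (b2\<^sup>2)"
  proof -
    have "(\<integral>\<^sup>+x. \<integral>\<^sup>+x'. ennreal ((\<bar>x \<bullet> x'\<bar> / n)\<^sup>2) \<partial>\<mu> \<partial>\<mu>) = (\<integral>\<^sup>+p. ennreal ((?Z p)\<^sup>2 / (n * \<gamma>)\<^sup>2) \<partial>(M \<Otimes>\<^sub>M M))"
      using corr[of "\<lambda>x. x\<^sup>2"] by (simp add: power_divide)
    also have "\<dots> = ennreal ((\<integral>p. (?Z p)\<^sup>2 \<partial>(M \<Otimes>\<^sub>M M)) / (n * \<gamma>)\<^sup>2)"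
      using Z(1) by (subst nn_integral_eq_integral) auto
    also have "(\<integral>p. (?Z p)\<^sup>2 \<partial>(M \<Otimes>\<^sub>M M)) / (n * \<gamma>)\<^sup>2 = b2\<^sup>2"
      unfolding b2_eq by (simp add: power_divide)
    finally show ?thesis unfolding n_def .
  qed
  have joint: "distr M borel \<Theta> \<Otimes>\<^sub>M distr M borel X = distr M (borel \<Otimes>\<^sub>M borel) (\<lambda>\<omega>. (\<Theta> \<omega>, X \<omega>))"
    by (rule joint_distribution_of_indep_set[OF M \<Theta> X indep])
  have law: "distr (distr M borel X) borel (\<lambda>x. \<theta> *v x) = distr (distr \<mu> borel (\<lambda>x. \<theta> *v x)) borel (\<lambda>z. sqrt \<gamma> *\<^sub>R z)" for \<theta> :: "real^'n^'k"
  proof -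
    have "sqrt \<gamma> *\<^sub>R (\<theta> *v (c *\<^sub>R x)) = \<theta> *v x" for x
      using c(3) by (simp add: matrix_vector_mult_scaleR)
    then show ?thesis unfolding \<mu>_def by (simp add: distr_distr comp_def)
  qed
  define L where "L = ennreal (1 / \<gamma>) * (\<integral>\<^sup>+\<omega>. (W2 (P (\<Theta> \<omega>)) (isotropic_gaussian \<gamma>))\<^sup>2 \<partial>M)"
  \<comment> \<open>Reduces the theorem to a measurable majorant of the normalised cost.
    Monotonicity of the integral holds for arbitrary integrands, so it applies to \<open>W2\<close>
    directly once \<open>P\<close> is replaced by the explicit law almost everywhere.\<close>
  have L: "L \<le> (\<integral>\<^sup>+\<theta>. F \<theta> \<partial>?T)"
    if [measurable]: "F \<in> borel_measurable borel"
      and F: "\<And>\<theta>. (W2 (distr \<mu> borel (\<lambda>x. \<theta> *v x)) (isotropic_gaussian 1))\<^sup>2 \<le> F \<theta>" for F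
  proof -
    have W: "(W2 (distr (distr M borel X) borel (\<lambda>x. \<theta> *v x)) (isotropic_gaussian \<gamma>))\<^sup>2 \<le> ennreal \<gamma> * F \<theta>" for \<theta> :: "real^'n^'k"
    proof -
      have "(W2 (distr (distr M borel X) borel (\<lambda>x. \<theta> *v x)) (isotropic_gaussian \<gamma>))\<^sup>2 \<le>
          ennreal ((sqrt \<gamma>)\<^sup>2) * (W2 (distr \<mu> borel (\<lambda>x. \<theta> *v x)) (isotropic_gaussian 1))\<^sup>2"
        unfolding law isotropic_gaussian_scale[OF \<gamma>, symmetric] using \<gamma>
        by (intro W2_square_scale) (simp_all add: isotropic_gaussian_def)
      also have "\<dots> \<le> ennreal \<gamma> * F \<theta>"
        using \<gamma> F[of \<theta>] by (intro mult_mono) auto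
      finally show ?thesis .
    qed
    have "AE \<omega> in M. P (\<Theta> \<omega>) = distr (distr M borel X) borel (\<lambda>x. \<Theta> \<omega> *v x)"
      using conditional_distribution_projection[OF M X \<Theta> joint P] by (rule AE_distrD[OF \<Theta>])
    then have "AE \<omega> in M. (W2 (P (\<Theta> \<omega>)) (isotropic_gaussian \<gamma>))\<^sup>2 \<le> ennreal \<gamma> * F (\<Theta> \<omega>)"
      by (rule AE_mp) (simp add: W)
    then have "(\<integral>\<^sup>+\<omega>. (W2 (P (\<Theta> \<omega>)) (isotropic_gaussian \<gamma>))\<^sup>2 \<partial>M) \<le> (\<integral>\<^sup>+\<omega>. ennreal \<gamma> * F (\<Theta> \<omega>) \<partial>M)"
      by (rule nn_integral_mono_AE)
    also have "\<dots> = ennreal \<gamma> * (\<integral>\<^sup>+\<theta>. F \<theta> \<partial>?T)"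
      unfolding \<Theta>_distr[symmetric] by (simp add: nn_integral_cmult nn_integral_distr)
    finally have "L \<le> ennreal (1 / \<gamma>) * (ennreal \<gamma> * (\<integral>\<^sup>+\<theta>. F \<theta> \<partial>?T))"
      unfolding L_def by (intro mult_left_mono) auto
    also have "\<dots> = (\<integral>\<^sup>+\<theta>. F \<theta> \<partial>?T)"
      using \<gamma> by (simp flip: mult.assoc ennreal_mult)
    finally show ?thesis .
  qed
  define k where "k = CARD('k)"
  have k: "k \<ge> 1" by (simp add: k_def Suc_le_eq)
  have triv: "L \<le> ennreal (real k * 4)"
  proof -
    obtain F :: "real^'n^'k \<Rightarrow> ennreal" where "F \<in> borel_measurable borel"
      "\<And>\<theta>. (W2 (distr \<mu> borel (\<lambda>x. \<theta> *v x)) (isotropic_gaussian 1))\<^sup>2 \<le> F \<theta>"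
      and F: "(\<integral>\<^sup>+\<theta>. F \<theta> \<partial>?T) \<le> ennreal (real CARD('k) * 4)"
      by (rule trivial_projection_cost[OF \<mu> second]; rule that; assumption)
    then have "L \<le> (\<integral>\<^sup>+\<theta>. F \<theta> \<partial>?T)" by (intro L)
    also note F
    finally show ?thesis unfolding k_def .
  qed
  \<comment> \<open>The trivial bound makes \<open>L\<close> finite, so nothing is lost in passing
    to a real number.\<close>
  define w where "w = enn2real L / real k"
  have "L < \<top>" using triv by (rule le_less_trans) simp
  then have Lw: "L = ennreal (real k * w)" using k by (simp add: w_def)
  have le: "w \<le> z" if "L \<le> ennreal (real k * z)" "z \<ge> 0" for z
    using that k unfolding Lw by (simp add: ennreal_le_iff)
  have "real k * w \<le> 40 * real k * (alpha M X / \<gamma>) + 40 * real k powr (3 / 4) * b1 powr (1 / 2)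
      + 40 * real k * b2 powr (4 / (real k + 4))"
  proof (rule optimise_smoothing[OF k alpha_nonneg b])
    show "w \<le> 4" by (rule le[OF triv]) simp
    fix t :: real assume t: "0 < t" "t < 1"
    \<comment> \<open>Abstracted over the dimension, to be read both at \<open>k\<close> and at
      \<open>CARD('k)\<close>.\<close>
    let ?z = "\<lambda>k. 5 * (alpha M X / \<gamma> + 2 * (1 - sqrt (1 - t))) + 5 * sqrt 3 *
        sqrt (2 * real k / 3 * corr_weight 0 ^ k * b1 + b2\<^sup>2 * corr_weight (1 - t) ^ k)"
    show "w \<le> ?z k"
    proof (rule le)
      obtain F :: "real^'n^'k \<Rightarrow> ennreal" where "F \<in> borel_measurable borel"
        "\<And>\<theta>. (W2 (distr \<mu> borel (\<lambda>x. \<theta> *v x)) (isotropic_gaussian 1))\<^sup>2 \<le> F \<theta>"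
        and F: "(\<integral>\<^sup>+\<theta>. F \<theta> \<partial>?T) \<le> ennreal (real CARD('k) * ?z CARD('k))"
        by (rule expected_projection_cost[OF \<mu> t alpha alpha_nonneg second b1 b(1) b2]; rule that; assumption)
      then have "L \<le> (\<integral>\<^sup>+\<theta>. F \<theta> \<partial>?T)" by (intro L)
      also note F
      finally show "L \<le> ennreal (real k * ?z k)" unfolding k_def .
      show "?z k \<ge> 0"
        using t b(1) corr_weight_pos[of 0] corr_weight_pos[of "1 - t"] alpha_nonneg
        by (intro add_nonneg_nonneg mult_nonneg_nonneg real_sqrt_ge_zero) auto
    qed
  qed
  then have "L \<le> ennreal (40 * real k * (alpha M X / \<gamma>) + 40 * real k powr (3 / 4) * b1 powr (1 / 2)
      + 40 * real k * b2 powr (4 / (real k + 4)))"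
    unfolding Lw by (rule ennreal_leI)
  then show ?thesis unfolding L_def k_def b1_def b2_def .
qed

end
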